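(* Let $k\ge a\ge1$. Let $\overline{O}_{k,a}(n)$ be the number of overpartitions $\lambda$ of $n$ counted by $\overline{B}_{k,a}(n)$ such that, for every cluster of the (left) cluster decomposition of its Gordon marking, the number of odd parts in the cluster minus $V_\lambda(l)$ is even, where $l$ is the $1$-marked part of the cluster. Write $N_i=n_i+\cdots+n_{k-1}$ for $1\le i\le k-1$ and $N_i=0$ for $i\ge k$. If $a$ is odd, then \[ \sum_{n\ge0}\overline{O}_{k,a}(n)q^n=\sum_{n_1,\ldots,n_{k-1}\ge0}\frac{q^{\frac{N_1(N_1+1)}{2}+N_2^2+\cdots+N_{k-1}^2+N_{a+1}+\cdots+N_{k-1}}\left(q^{N_a+n_1+n_3+\cdots+n_{a-2}}+q^{n_2+n_4+\cdots+n_{a-1}}\right)(-q)_{N_1-1}}{(q^2;q^2)_{n_1}\cdots(q^2;q^2)_{n_{k-1}}}. \] If $a$ is even, then \[ \sum_{n\ge0}\overline{O}_{k,a}(n)q^n=\sum_{n_1,\ldots,n_{k-1}\ge0}\frac{q^{\frac{N_1(N_1+1)}{2}+N_2^2+\cdots+N_{k-1}^2+N_a+N_{a+1}+\cdots+N_{k-1}}\left(q^{N_{a+1}+n_1+n_3+\cdots+n_{a-1}}+q^{n_2+n_4+\cdots+n_{a-2}}\right)(-q)_{N_1-1}}{(q^2;q^2)_{n_1}\cdots(q^2;q^2)_{n_{k-1}}}. \]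
   Context: Notation: $(a;q)_n=\prod_{i=0}^{n-1}(1-aq^i)$, $(a)_n=(a;q)_n$; for negative $n$, $(a;q)_n=(a;q)_\infty/(aq^n;q)_\infty$. Empty sums are $0$. Overpartitions: non-increasing sequences of positive integers where the first occurrence of each integer may be overlined. $\overline{B}_{k,a}(n)$ counts overpartitions $\lambda_1+\cdots+\lambda_s$ of $n$ in which $1$ occurs as a non-overlined part at most $a-1$ times and $\lambda_j-\lambda_{j+k-1}\ge1$ if $\lambda_j$ is overlined, $\ge2$ otherwise. $V_\lambda(l)$ is the number of overlined parts of $\lambda$ that are $\le l$. Gordon marking: assign positive integer marks to parts in the order $\overline1<1<\overline2<2<\cdots$, each as small as possible subject to: if $\overline{j+1}$ is not a part, then all parts $j,\overline j,j+1$ receive different marks; if $\overline{j+1}$ is a part, then the smallest mark assigned to a part $j$ or $\overline j$ may be used as the mark of $j+1$ or $\overline{j+1}$. An $r$-cluster is a sub-partition $\lambda_{i_1}\le\cdots\le\lambda_{i_r}$ with $\lambda_{i_j}$ $j$-marked, $\lambda_{i_{j+1}}-\lambda_{i_j}\le1$, and no $(r+1)$-marked part equal to $\lambda_{i_r}$ or $\lambda_{i_r}+1$. The (left) cluster decomposition is obtained by decomposing from left (smallest parts) to right, making clusters as long as possible, each part belonging to exactly one cluster.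
   Formalization: For even a, the exponent N_{a+1}+n_1+n_3+...+n_{a-1} in the bracketed factor is corrected to N_a+n_1+n_3+...+n_{a-1}; as printed the formula is false for even a<k (k=3, a=2: coefficient of q^3 is 4, but the count is 3). *)

theory Defs
  imports "HOL-Analysis.Analysis" "HOL-Computational_Algebra.Computational_Algebra"
begin

section \<open>The $q$-Pochhammer symbol\<close>

definition qpoch_inf :: "'a::{field, t2_space} \<Rightarrow> 'a \<Rightarrow> 'a" where
  "qpoch_inf a q = (\<Prod>i. 1 - a * q ^ i)"

definition qpoch :: "'a::{field, t2_space} \<Rightarrow> 'a \<Rightarrow> int \<Rightarrow> 'a" where
  "qpoch a q n =
     (if n \<ge> 0 then \<Prod>i<nat n. 1 - a * q ^ i
      else qpoch_inf a q / qpoch_inf (a * q powi n) q)"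

section \<open>Overpartitions\<close>

text \<open>A part is a pair of its size and a flag that is true iff the part is overlined.\<close>

type_synonym opart = "nat \<times> bool"

text \<open>
  Overpartitions are listed in non-increasing order; only the first occurrence of a size in this
  list may be overlined, so the overlined copy precedes the other parts of the same size.
\<close>

definition overpartition :: "opart list \<Rightarrow> bool" where
  "overpartition ps \<longleftrightarrow>
     (\<forall>p \<in> set ps. 0 < fst p) \<and>
     sorted_wrt (\<ge>) (map fst ps) \<and>
     (\<forall>i < length ps. snd (ps ! i) \<longrightarrow> (\<forall>j < i. fst (ps ! j) \<noteq> fst (ps ! i)))"

definition Bbar_set :: "nat \<Rightarrow> nat \<Rightarrow> nat \<Rightarrow> opart list set" where
  "Bbar_set k a n =
     {ps. overpartition ps \<and> sum_list (map fst ps) = n \<and>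
          count_list ps (1, False) \<le> a - 1 \<and>
          (\<forall>j. j + k - 1 < length ps \<longrightarrow>
             int (fst (ps ! j)) - int (fst (ps ! (j + k - 1)))
               \<ge> (if snd (ps ! j) then 1 else 2))}"

definition V :: "opart list \<Rightarrow> nat \<Rightarrow> nat" where
  "V ps l = length (filter (\<lambda>p. snd p \<and> fst p \<le> l) ps)"

section \<open>The Gordon marking\<close>

text \<open>A marked part is a part together with its mark.\<close>

type_synonym mpart = "opart \<times> nat"

abbreviation psize :: "mpart \<Rightarrow> nat" where "psize p \<equiv> fst (fst p)"
abbreviation pmark :: "mpart \<Rightarrow> nat" where "pmark p \<equiv> snd p"

text \<open>This key sorts parts by size, the overlined copy before the others of the same size;
  note that this is not the reverse of the order used in \<open>overpartition\<close>.\<close>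

definition gordon_key :: "opart \<Rightarrow> nat" where
  "gordon_key p = 2 * fst p + (if snd p then 0 else 1)"

definition marks_at :: "mpart list \<Rightarrow> nat \<Rightarrow> nat set" where
  "marks_at M s = {pmark p | p. p \<in> set M \<and> psize p = s}"

text \<open>
  The marks not available to the next part of size \<open>s\<close> of \<open>ps\<close>, when the parts in \<open>M\<close> are already
  marked: those of parts of size \<open>s\<close>, and those of parts of size \<open>s - 1\<close>, except that
  the smallest of the latter becomes available again if \<open>ps\<close> has an overlined part of size \<open>s\<close>.
\<close>

definition forbidden_marks :: "opart list \<Rightarrow> mpart list \<Rightarrow> nat \<Rightarrow> nat set" where
  "forbidden_marks ps M s =
     marks_at M s \<union>
     (if (s, True) \<in> set ps then marks_at M (s - 1) - {Min (marks_at M (s - 1))}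
      else marks_at M (s - 1))"

fun mark_from :: "opart list \<Rightarrow> mpart list \<Rightarrow> opart list \<Rightarrow> mpart list" where
  "mark_from ps M [] = M"
| "mark_from ps M (p # rest) =
     mark_from ps (M @ [(p, LEAST r. 1 \<le> r \<and> r \<notin> forbidden_marks ps M (fst p))]) rest"

definition gordon_marking :: "opart list \<Rightarrow> mpart list" where
  "gordon_marking ps = mark_from ps [] (sort_key gordon_key ps)"

section \<open>Clusters\<close>

text \<open>
  Equal parts receive different marks, so the Gordon marking may be treated as a set of marked
  parts. The cluster \<open>c\<close> is listed by increasing marks, so its first element is its
  1-marked part.
\<close>

definition cluster :: "mpart set \<Rightarrow> mpart list \<Rightarrow> bool" where
  "cluster M c \<longleftrightarrow>
     c \<noteq> [] \<and> set c \<subseteq> M \<and>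
     (\<forall>j < length c. pmark (c ! j) = Suc j) \<and>
     (\<forall>j. Suc j < length c \<longrightarrow>
        psize (c ! j) \<le> psize (c ! Suc j) \<and> psize (c ! Suc j) \<le> psize (c ! j) + 1) \<and>
     \<not> (\<exists>p \<in> M. pmark p = length c + 1 \<and>
          (psize p = psize (last c) \<or> psize p = psize (last c) + 1))"

text \<open>
  Left to right decomposition: the next cluster starts at the smallest 1-marked part that is left,
  and is a cluster of the set \<open>M\<close> of parts that do not belong to an earlier cluster.
  The final clause of \<open>cluster\<close> thus says that it cannot be prolonged by an unused part.
  For example, the parts 1, 2, 2 with the first two overlined have marks 1, 1, 2, and the clusters
  are formed by the overlined 1 with the plain 2, and by the overlined 2 alone.
\<close>

inductive left_decomposition :: "mpart set \<Rightarrow> mpart list list \<Rightarrow> bool" where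
  empty: "left_decomposition {} []"
| step: "cluster M c \<Longrightarrow> (\<And>p. p \<in> M \<Longrightarrow> pmark p = 1 \<Longrightarrow> psize (hd c) \<le> psize p) \<Longrightarrow>
         left_decomposition (M - set c) cs \<Longrightarrow> left_decomposition M (c # cs)"

definition parity_condition :: "opart list \<Rightarrow> mpart list \<Rightarrow> bool" where
  "parity_condition ps c \<longleftrightarrow>
     even (int (length (filter (\<lambda>p. odd (psize p)) c)) - int (V ps (psize (hd c))))"

text \<open>The Gordon marking of an overpartition has exactly one left decomposition \<open>cs\<close>.\<close>

definition Obar :: "nat \<Rightarrow> nat \<Rightarrow> nat \<Rightarrow> nat" where
  "Obar k a n =
     card {ps \<in> Bbar_set k a n.
       \<exists>cs. left_decomposition (set (gordon_marking ps)) cs \<and>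
            (\<forall>c \<in> set cs. parity_condition ps c)}"

definition Obar_gf :: "nat \<Rightarrow> nat \<Rightarrow> rat fls" where
  "Obar_gf k a = fps_to_fls (Abs_fps (\<lambda>n. of_nat (Obar k a n)))"

section \<open>The multisums\<close>

text \<open>The sum is empty, hence zero, for \<open>i \<ge> k\<close>.\<close>

definition N :: "nat \<Rightarrow> (nat \<Rightarrow> nat) \<Rightarrow> nat \<Rightarrow> nat" where
  "N k n i = (\<Sum>j = i..k - 1. n j)"

text \<open>
  A correction for even \<open>a\<close>. The printed formula has the factor
  $q^{N_{a+1} + n_1 + n_3 + \cdots + n_{a-1}} + q^{n_2 + n_4 + \cdots + n_{a-2}}$;
  the theorem has $N_a$ in place of that $N_{a+1}$, as in the formula for odd \<open>a\<close>.
  With $N_{a+1}$ the two formulas contradict each other: for \<open>k = 3\<close> the coefficient of $q^3$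
  would be 4 for \<open>a = 2\<close> and 3 for \<open>a = 3\<close>, although \<open>Bbar_set 3 2 3 \<subseteq> Bbar_set 3 3 3\<close> and the
  condition on the clusters does not involve \<open>a\<close>.
\<close>

end

theory Submission
  imports Defs
begin

text \<open>
  The parity condition on all clusters is equivalent to a local one: at each odd size it only
  restricts the number of plain parts of that size, in terms of the parity of the number of
  smaller overlined parts and of whether the preceding size carries a 1-marked part. Listing the
  multiplicities by size thus turns the overpartitions into the words of an automaton, and the
  generating functions with a fixed number \<open>L\<close> of clusters are determined by a linear recursion
  in the smallest admissible size. Without overlined parts the recursion is solved by multisums
  with linear exponents; this rests on a three-term relation between such sums. Passing from \<open>L\<close>
  to \<open>L + 1\<close> clusters, the overlined parts contribute the factor $1 + q^{-(L + 1)}$, because the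
  words whose clusters all continue from the preceding size satisfy a shift identity. So the
  overlined parts account for $(-q)_{L-1}$, at the cost of $q^{-L(L-1)/2}$, times the sum of the
  two barless series for the two parities.
\<close>

text \<open>A cluster can run through many sizes, so its parity condition is not visibly local. Two
  facts localize it. Parts of even size do not change the parity of the sum of a cluster, so the
  conditions sit at odd sizes. And the sums accumulated by the clusters up to their last parts of
  one odd size have a total that telescopes: it depends only on the number of parts there, on the
  overlined parts and on the clusters entering from the preceding size. As the clusters other than
  the one with the largest mark can be settled separately, this total decides the remaining one.

  The linear exponents are guessed, not derived: the coefficient of n_r, increased by r, is the
  least sum of the required parity that r plain parts can have within the bounds. Checking the
  recursion for this guess is algebra with multisums. At even sizes one three-term relation per step
  is enough. At odd sizes only every second bound changes the set of admissible words, and three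
  neighbouring relations have to be combined to eliminate the sums in between.\<close>

unbundle no vec_syntax

section \<open>The multisums\<close>

text \<open>The total of the entries is \<open>N k n 1\<close>. Fixing it as \<open>L\<close>, later
  the number of clusters, makes N_1 constant, so that $(-q)_{N_1-1}$ can be taken out of the
  sum.\<close>

definition comps :: "nat \<Rightarrow> nat \<Rightarrow> (nat \<Rightarrow> nat) set" where
  "comps k L = {n \<in> {1..k - 1} \<rightarrow>\<^sub>E UNIV. sum n {1..k - 1} = L}"

text \<open>This is $(q^2;q^2)_m$.\<close>

definition qden :: "nat \<Rightarrow> rat fps" where
  "qden m = (\<Prod>i<m. 1 - fps_X ^ (2 * Suc i))"

definition msum_term :: "nat \<Rightarrow> (nat \<Rightarrow> nat) \<Rightarrow> (nat \<Rightarrow> nat) \<Rightarrow> rat fps" where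
  "msum_term k c n =
     fps_X ^ ((\<Sum>i = 1..k - 1. (N k n i)\<^sup>2) + (\<Sum>r = 1..k - 1. c r * n r)) *
     (\<Prod>r = 1..k - 1. inverse (qden (n r)))"

definition msum :: "nat \<Rightarrow> nat \<Rightarrow> (nat \<Rightarrow> nat) \<Rightarrow> rat fps" where
  "msum k L c = (\<Sum>n \<in> comps k L. msum_term k c n)"

text \<open>The value 0 at \<open>L = 0\<close> stands for the impossible removal of a cluster, so
  that the recursions hold for all \<open>L\<close>.\<close>

definition msum_pred :: "nat \<Rightarrow> nat \<Rightarrow> (nat \<Rightarrow> nat) \<Rightarrow> rat fps" where
  "msum_pred k L c = (if L = 0 then 0 else msum k (L - 1) c)"

lemma msum_cong:
  assumes "\<And>r. 1 \<le> r \<Longrightarrow> r \<le> k - 1 \<Longrightarrow> c r = d r"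
  shows "msum k L c = msum k L d"
  unfolding msum_def msum_term_def using assms by (auto intro!: sum.cong)

lemma msum_pred_cong:
  assumes "\<And>r. 1 \<le> r \<Longrightarrow> r \<le> k - 1 \<Longrightarrow> c r = d r"
  shows "msum_pred k L c = msum_pred k L d"
  unfolding msum_pred_def using msum_cong[OF assms] by auto

lemma finite_comps [simp]: "finite (comps k L)"
proof -
  have "comps k L \<subseteq> {1..k - 1} \<rightarrow>\<^sub>E {..L}"
  proof
    fix n assume n: "n \<in> comps k L"
    have "n r \<le> L" if "r \<in> {1..k - 1}" for r
    proof -
      have "n r \<le> sum n {1..k - 1}" using that by (intro member_le_sum) auto
      with n show ?thesis by (simp add: comps_def)
    qed
    with n show "n \<in> {1..k - 1} \<rightarrow>\<^sub>E {..L}" by (auto simp: comps_def PiE_iff)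
  qed
  then show ?thesis by (rule finite_subset) (auto intro: finite_PiE)
qed

lemma qden_nth_0: "qden m $ 0 = 1"
  unfolding qden_def by (induction m) (auto simp: fps_mult_nth_0)

lemma msum_0 [simp]: "msum k 0 c = 1"
proof -
  have "comps k 0 = {\<lambda>r\<in>{1..k - 1}. 0}"
    unfolding comps_def by (auto simp: PiE_iff extensional_def fun_eq_iff restrict_def)
  then show ?thesis
    by (simp add: msum_def msum_term_def N_def qden_def)
qed

lemma N_upd:
  assumes "1 \<le> r" "r \<le> k - 1"
  shows "N k (n(r := Suc (n r))) i = N k n i + (if i \<le> r then 1 else 0)"
proof (cases "i \<le> r")
  case True
  have "N k (n(r := Suc (n r))) i = (\<Sum>j = i..k - 1. n j + (if j = r then 1 else 0))"
    unfolding N_def by (intro sum.cong) auto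
  also have "\<dots> = N k n i + 1" using True assms by (simp add: sum.distrib N_def)
  finally show ?thesis using True by simp
next
  case False
  then show ?thesis unfolding N_def by (auto intro!: sum.cong)
qed

lemma sum_N_min:
  assumes "r \<le> k - 1"
  shows "(\<Sum>i = 1..r. N k n i) = (\<Sum>s = 1..k - 1. min r s * n s)"
proof -
  have "(\<Sum>i = 1..r. N k n i) = (\<Sum>i = 1..r. \<Sum>s = 1..k - 1. if i \<le> s then n s else 0)"
    unfolding N_def
    by (intro sum.cong refl sum.mono_neutral_cong_left) auto
  also have "\<dots> = (\<Sum>s = 1..k - 1. \<Sum>i = 1..r. if i \<le> s then n s else 0)"
    by (rule sum.swap)
  also have "\<dots> = (\<Sum>s = 1..k - 1. min r s * n s)"
  proof (intro sum.cong refl)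
    fix s assume "s \<in> {1..k - 1}"
    have "(\<Sum>i = 1..r. if i \<le> s then n s else 0) = (\<Sum>i \<in> {1..min r s}. n s)"
      by (intro sum.mono_neutral_cong_right) auto
    then show "(\<Sum>i = 1..r. if i \<le> s then n s else 0) = min r s * n s" by simp
  qed
  finally show ?thesis .
qed

lemma sum_sq_upd:
  assumes "1 \<le> r" "r \<le> k - 1"
  shows "(\<Sum>i = 1..k - 1. (N k (n(r := Suc (n r))) i)\<^sup>2) =
         (\<Sum>i = 1..k - 1. (N k n i)\<^sup>2) + (\<Sum>s = 1..k - 1. 2 * min r s * n s) + r"
proof -
  have "(\<Sum>i = 1..k - 1. (N k (n(r := Suc (n r))) i)\<^sup>2) =
        (\<Sum>i = 1..k - 1. (N k n i)\<^sup>2 + (if i \<le> r then 2 * N k n i + 1 else 0))"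
    by (intro sum.cong refl) (auto simp: N_upd[OF assms] power2_eq_square algebra_simps)
  also have "\<dots> = (\<Sum>i = 1..k - 1. (N k n i)\<^sup>2) + (\<Sum>i = 1..k - 1. if i \<le> r then 2 * N k n i + 1 else 0)"
    by (rule sum.distrib)
  also have "(\<Sum>i = 1..k - 1. if i \<le> r then 2 * N k n i + 1 else 0) = (\<Sum>i = 1..r. 2 * N k n i + 1)"
    using assms by (intro sum.mono_neutral_cong_right) auto
  also have "\<dots> = 2 * (\<Sum>i = 1..r. N k n i) + r"
    unfolding sum.distrib sum_distrib_left by simp
  also have "\<dots> = (\<Sum>s = 1..k - 1. 2 * min r s * n s) + r"
    unfolding sum_N_min[OF assms(2)] by (simp add: sum_distrib_left mult.assoc)
  finally show ?thesis by (simp only: add.assoc)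
qed

lemma qden_Suc: "(1 - fps_X ^ (2 * Suc m)) * inverse (qden (Suc m)) = inverse (qden m)"
proof -
  have "(1 - fps_X ^ (2 * Suc m) :: rat fps) * inverse (1 - fps_X ^ (2 * Suc m)) = 1"
    by (rule inverse_mult_eq_1') (simp add: fps_X_power_nth)
  then show ?thesis
    unfolding qden_def by (simp add: fps_inverse_mult mult.commute mult.left_commute)
qed

text \<open>Each term gets the factor $1 - q^{2 n_r}$, which kills the terms with n_r = 0 and
  cancels the last factor of $(q^2;q^2)_{n_r}$ in the others. Replacing n_r by n_r + 1 there raises
  N_1, ..., N_r by one, and the squares grow by $r + 2 (N_1 + ... + N_r)$, whence the weights 2
  min(r, s).\<close>

lemma msum_rec_Suc:
  assumes r: "1 \<le> r" "r \<le> k - 1"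
  shows "msum k (Suc L) c - msum k (Suc L) (c(r := c r + 2)) =
         fps_X ^ (r + c r) * msum k L (\<lambda>s. c s + 2 * min r s)"
proof -
  let ?I = "{1..k - 1}"
  let ?up = "\<lambda>n. n(r := Suc (n r))"
  have rI: "r \<in> ?I" using r by auto
  have cr: "(\<Sum>s\<in>?I. (c(r := c r + 2)) s * n s) = (\<Sum>s\<in>?I. c s * n s) + 2 * n r" for n
  proof -
    have "(\<Sum>s\<in>?I. (c(r := c r + 2)) s * n s) = (\<Sum>s\<in>?I. c s * n s + (if s = r then 2 * n r else 0))"
      by (intro sum.cong) (auto simp: algebra_simps)
    then show ?thesis using rI by (simp add: sum.distrib)
  qed
  have t: "msum_term k c n - msum_term k (c(r := c r + 2)) n = (1 - fps_X ^ (2 * n r)) * msum_term k c n" for n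
    unfolding msum_term_def cr by (simp add: power_add algebra_simps)
  have "msum k (Suc L) c - msum k (Suc L) (c(r := c r + 2)) =
        (\<Sum>n \<in> comps k (Suc L). (1 - fps_X ^ (2 * n r)) * msum_term k c n)"
    unfolding msum_def by (simp only: sum_subtractf[symmetric] t)
  also have "\<dots> = (\<Sum>n \<in> ?up ` comps k L. (1 - fps_X ^ (2 * n r)) * msum_term k c n)"
  proof (intro sum.mono_neutral_right ballI)
    show "?up ` comps k L \<subseteq> comps k (Suc L)"
    proof
      fix m assume "m \<in> ?up ` comps k L"
      then obtain n where n: "n \<in> comps k L" "m = ?up n" by auto
      have "sum m ?I = (\<Sum>s\<in>?I. n s + (if s = r then 1 else 0))"
        unfolding n(2) by (intro sum.cong) auto
      also have "\<dots> = Suc L" using n(1) rI by (simp add: sum.distrib comps_def)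
      finally show "m \<in> comps k (Suc L)" using n rI by (auto simp: comps_def PiE_iff extensional_def)
    qed
  next
    fix m assume m: "m \<in> comps k (Suc L) - ?up ` comps k L"
    have "m r = 0"
    proof (rule ccontr)
      assume nz: "m r \<noteq> 0"
      let ?n = "m(r := m r - 1)"
      have "Suc (sum ?n ?I) = (\<Sum>s\<in>?I. ?n s + (if s = r then 1 else 0))"
        using rI by (simp add: sum.distrib)
      also have "\<dots> = sum m ?I" using nz by (intro sum.cong) auto
      finally have "?n \<in> comps k L" using m rI by (auto simp: comps_def PiE_iff extensional_def)
      moreover have "m = ?up ?n" using nz by auto
      ultimately show False using m by blast
    qed
    then show "(1 - fps_X ^ (2 * m r)) * msum_term k c m = 0" by simp
  qed auto
  also have "\<dots> = (\<Sum>n \<in> comps k L. (1 - fps_X ^ (2 * Suc (n r))) * msum_term k c (?up n))"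
  proof -
    have "inj_on ?up (comps k L)"
    proof (intro inj_onI ext)
      fix n m :: "nat \<Rightarrow> nat" and s assume "?up n = ?up m"
      then have "?up n s = ?up m s" by (rule fun_cong)
      then show "n s = m s" by (cases "s = r") auto
    qed
    then show ?thesis by (subst sum.reindex) (auto simp: o_def)
  qed
  also have "\<dots> = (\<Sum>n \<in> comps k L. fps_X ^ (r + c r) * msum_term k (\<lambda>s. c s + 2 * min r s) n)"
  proof (intro sum.cong refl)
    fix n assume "n \<in> comps k L"
    have e1: "(\<Sum>s\<in>?I. c s * ?up n s) = (\<Sum>s\<in>?I. c s * n s) + c r"
    proof -
      have "(\<Sum>s\<in>?I. c s * ?up n s) = (\<Sum>s\<in>?I. c s * n s + (if s = r then c r else 0))"
        by (intro sum.cong) (auto simp: algebra_simps)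
      then show ?thesis using rI by (simp add: sum.distrib)
    qed
    have e2: "(\<Sum>s\<in>?I. (c s + 2 * min r s) * n s) = (\<Sum>s\<in>?I. c s * n s) + (\<Sum>s\<in>?I. 2 * min r s * n s)"
      by (simp add: sum.distrib[symmetric] algebra_simps)
    have p: "(1 - fps_X ^ (2 * Suc (n r))) * (\<Prod>s\<in>?I. inverse (qden (?up n s))) =
             (\<Prod>s\<in>?I. inverse (qden (n s)))"
    proof -
      have "(\<Prod>s\<in>?I. inverse (qden (?up n s))) =
            inverse (qden (Suc (n r))) * (\<Prod>s\<in>?I - {r}. inverse (qden (n s)))"
        using rI by (subst prod.remove[of _ r]) auto
      then have "(1 - fps_X ^ (2 * Suc (n r))) * (\<Prod>s\<in>?I. inverse (qden (?up n s))) =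
            inverse (qden (n r)) * (\<Prod>s\<in>?I - {r}. inverse (qden (n s)))"
        by (metis mult.assoc qden_Suc)
      also have "\<dots> = (\<Prod>s\<in>?I. inverse (qden (n s)))"
        using rI by (subst (2) prod.remove[of _ r]) auto
      finally show ?thesis .
    qed
    have "(1 - fps_X ^ (2 * Suc (n r))) * msum_term k c (?up n) =
          fps_X ^ ((\<Sum>i = 1..k - 1. (N k n i)\<^sup>2) + (\<Sum>s\<in>?I. 2 * min r s * n s) + r + ((\<Sum>s\<in>?I. c s * n s) + c r)) *
          ((1 - fps_X ^ (2 * Suc (n r))) * (\<Prod>s\<in>?I. inverse (qden (?up n s))))"
      unfolding msum_term_def sum_sq_upd[OF r] e1 by (simp only: mult_ac)
    also have "\<dots> = fps_X ^ (r + c r) * msum_term k (\<lambda>s. c s + 2 * min r s) n"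
      unfolding p msum_term_def e2 by (simp add: power_add mult_ac)
    finally show "(1 - fps_X ^ (2 * Suc (n r))) * msum_term k c (?up n) =
          fps_X ^ (r + c r) * msum_term k (\<lambda>s. c s + 2 * min r s) n" .
  qed
  also have "\<dots> = fps_X ^ (r + c r) * msum k L (\<lambda>s. c s + 2 * min r s)"
    by (simp add: msum_def sum_distrib_left)
  finally show ?thesis .
qed

lemma msum_rec:
  assumes r: "1 \<le> r" "r \<le> k - 1"
  shows "msum k L c - msum k L (c(r := c r + 2)) =
         fps_X ^ (r + c r) * msum_pred k L (\<lambda>s. c s + 2 * min r s)"
  using msum_rec_Suc[OF r] by (cases L) (auto simp: msum_pred_def)

section \<open>The three-term relation\<close>

definition stair :: "nat \<Rightarrow> nat \<Rightarrow> nat" where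
  "stair i r = (if i \<le> r \<and> even (r + i) then 1 else 0)"

definition stair_seg :: "nat \<Rightarrow> nat \<Rightarrow> nat \<Rightarrow> nat" where
  "stair_seg i r t = (if i \<le> t \<and> t < r \<and> even (t + i) then 1 else 0)"

text \<open>The number of t with $i <= t <= r$ that have the parity of r, that is, the sum of
  \<open>stair t r\<close> over all t from i on.\<close>

definition stair_sum :: "nat \<Rightarrow> nat \<Rightarrow> nat" where
  "stair_sum i r = (r + 2 - i) div 2"

lemma stair_sum_rec: "stair_sum i r = stair_sum (Suc i) r + stair i r"
proof (cases "i \<le> r")
  case True
  then obtain d where "r = i + d" using le_Suc_ex by blast
  then show ?thesis unfolding stair_sum_def stair_def by (simp; presburger)
next
  case False
  then have "r + 2 - i = 0 \<or> r + 2 - i = 1" "r + 2 - Suc i = 0" by linarith+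
  with False show ?thesis unfolding stair_sum_def stair_def by auto
qed

lemma stair_sum_even: "i \<le> r \<Longrightarrow> even (r + i) \<Longrightarrow> 2 * stair_sum (Suc i) r = r - i"
  unfolding stair_sum_def by (auto elim!: evenE simp: le_iff_add)

lemma min_stair: "1 \<le> r \<Longrightarrow> min r t = min (r - 1) t + stair r t + stair (Suc r) t"
  unfolding stair_def by (cases "t = r") (auto simp: min_def)

lemma stair_split:
  assumes "i \<le> r" "even (r + i)"
  shows "stair i t = stair r t + stair_seg i r t"
  using assms unfolding stair_def stair_seg_def by auto

text \<open>The weights at i, i + 2, ... are raised by 2 one after another, the largest index first,
  each time by \<open>msum_rec\<close>; so the term for r already carries the raised weights above
  r.\<close>

lemma msum_telescope_up:
  assumes "1 \<le> i"
  shows "msum k L c - msum k L (\<lambda>s. c s + 2 * stair i s) =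
    (\<Sum>r | i \<le> r \<and> r \<le> k - 1 \<and> even (r + i).
       fps_X ^ (r + c r) * msum_pred k L (\<lambda>s. c s + 2 * stair (r + 2) s + 2 * min r s))"
  using assms
proof (induction "k - i" arbitrary: i rule: less_induct)
  case less
  show ?case
  proof (cases "i \<le> k - 1")
    case False
    have e1: "msum k L (\<lambda>s. c s + 2 * stair i s) = msum k L c"
      using False by (intro msum_cong) (auto simp: stair_def)
    have e2: "{r. i \<le> r \<and> r \<le> k - 1 \<and> even (r + i)} = {}" using False by auto
    show ?thesis unfolding e1 e2 by simp
  next
    case True
    let ?I = "\<lambda>i. {r. i \<le> r \<and> r \<le> k - 1 \<and> even (r + i)}"
    let ?f = "\<lambda>r. fps_X ^ (r + c r) * msum_pred k L (\<lambda>s. c s + 2 * stair (r + 2) s + 2 * min r s)"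
    let ?c = "\<lambda>s. c s + 2 * stair (i + 2) s"
    have IH: "msum k L c - msum k L ?c = sum ?f (?I (i + 2))"
      using True less.prems less.hyps[of "i + 2"] by auto
    have upd: "?c(i := ?c i + 2) = (\<lambda>s. c s + 2 * stair i s)"
    proof
      fix s
      show "(?c(i := ?c i + 2)) s = c s + 2 * stair i s"
        by (cases "s = i"; cases "s = Suc i") (auto simp: stair_def)
    qed
    have "msum k L ?c - msum k L (\<lambda>s. c s + 2 * stair i s) =
          fps_X ^ (i + ?c i) * msum_pred k L (\<lambda>s. ?c s + 2 * min i s)"
      using msum_rec[of i k L ?c] True less.prems unfolding upd by auto
    also have "\<dots> = ?f i" by (simp add: stair_def)
    finally have 2: "msum k L ?c - msum k L (\<lambda>s. c s + 2 * stair i s) = ?f i" .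
    have "x = i \<or> i + 2 \<le> x" if "i \<le> x" "even (x + i)" for x
      using that by (cases "x = i + 1") auto
    then have "?I i = insert i (?I (i + 2))" using True by auto
    moreover have "finite (?I (i + 2))" by (rule finite_subset[of _ "{..k}"]) auto
    ultimately have "sum ?f (?I i) = ?f i + sum ?f (?I (i + 2))" by simp
    with IH 2 show ?thesis by (simp add: algebra_simps)
  qed
qed

text \<open>The same from the smallest index upward: here the term for r carries the raised weights
  below r. Both orders are required to match the two expansions in
  \<open>msum_three_term\<close>.\<close>

lemma msum_telescope_down:
  assumes "1 \<le> i" "i + 2 * d \<le> k + 1"
  shows "msum k L c - msum k L (\<lambda>s. c s + 2 * stair_seg i (i + 2 * d) s) =
    (\<Sum>r | i \<le> r \<and> r < i + 2 * d \<and> even (r + i).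
       fps_X ^ (r + c r) * msum_pred k L (\<lambda>s. c s + 2 * stair_seg i r s + 2 * min r s))"
  using assms(2)
proof (induction d)
  case 0
  have e1: "{r. i \<le> r \<and> r < i + 2 * 0 \<and> even (r + i)} = {}" by auto
  have e2: "stair_seg i (i + 2 * 0) = (\<lambda>s. 0)" unfolding stair_seg_def by auto
  show ?case unfolding e1 e2 by simp
next
  case (Suc d)
  let ?I = "\<lambda>d. {r. i \<le> r \<and> r < i + 2 * d \<and> even (r + i)}"
  let ?f = "\<lambda>r. fps_X ^ (r + c r) * msum_pred k L (\<lambda>s. c s + 2 * stair_seg i r s + 2 * min r s)"
  let ?r = "i + 2 * d"
  let ?c = "\<lambda>s. c s + 2 * stair_seg i ?r s"
  have IH: "msum k L c - msum k L ?c = sum ?f (?I d)"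
    using Suc by auto
  have upd: "?c(?r := ?c ?r + 2) = (\<lambda>s. c s + 2 * stair_seg i (i + 2 * Suc d) s)"
  proof
    fix s
    show "(?c(?r := ?c ?r + 2)) s = c s + 2 * stair_seg i (i + 2 * Suc d) s"
      by (cases "s = ?r"; cases "s = Suc ?r") (auto simp: stair_seg_def)
  qed
  have "msum k L ?c - msum k L (\<lambda>s. c s + 2 * stair_seg i (i + 2 * Suc d) s) =
        fps_X ^ (?r + ?c ?r) * msum_pred k L (\<lambda>s. ?c s + 2 * min ?r s)"
    using msum_rec[of ?r k L ?c] Suc.prems assms(1) unfolding upd by auto
  also have "\<dots> = ?f ?r" by (simp add: stair_seg_def)
  finally have 2: "msum k L ?c - msum k L (\<lambda>s. c s + 2 * stair_seg i (i + 2 * Suc d) s) = ?f ?r" .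
  have "x < ?r \<or> x = ?r" if "x < i + 2 * Suc d" "even (x + i)" for x
    using that by (cases "x = Suc ?r") auto
  then have "?I (Suc d) = insert ?r (?I d)" by auto
  moreover have "finite (?I d)" by (rule finite_subset[of _ "{..i + 2 * d}"]) auto
  ultimately have "sum ?f (?I (Suc d)) = ?f ?r + sum ?f (?I d)" by simp
  with IH 2 show ?case by (simp add: algebra_simps)
qed

text \<open>Expanding both differences by removing one cluster at a time leaves a double sum over pairs
  of removed clusters, whose terms cancel against their transposes.\<close>

lemma msum_three_term:
  fixes k L i d :: nat and W :: "nat \<Rightarrow> nat"
  assumes i: "2 \<le> i" "i \<le> k"
    and W: "\<And>r. i \<le> r \<Longrightarrow> r \<le> k \<Longrightarrow> even (r + i) \<Longrightarrow> d + W (r - 1) = 1 + W r"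
  defines "\<Theta> \<equiv> \<lambda>i. msum k L (\<lambda>s. W s + 2 * stair_sum i s)"
  shows "fps_X ^ d * (\<Theta> i - \<Theta> (i - 1)) - (\<Theta> (Suc i) - \<Theta> i) =
    (if even (k + i) then fps_X ^ (2 * k - i + W k) * msum_pred k L (\<lambda>s. W s + 2 * stair_sum i s + 2 * s)
     else 0)"
proof -
  define I where "I = {r. i \<le> r \<and> r \<le> k - 1 \<and> even (r + i)}"
  define J where "J = {r. i \<le> r \<and> r \<le> k \<and> even (r + i)}"
  define E where "E r = W r + (2 * r - i)" for r
  define U where "U r = msum_pred k L (\<lambda>s. W s + 2 * stair_sum i s + 2 * stair (r + 1) s + 2 * min (r - 1) s)" for r
  define V where "V r = msum_pred k L (\<lambda>s. W s + 2 * stair_sum (Suc i) s + 2 * stair (r + 2) s + 2 * min r s)" for r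
  have fin: "finite I" "finite J" unfolding I_def J_def by (auto intro: finite_subset[of _ "{..k}"])
  have d1: "\<Theta> (Suc i) - \<Theta> i = (\<Sum>r\<in>I. fps_X ^ E r * V r)"
  proof -
    have "\<Theta> (Suc i) - \<Theta> i = (\<Sum>r\<in>I. fps_X ^ (r + (W r + 2 * stair_sum (Suc i) r)) * V r)"
      using msum_telescope_up[of i k L "\<lambda>s. W s + 2 * stair_sum (Suc i) s"] i
      unfolding \<Theta>_def I_def V_def stair_sum_rec[of i] by (simp add: algebra_simps)
    also have "\<dots> = (\<Sum>r\<in>I. fps_X ^ E r * V r)"
      by (intro sum.cong refl) (auto simp: I_def E_def stair_sum_even)
    finally show ?thesis .
  qed
  have d2: "fps_X ^ d * (\<Theta> i - \<Theta> (i - 1)) = (\<Sum>r\<in>J. fps_X ^ E r * U r)"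
  proof -
    define I' where "I' = {r. i - 1 \<le> r \<and> r \<le> k - 1 \<and> even (r + (i - 1))}"
    have rec: "stair_sum (i - 1) s = stair_sum i s + stair (i - 1) s" for s
      using stair_sum_rec[of "i - 1"] i by simp
    have "\<Theta> i - \<Theta> (i - 1) = (\<Sum>r\<in>I'. fps_X ^ (r + (W r + 2 * stair_sum i r)) * U (Suc r))"
      using msum_telescope_up[of "i - 1" k L "\<lambda>s. W s + 2 * stair_sum i s"] i
      unfolding \<Theta>_def I'_def U_def rec by (simp add: algebra_simps)
    \<comment> \<open>Shifting the index by one gives this expansion the parity of i; its range J
      reaches up to k, one beyond the bound for I in the other expansion.\<close>
    also have "\<dots> = (\<Sum>r\<in>J. fps_X ^ (r - 1 + (W (r - 1) + 2 * stair_sum i (r - 1))) * U r)"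
      using i by (intro sum.reindex_bij_witness[of _ "\<lambda>r. r - 1" Suc]) (auto simp: I'_def J_def)
    finally have "fps_X ^ d * (\<Theta> i - \<Theta> (i - 1)) =
      (\<Sum>r\<in>J. fps_X ^ (d + (r - 1 + (W (r - 1) + 2 * stair_sum i (r - 1)))) * U r)"
      by (simp add: sum_distrib_left power_add mult.assoc)
    also have "\<dots> = (\<Sum>r\<in>J. fps_X ^ E r * U r)"
    proof (intro sum.cong refl)
      fix r assume r: "r \<in> J"
      have "2 * stair_sum (Suc (i - 1)) (r - 1) = r - 1 - (i - 1)"
        using r i by (intro stair_sum_even) (auto simp: J_def)
      then have "d + (r - 1 + (W (r - 1) + 2 * stair_sum i (r - 1))) = E r"
        using W[of r] r i unfolding E_def J_def by auto
      then show "fps_X ^ (d + (r - 1 + (W (r - 1) + 2 * stair_sum i (r - 1)))) * U r = fps_X ^ E r * U r"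
        by simp
    qed
    finally show ?thesis .
  qed
  \<comment> \<open>The contribution of r = k is the right-hand side of the relation; everything
    else has to cancel.\<close>
  have JI: "(\<Sum>r\<in>J. fps_X ^ E r * U r) = (\<Sum>r\<in>I. fps_X ^ E r * U r) + (if even (k + i) then fps_X ^ E k * U k else 0)"
  proof (cases "even (k + i)")
    case True
    have "J = insert k I" "k \<notin> I" using True i by (auto simp: I_def J_def)
    with True show ?thesis using fin by simp
  next
    case False
    have "x \<le> k - 1" if "x \<le> k" "even (x + i)" for x using that False by (cases "x = k") auto
    then have "J = I" unfolding I_def J_def by auto
    with False show ?thesis by simp
  qed
  have Uk: "U k = msum_pred k L (\<lambda>s. W s + 2 * stair_sum i s + 2 * s)"
    unfolding U_def by (intro msum_pred_cong) (auto simp: stair_def)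
  have Ek: "E k = 2 * k - i + W k" unfolding E_def by simp
  have key: "(\<Sum>r\<in>I. fps_X ^ E r * U r) = (\<Sum>r\<in>I. fps_X ^ E r * V r)"
  proof (cases L)
    case 0
    then show ?thesis by (simp add: U_def V_def msum_pred_def)
  next
    case (Suc M)
    define B where "B r s = W s + 2 * stair_sum (Suc i) s + 2 * min (r - 1) s + 2 * stair (r + 1) s" for r s
    define Y where "Y r s = fps_X ^ (s + (B r s + 2 * stair i s)) *
        msum_pred k M (\<lambda>t. B r t + 2 * stair i t + 2 * stair (s + 2) t + 2 * min s t)" for r s
    define Z where "Z r s = fps_X ^ (s + (B r s + 2 * stair r s + 2 * stair (r + 2) s)) *
        msum_pred k M (\<lambda>t. B r t + 2 * stair r t + 2 * stair (r + 2) t + 2 * stair_seg i s t + 2 * min s t)" for r s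
    have UV: "U r - V r = (\<Sum>s | s \<in> I \<and> r < s. Y r s) - (\<Sum>s | s \<in> I \<and> s < r. Z r s)" if r: "r \<in> I" for r
    proof -
      \<comment> \<open>An intermediate sum carrying the raised weights of both: it differs from
        \<open>U r\<close> at the indices above r and from \<open>V r\<close> at those below
        r.\<close>
      let ?m = "msum k M (\<lambda>t. B r t + 2 * stair i t + 2 * stair (r + 2) t)"
      have r': "1 \<le> r" "i \<le> r" "even (r + i)" using r i unfolding I_def by auto
      then obtain e where e: "r = i + 2 * e" by (metis add.commute dvd_diffD1 even_add even_diff_nat le_iff_add evenE)
      have U: "U r = msum k M (\<lambda>t. B r t + 2 * stair i t)"
        unfolding U_def B_def Suc stair_sum_rec[of i] msum_pred_def by (simp add: algebra_simps)
      have V: "V r = msum k M (\<lambda>t. B r t + 2 * stair r t + 2 * stair (r + 2) t)"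
        unfolding V_def B_def Suc msum_pred_def min_stair[OF r'(1)] by (simp add: algebra_simps)
      have "U r - ?m = (\<Sum>s | r + 2 \<le> s \<and> s \<le> k - 1 \<and> even (s + (r + 2)). Y r s)"
        unfolding U Y_def using msum_telescope_up[of "r + 2" k M "\<lambda>t. B r t + 2 * stair i t"]
        by (simp add: algebra_simps)
      also have "{s. r + 2 \<le> s \<and> s \<le> k - 1 \<and> even (s + (r + 2))} = {s. s \<in> I \<and> r < s}"
      proof -
        have "r + 2 \<le> s" if "r < s" "even (s + i)" for s
          using that r' by (cases "s = r + 1") auto
        then show ?thesis using r' unfolding I_def by auto
      qed
      finally have 1: "U r - ?m = (\<Sum>s | s \<in> I \<and> r < s. Y r s)" .
      have "?m = msum k M (\<lambda>t. B r t + 2 * stair r t + 2 * stair (r + 2) t + 2 * stair_seg i (i + 2 * e) t)"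
        unfolding stair_split[OF r'(2,3)] e by (simp add: algebra_simps)
      then have "V r - ?m = (\<Sum>s | i \<le> s \<and> s < i + 2 * e \<and> even (s + i). Z r s)"
        unfolding V Z_def using msum_telescope_down[of i e k M "\<lambda>t. B r t + 2 * stair r t + 2 * stair (r + 2) t"] i r e
        by (simp add: I_def algebra_simps)
      also have "{s. i \<le> s \<and> s < i + 2 * e \<and> even (s + i)} = {s. s \<in> I \<and> s < r}"
        using r unfolding e I_def by auto
      finally have 2: "V r - ?m = (\<Sum>s | s \<in> I \<and> s < r. Z r s)" .
      from 1 2 show ?thesis by (simp add: algebra_simps)
    qed
    \<comment> \<open>The term for r and then s in the first expansion equals the term for s and
      then r in the second.\<close>
    have YZ: "fps_X ^ E r * Y r s = fps_X ^ E s * Z s r" if rs: "r \<in> I" "s \<in> I" "r < s" for r s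
    proof -
      have r: "1 \<le> r" "i \<le> r" "even (r + i)" and s: "1 \<le> s" "i \<le> s" "even (s + i)"
        using rs i unfolding I_def by auto
      have p: "B r s + 2 * stair i s = W s + (s - i) + 2 * r" "B s r + 2 * stair s r + 2 * stair (s + 2) r = W r + (r - i) + 2 * r"
        unfolding B_def stair_sum_even[OF r(2,3)] stair_sum_even[OF s(2,3)]
        using r s rs(3) by (auto simp: stair_def)
      have e: "E r + (s + (B r s + 2 * stair i s)) = E s + (r + (B s r + 2 * stair s r + 2 * stair (s + 2) r))"
        unfolding p E_def using r s by auto
      have a: "(\<lambda>t. B r t + 2 * stair i t + 2 * stair (s + 2) t + 2 * min s t) =
               (\<lambda>t. B s t + 2 * stair s t + 2 * stair (s + 2) t + 2 * stair_seg i r t + 2 * min r t)"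
        unfolding B_def min_stair[OF r(1)] min_stair[OF s(1)] stair_split[OF r(2,3)] by (auto simp: fun_eq_iff)
      show ?thesis unfolding Y_def Z_def a
        unfolding mult.assoc[symmetric] power_add[symmetric] e ..
    qed
    have "(\<Sum>r\<in>I. fps_X ^ E r * (\<Sum>s | s \<in> I \<and> r < s. Y r s)) =
          (\<Sum>r\<in>I. \<Sum>s\<in>I. if r < s then fps_X ^ E r * Y r s else 0)"
      unfolding sum_distrib_left
      by (intro sum.cong refl sum.mono_neutral_cong_left) (use fin in auto)
    also have "\<dots> = (\<Sum>r\<in>I. \<Sum>s\<in>I. if r < s then fps_X ^ E s * Z s r else 0)"
      by (intro sum.cong refl) (auto simp: YZ)
    also have "\<dots> = (\<Sum>s\<in>I. \<Sum>r\<in>I. if r < s then fps_X ^ E s * Z s r else 0)"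
      by (rule sum.swap)
    also have "\<dots> = (\<Sum>r\<in>I. fps_X ^ E r * (\<Sum>s | s \<in> I \<and> s < r. Z r s))"
      unfolding sum_distrib_left
      by (intro sum.cong refl sum.mono_neutral_cong_right) (use fin in auto)
    finally have "(\<Sum>r\<in>I. fps_X ^ E r * (U r - V r)) = 0"
      by (simp add: UV sum_subtractf right_diff_distrib)
    then show ?thesis by (simp add: sum_subtractf right_diff_distrib)
  qed
  show ?thesis unfolding d1 d2 JI key Uk[symmetric] Ek[symmetric] by simp
qed

section \<open>Words without overlined parts\<close>

text \<open>
  \<open>free_gf k v i j L\<close> counts the partitions into parts \<open>\<ge> j\<close> with \<open>L\<close> clusters and fewer than \<open>i\<close>
  parts equal to \<open>j\<close> that satisfy the local condition, when \<open>v\<close> is the parity of the number of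
  overlined parts below \<open>j\<close> and there is no 1-marked part of size \<open>j - 1\<close>; \<open>cont_gf\<close> is the same
  with a 1-marked part of size \<open>j - 1\<close>, so that parts of size \<open>j\<close> start no cluster.
\<close>

definition part_ok :: "bool \<Rightarrow> nat \<Rightarrow> nat \<Rightarrow> bool" where
  "part_ok v j f \<longleftrightarrow> even j \<or> odd f = v"

text \<open>For positive i, j and r, \<open>r + free_exp v i j r\<close> is the least number of the
  parity of v that is a sum of r parts, all at least j and fewer than i of them equal to j. This is
  the exponent of the term of \<open>msum\<close> with a single cluster of r parts.\<close>

definition free_exp :: "bool \<Rightarrow> nat \<Rightarrow> nat \<Rightarrow> nat \<Rightarrow> nat" where
  "free_exp v i j r = (j - 1) * r +
     (if even j then of_bool v + 2 * stair_sum (i + of_bool v) r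
      else of_bool (odd r \<noteq> v) + 2 * stair_sum (if odd i = v then i else Suc i) r)"

definition free_gf :: "nat \<Rightarrow> bool \<Rightarrow> nat \<Rightarrow> nat \<Rightarrow> nat \<Rightarrow> rat fps" where
  "free_gf k v i j L = msum k L (free_exp v i j)"

definition cont_gf :: "nat \<Rightarrow> bool \<Rightarrow> nat \<Rightarrow> nat \<Rightarrow> nat \<Rightarrow> rat fps" where
  "cont_gf k v i j L =
     (\<Sum>f<i. if part_ok v j f then fps_X ^ (j * f) * free_gf k v (k - f) (Suc j) L else 0)"

lemma free_gf_0 [simp]: "free_gf k v i j 0 = 1"
  by (simp add: free_gf_def)

lemma stair_sum_ge: "r < i \<Longrightarrow> stair_sum i r = 0"
  unfolding stair_sum_def by auto

lemma msum_stair_ge: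
  assumes "k \<le> i" "k \<le> i'"
  shows "msum k L (\<lambda>s. W s + 2 * stair_sum i s) = msum k L (\<lambda>s. W s + 2 * stair_sum i' s)"
  using assms by (intro msum_cong) (auto simp: stair_sum_ge)

lemma free_gf_Suc_k: "free_gf k v (Suc k) j L = free_gf k v k j L"
  unfolding free_gf_def free_exp_def by (intro msum_cong) (auto simp: stair_sum_ge)

text \<open>If no part equals j, the word starts afresh at j + 1, where up to k - 1 parts are
  possible; accordingly the exponents agree for all r < k.\<close>

lemma free_gf_1:
  assumes "1 \<le> j" "1 \<le> k"
  shows "free_gf k v 1 j L = free_gf k v k (Suc j) L"
  unfolding free_gf_def
proof (intro msum_cong)
  fix r assume r: "1 \<le> r" "r \<le> k - 1"
  have s: "stair_sum (Suc 0) r = Suc r div 2" "stair_sum (Suc (Suc 0)) r = r div 2"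
    by (auto simp: stair_sum_def)
  have z: "stair_sum k r = 0" "stair_sum (Suc k) r = 0" using r by (auto simp: stair_sum_ge)
  obtain j' where j: "j = Suc j'" using assms by (cases j) auto
  show "free_exp v 1 j r = free_exp v k (Suc j) r"
    unfolding free_exp_def j by (cases v) (auto simp: s z elim!: evenE oddE)
qed

text \<open>At i = k + 1, which both applications below reach, the three sums coincide and both
  sides vanish.\<close>

lemma msum_three_term_ext:
  fixes k L i d :: nat and W :: "nat \<Rightarrow> nat"
  assumes i: "2 \<le> i" "i \<le> Suc k"
    and W: "\<And>r. i \<le> r \<Longrightarrow> r \<le> k \<Longrightarrow> even (r + i) \<Longrightarrow> d + W (r - 1) = 1 + W r"
  defines "\<Theta> \<equiv> \<lambda>i. msum k L (\<lambda>s. W s + 2 * stair_sum i s)"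
  shows "fps_X ^ d * (\<Theta> i - \<Theta> (i - 1)) - (\<Theta> (Suc i) - \<Theta> i) =
    (if even (k + i) then fps_X ^ (2 * k - i + W k) * msum_pred k L (\<lambda>s. W s + 2 * stair_sum i s + 2 * s)
     else 0)"
proof (cases "i = Suc k")
  case True
  then have "\<Theta> i = \<Theta> k" "\<Theta> (i - 1) = \<Theta> k" "\<Theta> (Suc i) = \<Theta> k"
    unfolding \<Theta>_def using msum_stair_ge by auto
  with True show ?thesis by simp
next
  case False
  with assms msum_three_term[of i k d W L] show ?thesis unfolding \<Theta>_def by auto
qed

text \<open>This anticipates \<open>cont_gf k v (k - i) (Suc j) (L - 1)\<close>, in terms of
  \<open>msum_pred\<close> so that it is 0 at \<open>L = 0\<close>.\<close>

definition rec_sum :: "nat \<Rightarrow> nat \<Rightarrow> bool \<Rightarrow> nat \<Rightarrow> nat \<Rightarrow> rat fps" where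
  "rec_sum k L v j i =
     (\<Sum>g<k - i. if part_ok v (Suc j) g
        then fps_X ^ (Suc j * g) * msum_pred k L (free_exp v (k - g) (Suc (Suc j))) else 0)"

lemma rec_sum_ge: "k \<le> i \<Longrightarrow> rec_sum k L v j i = 0"
  by (simp add: rec_sum_def)

lemma rec_sum_step:
  assumes "i < k"
  shows "rec_sum k L v j i = rec_sum k L v j (Suc i) +
    (if part_ok v (Suc j) (k - Suc i)
     then fps_X ^ (Suc j * (k - Suc i)) * msum_pred k L (free_exp v (Suc i) (Suc (Suc j))) else 0)"
proof -
  have "k - i = Suc (k - Suc i)" "k - (k - Suc i) = Suc i" using assms by auto
  then show ?thesis unfolding rec_sum_def by simp
qed

lemma fps_X_power_cancel:
  fixes a b :: "rat fps"
  shows "fps_X ^ n * a = fps_X ^ n * b \<Longrightarrow> a = b"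
  by simp

text \<open>With d = j the three-term relation compares consecutive differences in i. Both sides
  obey the same first-order recursion downward from i = k, where both are 0.\<close>

lemma free_gf_diff_even:
  assumes "1 \<le> i" "i \<le> k" "1 \<le> j" "even j"
  shows "free_gf k v (Suc i) j L - free_gf k v i j L = fps_X ^ (j * i) * rec_sum k L v j i"
  using assms(2,1)
proof (induction i rule: inc_induct)
  case base
  show ?case by (simp add: free_gf_Suc_k rec_sum_ge)
next
  case (step i)
  define W where "W r = (j - 1) * r + of_bool v" for r :: nat
  define I where "I = Suc i + of_bool v"
  define T where "T i = msum k L (\<lambda>s. W s + 2 * stair_sum i s)" for i
  have T: "free_gf k v i j L = T (i + of_bool v)" for i
    unfolding free_gf_def T_def free_exp_def W_def using assms by (simp add: add.assoc)
  have "2 \<le> I" "I \<le> Suc k" using step by (auto simp: I_def)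
  then have "fps_X ^ j * (T I - T (I - 1)) - (T (Suc I) - T I) =
    (if even (k + I) then fps_X ^ (2 * k - I + W k) * msum_pred k L (\<lambda>s. W s + 2 * stair_sum I s + 2 * s) else 0)"
    unfolding T_def
  proof (rule msum_three_term_ext)
    fix r assume "I \<le> r"
    then obtain r' where "r = Suc r'" using step by (cases r) (auto simp: I_def)
    moreover obtain j' where "j = Suc j'" using assms by (cases j) auto
    ultimately show "j + W (r - 1) = 1 + W r" unfolding W_def by simp
  qed
  moreover have "T I = free_gf k v (Suc i) j L" "T (I - 1) = free_gf k v i j L"
      "T (Suc I) = free_gf k v (Suc (Suc i)) j L"
    unfolding T I_def by (auto simp: add.commute)
  moreover have "(\<lambda>s. W s + 2 * stair_sum I s + 2 * s) = free_exp v (Suc i) (Suc (Suc j))"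
    using assms(3,4) unfolding W_def free_exp_def I_def by (cases j) (auto simp: fun_eq_iff algebra_simps)
  moreover have "even (k + I) \<longleftrightarrow> part_ok v (Suc j) (k - Suc i)"
    using assms(4) step unfolding part_ok_def I_def by (cases v) auto
  moreover have "2 * k - I + W k = j * Suc i + Suc j * (k - Suc i)" if "even (k + I)"
  proof -
    obtain e where "k = Suc i + e" using step by (metis Suc_leI le_iff_add)
    moreover obtain j' where "j = Suc j'" using assms by (cases j) auto
    moreover from this calculation have "of_bool v \<le> e" using that by (cases v; cases e) (auto simp: I_def)
    ultimately show ?thesis unfolding I_def W_def by (auto simp: algebra_simps)
  qed
  ultimately have "fps_X ^ j * (free_gf k v (Suc i) j L - free_gf k v i j L) =
      (free_gf k v (Suc (Suc i)) j L - free_gf k v (Suc i) j L) +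
      fps_X ^ (j * Suc i) * (if part_ok v (Suc j) (k - Suc i)
        then fps_X ^ (Suc j * (k - Suc i)) * msum_pred k L (free_exp v (Suc i) (Suc (Suc j))) else 0)"
    by (auto simp: algebra_simps power_add)
  also have "\<dots> = fps_X ^ (j * Suc i) * rec_sum k L v j i"
    using step by (simp add: rec_sum_step[of i] ring_distribs)
  finally have "fps_X ^ j * (free_gf k v (Suc i) j L - free_gf k v i j L) =
      fps_X ^ j * (fps_X ^ (j * i) * rec_sum k L v j i)"
    by (simp add: power_add mult.assoc)
  then show ?case by (rule fps_X_power_cancel)
qed

text \<open>Here b and d stand for sums at bounds of the wrong parity; the combination of the three
  relations with weights y, 1 + z and 1 eliminates them.\<close>

lemma odd_elimination:
  fixes a b c d e y z r1 r2 r3 :: "rat fps"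
  assumes "z * (b - a) - (c - b) = r1" "y * (c - b) - (d - c) = r2" "z * (d - c) - (e - d) = r3"
  shows "y * z * (c - a) - (e - c) = r3 + y * r1 + (1 + z) * r2"
  unfolding assms[symmetric] by (simp add: algebra_simps)

text \<open>At an odd size the weight \<open>of_bool (odd s \<noteq> v)\<close> alternates, so d
  alternates between j - 1 and j + 1, and only indices of the parity of v occur in a
  \<open>free_gf\<close>. The induction therefore goes in steps of two and combines three
  neighbouring relations.\<close>

lemma free_gf_diff_odd:
  assumes "1 \<le> i" "1 \<le> j" "odd j" "odd i = v"
  shows "msum k L (\<lambda>s. (j - 1) * s + of_bool (odd s \<noteq> v) + 2 * stair_sum (i + 2) s) -
         msum k L (\<lambda>s. (j - 1) * s + of_bool (odd s \<noteq> v) + 2 * stair_sum i s) =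
         fps_X ^ (j * i) * rec_sum k L v j i"
  using assms(1,4)
proof (induction "k - i" arbitrary: i rule: less_induct)
  case less
  define W where "W r = (j - 1) * r + of_bool (odd r \<noteq> v)" for r :: nat
  define T where "T i = msum k L (\<lambda>s. W s + 2 * stair_sum i s)" for i
  define Tp where "Tp i = msum_pred k L (\<lambda>s. W s + 2 * stair_sum i s + 2 * s)" for i
  obtain j' where j': "j = Suc j'" "even j'" using assms by (cases j) auto
  have Wd: "(if odd I = v then j - 1 else j + 1) + W (r - 1) = 1 + W r"
    if "1 \<le> r" "even (r + I)" for r I
    using that j' unfolding W_def by (cases r) auto
  have t: "fps_X ^ (if odd I = v then j - 1 else j + 1) * (T I - T (I - 1)) - (T (Suc I) - T I) =
    (if even (k + I) then fps_X ^ (2 * k - I + W k) * Tp I else 0)"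
    if "2 \<le> I" "I \<le> Suc k" for I
    unfolding T_def Tp_def using that Wd[of _ I] by (intro msum_three_term_ext) auto
  have Tp: "msum_pred k L (free_exp v I (Suc (Suc j))) = Tp (if odd I = v then I else Suc I)" for I
    unfolding Tp_def free_exp_def W_def using j' by (intro msum_pred_cong) (auto simp: algebra_simps)
  have Tpge: "Tp I = Tp k" if "k \<le> I" for I
    unfolding Tp_def using that by (intro msum_pred_cong) (auto simp: stair_sum_ge)
  have Tge: "T I = T k" if "k \<le> I" for I
    unfolding T_def using that by (intro msum_stair_ge) auto
  have "T (i + 2) - T i = fps_X ^ (j * i) * rec_sum k L v j i"
  proof -
    consider "k \<le> i" | "Suc i = k" | "i + 2 \<le> k" by linarith
    then show ?thesis
    proof cases
      case 1
      then show ?thesis using Tge[of i] Tge[of "i + 2"] by (simp add: rec_sum_ge)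
    next
      case 2
      have ok: "odd k \<noteq> v" using 2 less.prems by auto
      have "fps_X ^ (j + 1) * (T k - T i) = fps_X ^ (k + W k) * Tp k"
        using t[of k] 2 less.prems ok Tge[of "Suc k"] by auto
      also have "k + W k = (j + 1) + j * i" unfolding W_def using ok 2 j' by (auto simp: algebra_simps)
      finally have "fps_X ^ (j + 1) * (T k - T i) = fps_X ^ (j + 1) * (fps_X ^ (j * i) * Tp k)"
        by (simp only: power_add mult.assoc)
      then have "T k - T i = fps_X ^ (j * i) * Tp k" by (rule fps_X_power_cancel)
      moreover have "rec_sum k L v j i = Tp k"
      proof -
        have "rec_sum k L v j i = rec_sum k L v j (Suc i) + Tp (Suc k)"
          using rec_sum_step[of i k L v j] 2 ok j' unfolding Tp by (simp add: part_ok_def)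
        then show ?thesis using 2 Tpge[of "Suc k"] by (simp add: rec_sum_ge)
      qed
      ultimately show ?thesis using Tge[of "i + 2"] 2 by simp
    next
      case 3
      define I where "I = i + 2"
      have I: "odd I = v" "I \<le> k" "3 \<le> I" using 3 less.prems by (auto simp: I_def)
      note E = power_add[of "fps_X :: rat fps"]
      define y z :: "rat fps" where "y = fps_X ^ (j - 1)" and "z = fps_X ^ (j + 1)"
      define r1 r2 r3 where "r1 = (if even (k + (I - 1)) then fps_X ^ (2 * k - (I - 1) + W k) * Tp (I - 1) else 0)"
        and "r2 = (if even (k + I) then fps_X ^ (2 * k - I + W k) * Tp I else 0)"
        and "r3 = (if even (k + Suc I) then fps_X ^ (2 * k - Suc I + W k) * Tp (Suc I) else 0)"
      have "z * (T (I - 1) - T (I - 2)) - (T I - T (I - 1)) = r1"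
        unfolding z_def r1_def I_def using t[of "Suc i"] 3 less.prems by auto
      moreover have "y * (T I - T (I - 1)) - (T (Suc I) - T I) = r2"
        using t[of I] I unfolding y_def r2_def by auto
      moreover have "z * (T (Suc I) - T I) - (T (Suc (Suc I)) - T (Suc I)) = r3"
        using t[of "Suc I"] I unfolding z_def r3_def by auto
      ultimately have el: "y * z * (T I - T (I - 2)) - (T (Suc (Suc I)) - T I) = r3 + y * r1 + (1 + z) * r2"
        by (rule odd_elimination)
      have rhs: "r3 + y * r1 + (1 + z) * r2 = fps_X ^ (j * I + Suc j * (k - I)) * ((1 + z) * Tp I)"
      proof (cases "even (k + I)")
        case True
        have "2 * k - I + W k = j * I + Suc j * (k - I)"
        proof -
          obtain e where "k = I + e" using I by (metis le_iff_add)
          then show ?thesis using True I j' unfolding W_def by (auto simp: algebra_simps)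
        qed
        with True I show ?thesis unfolding r1_def r2_def r3_def by simp
      next
        case False
        then obtain e where e: "k = I + Suc e"
          using I by (metis add.right_neutral even_add le_iff_add not0_implies_Suc)
        have e1: "2 * k - Suc I + W k = j * I + Suc j * (k - I)"
          using False I j' unfolding W_def e by (auto simp: algebra_simps)
        have e2: "(j - 1) + (2 * k - (I - 1) + W k) = (j * I + Suc j * (k - I)) + (j + 1)"
          using False I j' unfolding W_def e by (auto simp: algebra_simps)
        \<comment> \<open>The right-hand sides of the two outer relations have the wrong index; the
          three-term relation with one cluster fewer expresses them by \<open>Tp I\<close>.\<close>
        have e3: "(1 + z) * Tp I = Tp (Suc I) + z * Tp (I - 1)"
        proof (cases L)
          case 0
          then show ?thesis by (simp add: Tp_def msum_pred_def)
        next
          case (Suc M)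
          define W' where "W' r = W r + 2 * r" for r
          have "fps_X ^ (j + 1) * (msum k M (\<lambda>s. W' s + 2 * stair_sum I s) - msum k M (\<lambda>s. W' s + 2 * stair_sum (I - 1) s)) -
              (msum k M (\<lambda>s. W' s + 2 * stair_sum (Suc I) s) - msum k M (\<lambda>s. W' s + 2 * stair_sum I s)) =
              (if even (k + I) then fps_X ^ (2 * k - I + W' k) * msum_pred k M (\<lambda>s. W' s + 2 * stair_sum I s + 2 * s) else 0)"
          proof (rule msum_three_term_ext)
            fix r assume r: "I \<le> r" "even (r + I)"
            show "j + 1 + W' (r - 1) = 1 + W' r"
              using Wd[of r I] r I j' unfolding W'_def by auto
          qed (use I in auto)
          moreover have "Tp i = msum k M (\<lambda>s. W' s + 2 * stair_sum i s)" for i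
            unfolding Tp_def Suc msum_pred_def W'_def by (simp add: algebra_simps)
          ultimately show ?thesis using False unfolding z_def by (simp add: algebra_simps)
        qed
        have "r2 = 0" "r3 = fps_X ^ (j * I + Suc j * (k - I)) * Tp (Suc I)"
          using False unfolding r2_def r3_def e1 by auto
        moreover have "y * r1 = fps_X ^ (j * I + Suc j * (k - I)) * z * Tp (I - 1)"
        proof -
          have "r1 = fps_X ^ (2 * k - (I - 1) + W k) * Tp (I - 1)"
            using False I unfolding r1_def by auto
          then have "y * r1 = fps_X ^ ((j - 1) + (2 * k - (I - 1) + W k)) * Tp (I - 1)"
            unfolding y_def by (simp only: power_add mult.assoc)
          then show ?thesis unfolding e2 z_def by (simp only: power_add)
        qed
        ultimately show ?thesis unfolding e3 by (simp only: ring_distribs mult.assoc mult_zero_right add_0_right)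
      qed
      have IH: "T (Suc (Suc I)) - T I = fps_X ^ (j * I) * rec_sum k L v j I"
        using less.hyps[of I] 3 I unfolding T_def W_def I_def by simp
      \<comment> \<open>The bounds i + 1 and i + 2 give the same exponents at the odd size j + 2,
        and at the even size j + 1 both multiplicities are allowed, so each step splits off a
        multiple of \<open>Tp I\<close>.\<close>
      have K: "rec_sum k L v j i = rec_sum k L v j I + fps_X ^ (Suc j * (k - I)) * ((1 + z) * Tp I)"
      proof -
        have 1: "rec_sum k L v j i = rec_sum k L v j (Suc i) + fps_X ^ (Suc j * (k - Suc i)) * Tp I"
          using rec_sum_step[of i k L v j] 3 j' I unfolding Tp by (auto simp: part_ok_def I_def)
        have 2: "rec_sum k L v j (Suc i) = rec_sum k L v j I + fps_X ^ (Suc j * (k - I)) * Tp I"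
          using rec_sum_step[of "Suc i" k L v j] 3 j' I unfolding Tp by (auto simp: part_ok_def I_def)
        have "k - Suc i = Suc (k - I)" using 3 by (auto simp: I_def)
        then have "Suc j * (k - Suc i) = Suc j * (k - I) + (j + 1)" by simp
        then have e: "fps_X ^ (Suc j * (k - Suc i)) = fps_X ^ (Suc j * (k - I)) * z"
          unfolding z_def by (simp only: power_add)
        have "a + w * t + w * z * t = a + w * ((1 + z) * t)" for a w t :: "rat fps"
          by (simp add: algebra_simps)
        then show ?thesis unfolding 1 2 e .
      qed
      have yz: "y * z = fps_X ^ (2 * j)" unfolding y_def z_def using j' by (simp flip: power_add)
      have "fps_X ^ (2 * j) * (T I - T i) = fps_X ^ (j * I) * rec_sum k L v j i"
        using el unfolding rhs IH K yz by (simp add: I_def power_add algebra_simps)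
      also have "\<dots> = fps_X ^ (2 * j) * (fps_X ^ (j * i) * rec_sum k L v j i)"
      proof -
        have e: "j * I = 2 * j + j * i" by (simp add: I_def)
        show ?thesis unfolding e by (simp only: power_add mult.assoc)
      qed
      finally show ?thesis unfolding I_def by (rule fps_X_power_cancel)
    qed
  qed
  then show ?case unfolding T_def W_def by (simp add: add.assoc)
qed

text \<open>The multisums obey the recursion of the words: exactly i parts equal to j open one
  cluster and leave room for fewer than k - i parts of size j + 1, none of which starts a cluster.
  With \<open>free_gf_1\<close>, this justifies reading the multisums as counts of words.\<close>

lemma free_gf_Suc:
  assumes "1 \<le> i" "i \<le> k" "1 \<le> j"
  shows "free_gf k v (Suc i) j L = free_gf k v i j L +
    (if part_ok v j i \<and> L \<noteq> 0 then fps_X ^ (j * i) * cont_gf k v (k - i) (Suc j) (L - 1) else 0)"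
proof -
  have K: "rec_sum k L v j i = (if L \<noteq> 0 then cont_gf k v (k - i) (Suc j) (L - 1) else 0)"
    unfolding rec_sum_def cont_gf_def free_gf_def msum_pred_def by (auto intro!: sum.cong sum.neutral)
  show ?thesis
  proof (cases "even j")
    case True
    with free_gf_diff_even[of i k j v L] assms K show ?thesis
      by (auto simp: part_ok_def algebra_simps split: if_splits)
  next
    case False
    show ?thesis
    proof (cases "odd i = v")
      case True
      have "free_gf k v (Suc i) j L - free_gf k v i j L = fps_X ^ (j * i) * rec_sum k L v j i"
        using free_gf_diff_odd[of i j v k L] assms False True
        unfolding free_gf_def free_exp_def by (auto simp: add.assoc)
      with K True show ?thesis by (auto simp: part_ok_def algebra_simps split: if_splits)
    next
      case F: False
      then have "free_exp v (Suc i) j = free_exp v i j"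
        unfolding free_exp_def using False by (auto simp: fun_eq_iff)
      with F False show ?thesis by (simp add: free_gf_def part_ok_def)
    qed
  qed
qed

text \<open>A nonempty word weighs at least j. This starts the arguments on multisums that raise j
  indefinitely.\<close>

lemma free_gf_dvd:
  assumes "L \<noteq> 0" "1 \<le> j"
  shows "fps_X ^ j dvd free_gf k v i j L"
  unfolding free_gf_def msum_def
proof (intro dvd_sum)
  fix n assume n: "n \<in> comps k L"
  let ?I = "{1..k - 1}"
  have L: "sum n ?I = L" using n by (simp add: comps_def)
  with assms have k: "1 \<in> ?I" by (cases "k - 1") auto
  have "L * 1 \<le> L * L" using assms by (intro mult_le_mono) auto
  also have "L * L = (N k n 1)\<^sup>2" using L by (simp add: N_def power2_eq_square)
  also have "\<dots> \<le> (\<Sum>i\<in>?I. (N k n i)\<^sup>2)" using k by (intro member_le_sum) auto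
  finally have 1: "L \<le> (\<Sum>i\<in>?I. (N k n i)\<^sup>2)" by simp
  have "(j - 1) * L = (\<Sum>r\<in>?I. (j - 1) * n r)" unfolding L[symmetric] by (rule sum_distrib_left)
  also have "\<dots> \<le> (\<Sum>r\<in>?I. free_exp v i j r * n r)"
  proof (intro sum_mono mult_le_mono1)
    fix r assume "r \<in> ?I"
    then have "(j - 1) * 1 \<le> (j - 1) * r" by (intro mult_le_mono) auto
    also have "\<dots> \<le> free_exp v i j r" unfolding free_exp_def by (rule le_add1)
    finally show "j - 1 \<le> free_exp v i j r" by simp
  qed
  finally have 2: "(j - 1) * L \<le> (\<Sum>r\<in>?I. free_exp v i j r * n r)" .
  have "j * 1 \<le> j * L" using assms by (intro mult_le_mono) auto
  also have "j * L = L + (j - 1) * L" using assms by (cases j) auto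
  finally have "j \<le> (\<Sum>i\<in>?I. (N k n i)\<^sup>2) + (\<Sum>r\<in>?I. free_exp v i j r * n r)"
    using 1 2 by simp
  then show "fps_X ^ j dvd msum_term k (free_exp v i j) n"
    unfolding msum_term_def by (intro dvd_mult2 le_imp_power_dvd)
qed

lemma cont_gf_0 [simp]: "cont_gf k v 0 j L = 0"
  by (simp add: cont_gf_def)

lemma cont_gf_Suc:
  "cont_gf k v (Suc n) j L = cont_gf k v n j L +
     (if part_ok v j n then fps_X ^ (j * n) * free_gf k v (k - n) (Suc j) L else 0)"
  by (simp add: cont_gf_def)

lemma cont_gf_dvd:
  assumes "L \<noteq> 0"
  shows "fps_X ^ j dvd cont_gf k v n j L"
  unfolding cont_gf_def
proof (intro dvd_sum)
  fix f
  have "fps_X ^ Suc j dvd free_gf k v (k - f) (Suc j) L" by (rule free_gf_dvd) (use assms in auto)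
  then have "fps_X ^ j dvd free_gf k v (k - f) (Suc j) L" by (rule power_le_dvd) simp
  then show "fps_X ^ j dvd (if part_ok v j f then fps_X ^ (j * f) * free_gf k v (k - f) (Suc j) L else 0)"
    by simp
qed

lemma fps_eq_0_if_dvd: "(\<And>d. fps_X ^ d dvd (p :: rat fps)) \<Longrightarrow> p = 0"
proof (rule fps_ext)
  fix n assume "\<And>d. fps_X ^ d dvd p"
  then have "fps_X ^ Suc n dvd p" .
  then obtain r where "p = fps_X ^ Suc n * r" by (elim dvdE)
  then have "p $ n = (fps_X ^ Suc n * r) $ n" by simp
  then show "p $ n = 0 $ n" unfolding fps_X_power_mult_nth by simp
qed

section \<open>The shift identity\<close>

text \<open>Both defects vanish, since their recursions raise the smallest size \<open>j\<close> indefinitely and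
  so make them divisible by every power of \<open>fps_X\<close>.\<close>

definition shift_defect0 :: "nat \<Rightarrow> bool \<Rightarrow> nat \<Rightarrow> nat \<Rightarrow> nat \<Rightarrow> rat fps" where
  "shift_defect0 k v m j L = free_gf k v m j L - fps_X ^ L * free_gf k (\<not> v) (Suc m) j L -
     (if (odd j \<or> \<not> v) \<and> L \<noteq> 0 then fps_X ^ (L + j - 1) * cont_gf k (\<not> v) (m - 1) j (L - 1) else 0)"

text \<open>The case distinction is whether an overlined part of size j can follow a 1-marked part
  of size j - 1.\<close>

definition shift_defect1 :: "nat \<Rightarrow> bool \<Rightarrow> nat \<Rightarrow> nat \<Rightarrow> nat \<Rightarrow> rat fps" where
  "shift_defect1 k v n j L = cont_gf k v n j L -
     (if even j \<or> \<not> v then fps_X ^ L * free_gf k (\<not> v) (Suc n) j L else 0) -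
     fps_X ^ (L + j) * cont_gf k (\<not> v) (n - 1) j L"

context
  fixes k j :: nat
  assumes k: "1 \<le> k" and j: "1 \<le> j"
begin

lemma free_gf_2: "free_gf k v (Suc 1) j L = free_gf k v k (Suc j) L +
    (if (even j \<or> v) \<and> L \<noteq> 0 then fps_X ^ j * cont_gf k v (k - 1) (Suc j) (L - 1) else 0)"
  using free_gf_Suc[of 1 k j v L] free_gf_1[OF j k] k j by (auto simp: part_ok_def)

text \<open>This and the next three lemmas express a defect by defects at size j + 1 and by the same
  defect at a smaller bound, with no inhomogeneous term: the shift is compatible with the recursions
  of \<open>free_gf\<close> and \<open>cont_gf\<close>.\<close>

lemma shift_defect0_1: "shift_defect0 k v 1 j L = shift_defect0 k v k (Suc j) L"
  unfolding shift_defect0_def free_gf_2 free_gf_Suc_k free_gf_1[OF j k]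
  by (auto simp: algebra_simps power_add)

lemma shift_defect1_1:
  "shift_defect1 k v 1 j L = (if even j \<or> \<not> v then shift_defect0 k v k (Suc j) L else 0)"
  unfolding shift_defect1_def shift_defect0_def free_gf_2 free_gf_Suc_k
  by (auto simp: cont_gf_def part_ok_def algebra_simps power_add)

lemma shift_defect0_Suc:
  assumes "1 \<le> m" "m < k"
  shows "shift_defect0 k v (Suc m) j L = shift_defect0 k v m j L +
    (if part_ok v j m \<and> L \<noteq> 0 then fps_X ^ (j * m) * shift_defect1 k v (k - m) (Suc j) (L - 1) else 0)"
proof (cases L)
  case 0
  then show ?thesis by (simp add: shift_defect0_def)
next
  case (Suc M)
  obtain m' where m: "m = Suc m'" using assms by (cases m) auto
  have o: "part_ok (\<not> v) j (Suc m) = part_ok v j m" "part_ok (\<not> v) j m' = part_ok v j m"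
    unfolding part_ok_def m by auto
  have k': "k - m' = Suc (k - m)" "k - Suc m = k - m - 1" using assms m by auto
  have 1: "free_gf k v (Suc m) j (Suc M) = free_gf k v m j (Suc M) +
    (if part_ok v j m then fps_X ^ (j * m) * cont_gf k v (k - m) (Suc j) M else 0)"
    using free_gf_Suc[of m k j v "Suc M"] assms j by simp
  have 2: "free_gf k (\<not> v) (Suc (Suc m)) j (Suc M) = free_gf k (\<not> v) (Suc m) j (Suc M) +
    (if part_ok v j m then fps_X ^ (j * m) * fps_X ^ j * cont_gf k (\<not> v) (k - m - 1) (Suc j) M else 0)"
    using free_gf_Suc[of "Suc m" k j "\<not> v" "Suc M"] assms j unfolding o k'
    by (simp add: power_add mult_ac)
  have 3: "cont_gf k (\<not> v) m j M = cont_gf k (\<not> v) (m - 1) j M +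
    (if part_ok v j m then fps_X ^ (j * m') * free_gf k (\<not> v) (Suc (k - m)) (Suc j) M else 0)"
    using cont_gf_Suc[of k "\<not> v" m' j M] unfolding o k' by (simp add: m)
  have p: "fps_X ^ (j * m) = (fps_X ^ (j * m') * fps_X ^ j :: rat fps)"
    unfolding m by (simp add: power_add mult_ac)
  have q: "fps_X ^ (Suc M + j - 1) = (fps_X ^ M * fps_X ^ j :: rat fps)"
    "fps_X ^ (M + Suc j) = (fps_X ^ M * fps_X * fps_X ^ j :: rat fps)"
    "fps_X ^ Suc M = (fps_X * fps_X ^ M :: rat fps)"
    by (simp_all add: power_add)
  have c: "(odd j \<or> \<not> v) = (even (Suc j) \<or> \<not> v)" by simp
  show ?thesis
    unfolding Suc shift_defect0_def shift_defect1_def 1 2 diff_Suc_1 3 p q c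
    by (cases "part_ok v j m"; cases "even (Suc j) \<or> \<not> v") (simp_all only: if_True if_False, simp_all add: algebra_simps)
qed

lemma shift_defect1_Suc:
  assumes "1 \<le> n" "n < k"
  shows "shift_defect1 k v (Suc n) j L = shift_defect1 k v n j L +
    (if part_ok v j n then fps_X ^ (j * n) * shift_defect0 k v (k - n) (Suc j) L else 0)"
proof -
  obtain n' where n: "n = Suc n'" using assms by (cases n) auto
  have o: "part_ok (\<not> v) j (Suc n) = part_ok v j n" "part_ok (\<not> v) j n' = part_ok v j n"
    unfolding part_ok_def n by auto
  have k': "k - n' = Suc (k - n)" "k - Suc n = k - n - 1" using assms n by auto
  have 2: "free_gf k (\<not> v) (Suc (Suc n)) j L = free_gf k (\<not> v) (Suc n) j L +
    (if part_ok v j n \<and> L \<noteq> 0 then fps_X ^ (j * n) * fps_X ^ j * cont_gf k (\<not> v) (k - n - 1) (Suc j) (L - 1) else 0)"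
    using free_gf_Suc[of "Suc n" k j "\<not> v" L] assms j unfolding o k'
    by (simp add: power_add mult_ac)
  have 3: "cont_gf k (\<not> v) n j L = cont_gf k (\<not> v) (n - 1) j L +
    (if part_ok v j n then fps_X ^ (j * n') * free_gf k (\<not> v) (Suc (k - n)) (Suc j) L else 0)"
    using cont_gf_Suc[of k "\<not> v" n' j L] unfolding o k' by (simp add: n)
  have p: "fps_X ^ (j * n) = (fps_X ^ (j * n') * fps_X ^ j :: rat fps)"
    unfolding n by (simp add: power_add mult_ac)
  have q: "fps_X ^ (L + Suc j - 1) = (fps_X ^ L * fps_X ^ j :: rat fps)"
    "fps_X ^ (L + j) = (fps_X ^ L * fps_X ^ j :: rat fps)"
    by (simp_all add: power_add)
  have c: "(odd (Suc j) \<or> \<not> v) = (even j \<or> \<not> v)" by simp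
  show ?thesis
    unfolding shift_defect0_def shift_defect1_def 2 cont_gf_Suc[of k v n] diff_Suc_1 3 p q c
    by (cases "part_ok v j n"; cases "even j \<or> \<not> v"; cases "L = 0") (simp_all only: if_True if_False simp_thms, simp_all add: algebra_simps)
qed

end

text \<open>At \<open>L = 0\<close> the series contain the empty word, so divisibility by powers of
  \<open>fps_X\<close> cannot be had term by term, and this case of the next induction is treated
  directly.\<close>

lemma shift_defect1_L0:
  assumes "1 \<le> n" "n \<le> k" "1 \<le> j"
  shows "shift_defect1 k v n j 0 = 0"
  using assms(1,2)
proof (induction n rule: dec_induct)
  case base
  have "1 \<le> k" using assms by simp
  from shift_defect1_1[OF this assms(3), of v 0] show ?case by (simp add: shift_defect0_def)
next
  case (step n)
  with assms show ?case by (subst shift_defect1_Suc) (auto simp: shift_defect0_def)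
qed

text \<open>The outer induction on d raises j, the inner one raises the bound from 1, where the
  defects are already those at j + 1.\<close>

lemma shift_defect_dvd:
  assumes "1 \<le> k" "1 \<le> j" "1 \<le> m" "m \<le> k"
  shows "fps_X ^ (j + d) dvd shift_defect0 k v m j L \<and> fps_X ^ (j + d) dvd shift_defect1 k v m j L"
  using assms(2-)
proof (induction d arbitrary: j m v L)
  case 0
  have "fps_X ^ j dvd shift_defect0 k v m j L"
  proof (cases "L = 0")
    case True
    then show ?thesis by (simp add: shift_defect0_def)
  next
    case False
    then have "fps_X ^ j dvd (fps_X ^ (L + j - 1) :: rat fps)" by (intro le_imp_power_dvd) auto
    then show ?thesis unfolding shift_defect0_def using free_gf_dvd[OF False "0.prems"(1)]
      by (auto intro!: dvd_diff dvd_mult dvd_mult2)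
  qed
  moreover have "fps_X ^ j dvd shift_defect1 k v m j L"
  proof (cases "L = 0")
    case True
    with 0 shift_defect1_L0[of m k j v] show ?thesis by simp
  next
    case False
    then have "fps_X ^ j dvd (fps_X ^ (L + j) :: rat fps)" by (intro le_imp_power_dvd) auto
    then show ?thesis unfolding shift_defect1_def using free_gf_dvd[OF False "0.prems"(1)] cont_gf_dvd[OF False]
      by (auto intro!: dvd_diff dvd_mult dvd_mult2)
  qed
  ultimately show ?case by simp
next
  case (Suc d)
  note IH = Suc.IH[of "Suc j", simplified]
  show ?case using Suc.prems(2,3)
  proof (induction m arbitrary: v L rule: dec_induct)
    case base
    then show ?case
      using IH[of k v L] assms(1) Suc.prems(1) shift_defect0_1[of k j v L] shift_defect1_1[of k j v L] by auto
  next
    case (step m)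
    then show ?case
      using IH[of "k - m" v L] IH[of "k - m" v "L - 1"] assms(1) Suc.prems(1)
        shift_defect0_Suc[of k j m v L] shift_defect1_Suc[of k j m v L] by (auto intro!: dvd_add dvd_mult)
  qed
qed

text \<open>By \<open>barred_expand\<close> the bracket is what the overlined parts add in
  \<open>over_gf_1_rec\<close>, up to the product already found. So they add $q^{-L}$ times
  \<open>cont_gf\<close>, which is the origin of the factors $1 + q^{-L}$.\<close>

lemma cont_gf_shift:
  assumes "1 \<le> k" "1 \<le> j" "1 \<le> n" "n \<le> k"
  shows "cont_gf k v n j L =
     fps_X ^ L * ((if even j \<or> \<not> v then free_gf k (\<not> v) (Suc n) j L else 0) +
     fps_X ^ j * cont_gf k (\<not> v) (n - 1) j L)"
proof -
  have "shift_defect1 k v n j L = 0"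
  proof (rule fps_eq_0_if_dvd)
    fix d
    have "fps_X ^ (j + d) dvd shift_defect1 k v n j L" using shift_defect_dvd[OF assms] by blast
    then show "fps_X ^ d dvd shift_defect1 k v n j L" by (rule power_le_dvd) simp
  qed
  then show ?thesis unfolding shift_defect1_def by (auto simp: algebra_simps power_add)
qed

section \<open>The automaton\<close>

text \<open>
  The letter \<open>(f, b)\<close> read at \<open>j\<close> stands for \<open>f\<close> plain parts of size \<open>j\<close> and, if \<open>b\<close>, an overlined
  one. The state consists of the parity \<open>v\<close> of the number of overlined parts below \<open>j\<close>, of whether
  \<open>j - 1\<close> carries a 1-marked part (\<open>e\<close>), and of a strict bound \<open>i\<close> for \<open>f\<close>; \<open>new_mark\<close> tells whether
  \<open>j\<close> carries a 1-marked part, and \<open>L\<close> counts the 1-marked parts, that is, the clusters.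
\<close>

definition letter_ok :: "bool \<Rightarrow> bool \<Rightarrow> nat \<Rightarrow> nat \<Rightarrow> bool \<Rightarrow> bool" where
  "letter_ok v e j f b \<longleftrightarrow>
     even j \<or> (if v then odd f \<and> \<not> (b \<and> e) \<or> f = 0 \<and> \<not> b \<and> \<not> e else even f)"

definition new_mark :: "bool \<Rightarrow> nat \<Rightarrow> bool \<Rightarrow> bool" where
  "new_mark e f b \<longleftrightarrow> b \<or> 0 < f \<and> \<not> e"

text \<open>The guard on \<open>L\<close> excludes a truncated subtraction in
  \<open>trunc_gf\<close>.\<close>

definition step_ok :: "nat \<Rightarrow> bool \<Rightarrow> bool \<Rightarrow> nat \<Rightarrow> nat \<Rightarrow> nat \<Rightarrow> bool \<Rightarrow> bool" where
  "step_ok k v e j L f b \<longleftrightarrow>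
     f + of_bool b < k \<and> letter_ok v e j f b \<and> (new_mark e f b \<longrightarrow> L \<noteq> 0)"

text \<open>Only n letters are read, and those after them are taken to be zero. A zero letter leaves
  no 1-marked part behind, so only the first of them can violate \<open>letter_ok\<close>; the value
  for no letters tests just that.\<close>

primrec trunc_gf :: "nat \<Rightarrow> nat \<Rightarrow> bool \<Rightarrow> bool \<Rightarrow> nat \<Rightarrow> nat \<Rightarrow> nat \<Rightarrow> rat fps" where
  "trunc_gf k 0 v e i j L = (if L = 0 \<and> \<not> (v \<and> e \<and> odd j) then 1 else 0)"
| "trunc_gf k (Suc n) v e i j L =
     (\<Sum>f<i. \<Sum>b\<in>UNIV.
        if step_ok k v e j L f b
        then fps_X ^ (j * (f + of_bool b)) *
          trunc_gf k n (v \<noteq> b) (new_mark e f b) (k - f - of_bool b) (Suc j) (L - of_bool (new_mark e f b))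
        else 0)"

text \<open>The limit of the truncations, taken diagonally: after n letters the remaining parts have
  size at least j + n and do not touch the coefficients below j + n.\<close>

definition over_gf :: "nat \<Rightarrow> bool \<Rightarrow> bool \<Rightarrow> nat \<Rightarrow> nat \<Rightarrow> nat \<Rightarrow> rat fps" where
  "over_gf k v e i j L = Abs_fps (\<lambda>m. trunc_gf k (Suc m) v e i j L $ m)"

lemma letter_ok_0: "letter_ok v e j 0 False \<longleftrightarrow> \<not> (v \<and> e \<and> odd j)"
  by (auto simp: letter_ok_def)

lemma trunc_gf_stable_Suc:
  assumes "1 \<le> i" "i \<le> k" "1 \<le> j" "m < n + j"
  shows "trunc_gf k (Suc n) v e i j L $ m = trunc_gf k n v e i j L $ m"
  using assms
proof (induction n arbitrary: v e i j L m)
  case 0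
  let ?t = "\<lambda>f b. (if step_ok k v e j L f b
        then fps_X ^ (j * (f + of_bool b)) *
          trunc_gf k 0 (v \<noteq> b) (new_mark e f b) (k - f - of_bool b) (Suc j) (L - of_bool (new_mark e f b))
        else 0)"
  have z: "?t f b $ m = 0" if "f \<noteq> 0 \<or> b" for f b
  proof -
    have "j * 1 \<le> j * (f + of_bool b)" using that by (intro mult_le_mono2) auto
    then have "m < j * (f + of_bool b)" using 0 by linarith
    then show ?thesis by (auto simp: fps_X_power_mult_nth)
  qed
  have "trunc_gf k (Suc 0) v e i j L $ m = (\<Sum>f<i. \<Sum>b\<in>UNIV. ?t f b $ m)"
    unfolding trunc_gf.simps fps_sum_nth ..
  also have "\<dots> = (\<Sum>f<i. if f = 0 then ?t 0 False $ m else 0)"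
    by (intro sum.cong refl) (auto simp: UNIV_bool z)
  also have "\<dots> = ?t 0 False $ m" using 0 by simp
  also have "\<dots> = trunc_gf k 0 v e i j L $ m" using 0 by (auto simp: letter_ok_0 step_ok_def new_mark_def)
  finally show ?case .
next
  case (Suc n)
  show ?case
    unfolding trunc_gf.simps(2)[of k "Suc n"] trunc_gf.simps(2)[of k n v e i j L] fps_sum_nth
  proof (intro sum.cong refl)
    fix f b assume "f \<in> {..<i}"
    show "(if step_ok k v e j L f b
        then fps_X ^ (j * (f + of_bool b)) *
          trunc_gf k (Suc n) (v \<noteq> b) (new_mark e f b) (k - f - of_bool b) (Suc j) (L - of_bool (new_mark e f b))
        else 0) $ m = (if step_ok k v e j L f b
        then fps_X ^ (j * (f + of_bool b)) *
          trunc_gf k n (v \<noteq> b) (new_mark e f b) (k - f - of_bool b) (Suc j) (L - of_bool (new_mark e f b))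
        else 0) $ m"
    proof (cases "step_ok k v e j L f b")
      case True
      then have "f + of_bool b < k" by (simp add: step_ok_def)
      then have "trunc_gf k (Suc n) v' e' (k - f - of_bool b) (Suc j) L' $ (m - x) =
          trunc_gf k n v' e' (k - f - of_bool b) (Suc j) L' $ (m - x)" for v' e' L' x
        using Suc.prems by (intro Suc.IH) auto
      then show ?thesis unfolding if_P[OF True] fps_X_power_mult_nth by (simp only:)
    qed (simp only: if_False)
  qed
qed

lemma trunc_gf_stable:
  assumes "1 \<le> i" "i \<le> k" "1 \<le> j" "m < n + j" "n \<le> n'"
  shows "trunc_gf k n' v e i j L $ m = trunc_gf k n v e i j L $ m"
  using assms(5)
proof (induction n' rule: dec_induct)
  case (step n')
  have "trunc_gf k (Suc n') v e i j L $ m = trunc_gf k n' v e i j L $ m"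
    using step assms by (intro trunc_gf_stable_Suc) auto
  with step show ?case by simp
qed simp

lemma over_gf_nth:
  assumes "1 \<le> i" "i \<le> k" "1 \<le> j" "m < n + j"
  shows "over_gf k v e i j L $ m = trunc_gf k n v e i j L $ m"
proof (cases "n \<le> Suc m")
  case True
  then show ?thesis using trunc_gf_stable[OF assms True] by (simp add: over_gf_def del: trunc_gf.simps)
next
  case False
  then show ?thesis using trunc_gf_stable[of i k j m "Suc m" n v e L] assms
    by (simp add: over_gf_def del: trunc_gf.simps)
qed

lemma over_gf_rec:
  assumes "1 \<le> i" "i \<le> k" "1 \<le> j"
  shows "over_gf k v e i j L =
     (\<Sum>f<i. \<Sum>b\<in>UNIV.
        if step_ok k v e j L f b
        then fps_X ^ (j * (f + of_bool b)) *
          over_gf k (v \<noteq> b) (new_mark e f b) (k - f - of_bool b) (Suc j) (L - of_bool (new_mark e f b))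
        else 0)"
proof (rule fps_ext)
  fix m
  have 1: "over_gf k v e i j L $ m = trunc_gf k (Suc m) v e i j L $ m"
    by (simp add: over_gf_def del: trunc_gf.simps)
  show "over_gf k v e i j L $ m = (\<Sum>f<i. \<Sum>b\<in>UNIV.
        if step_ok k v e j L f b
        then fps_X ^ (j * (f + of_bool b)) *
          over_gf k (v \<noteq> b) (new_mark e f b) (k - f - of_bool b) (Suc j) (L - of_bool (new_mark e f b))
        else 0) $ m"
    unfolding 1 trunc_gf.simps(2) fps_sum_nth
  proof (intro sum.cong refl)
    fix f b assume "f \<in> {..<i}"
    show "(if step_ok k v e j L f b
        then fps_X ^ (j * (f + of_bool b)) *
          trunc_gf k m (v \<noteq> b) (new_mark e f b) (k - f - of_bool b) (Suc j) (L - of_bool (new_mark e f b))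
        else 0) $ m = (if step_ok k v e j L f b
        then fps_X ^ (j * (f + of_bool b)) *
          over_gf k (v \<noteq> b) (new_mark e f b) (k - f - of_bool b) (Suc j) (L - of_bool (new_mark e f b))
        else 0) $ m"
    proof (cases "step_ok k v e j L f b")
      case True
      then have "f + of_bool b < k" by (simp add: step_ok_def)
      then have "trunc_gf k m v' e' (k - f - of_bool b) (Suc j) L' $ (m - x) =
          over_gf k v' e' (k - f - of_bool b) (Suc j) L' $ (m - x)" for v' e' L' x
        by (intro over_gf_nth[symmetric]) auto
      then show ?thesis unfolding if_P[OF True] fps_X_power_mult_nth by (simp only:)
    qed (simp only: if_False)
  qed
qed

text \<open>Without a 1-marked part of the preceding size every nonzero letter opens exactly one
  cluster, so every term but that of the zero letter has \<open>L - 1\<close>.\<close>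

lemma over_gf_0_rec:
  assumes "1 \<le> i" "i \<le> k" "1 \<le> j"
  shows "over_gf k v False i j L = over_gf k v False k (Suc j) L +
    (if L = 0 then 0 else
      (\<Sum>f = 1..<i. if part_ok v j f then fps_X ^ (j * f) * over_gf k v True (k - f) (Suc j) (L - 1) else 0) +
      (\<Sum>f<i. if Suc f < k \<and> part_ok v j f
         then fps_X ^ (j * Suc f) * over_gf k (\<not> v) True (k - Suc f) (Suc j) (L - 1) else 0))"
proof -
  have s: "{..<i} = insert 0 {1..<i}" using assms by auto
  have 1: "(\<Sum>f<i. if f < k \<and> letter_ok v False j f False \<and> (0 < f \<longrightarrow> L \<noteq> 0)
        then fps_X ^ (j * f) * over_gf k v (0 < f) (k - f) (Suc j) (L - of_bool (0 < f)) else 0) =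
     over_gf k v False k (Suc j) L + (if L = 0 then 0 else
      (\<Sum>f = 1..<i. if part_ok v j f then fps_X ^ (j * f) * over_gf k v True (k - f) (Suc j) (L - 1) else 0))"
    unfolding s using assms
    by (auto simp: letter_ok_0 letter_ok_def part_ok_def intro!: sum.cong sum.neutral)
  have 2: "(\<Sum>f<i. if Suc f < k \<and> letter_ok v False j f True \<and> L \<noteq> 0
        then fps_X ^ (j * Suc f) * over_gf k (\<not> v) True (k - Suc f) (Suc j) (L - 1) else 0) =
     (if L = 0 then 0 else (\<Sum>f<i. if Suc f < k \<and> part_ok v j f
         then fps_X ^ (j * Suc f) * over_gf k (\<not> v) True (k - Suc f) (Suc j) (L - 1) else 0))"
    by (auto simp: letter_ok_def part_ok_def intro!: sum.cong sum.neutral)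
  have "over_gf k v False i j L = (\<Sum>f<i. (if f < k \<and> letter_ok v False j f False \<and> (0 < f \<longrightarrow> L \<noteq> 0)
        then fps_X ^ (j * f) * over_gf k v (0 < f) (k - f) (Suc j) (L - of_bool (0 < f)) else 0) + (if Suc f < k \<and> letter_ok v False j f True \<and> L \<noteq> 0
        then fps_X ^ (j * Suc f) * over_gf k (\<not> v) True (k - Suc f) (Suc j) (L - 1) else 0))"
    unfolding over_gf_rec[OF assms]
    by (intro sum.cong refl) (auto simp: UNIV_bool step_ok_def new_mark_def)
  then show ?thesis unfolding sum.distrib 1 2 by (simp add: add.assoc)
qed

text \<open>Now plain parts of size j only continue clusters and leave no 1-marked part; a cluster
  is opened by an overlined part alone.\<close>

lemma over_gf_1_rec:
  assumes "1 \<le> i" "i \<le> k" "1 \<le> j"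
  shows "over_gf k v True i j L =
      (\<Sum>f<i. if part_ok v j f then fps_X ^ (j * f) * over_gf k v False (k - f) (Suc j) L else 0) +
      (if L = 0 then 0 else
      (\<Sum>f<i. if Suc f < k \<and> (even j \<or> \<not> v \<and> even f)
         then fps_X ^ (j * Suc f) * over_gf k (\<not> v) True (k - Suc f) (Suc j) (L - 1) else 0))"
proof -
  have 1: "(\<Sum>f<i. if f < k \<and> letter_ok v True j f False
        then fps_X ^ (j * f) * over_gf k v False (k - f) (Suc j) L else 0) =
      (\<Sum>f<i. if part_ok v j f then fps_X ^ (j * f) * over_gf k v False (k - f) (Suc j) L else 0)"
    using assms by (intro sum.cong refl) (auto simp: letter_ok_def part_ok_def)
  have 2: "(\<Sum>f<i. if Suc f < k \<and> letter_ok v True j f True \<and> L \<noteq> 0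
        then fps_X ^ (j * Suc f) * over_gf k (\<not> v) True (k - Suc f) (Suc j) (L - 1) else 0) =
     (if L = 0 then 0 else (\<Sum>f<i. if Suc f < k \<and> (even j \<or> \<not> v \<and> even f)
         then fps_X ^ (j * Suc f) * over_gf k (\<not> v) True (k - Suc f) (Suc j) (L - 1) else 0))"
    by (auto simp: letter_ok_def intro!: sum.cong sum.neutral)
  have "over_gf k v True i j L = (\<Sum>f<i. (if f < k \<and> letter_ok v True j f False
        then fps_X ^ (j * f) * over_gf k v False (k - f) (Suc j) L else 0) + (if Suc f < k \<and> letter_ok v True j f True \<and> L \<noteq> 0
        then fps_X ^ (j * Suc f) * over_gf k (\<not> v) True (k - Suc f) (Suc j) (L - 1) else 0))"
    unfolding over_gf_rec[OF assms]
    by (intro sum.cong refl) (auto simp: UNIV_bool step_ok_def new_mark_def)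
  then show ?thesis unfolding sum.distrib 1 2 .
qed

lemma over_gf_low:
  assumes "1 \<le> i" "i \<le> k" "1 \<le> j" "m < j"
  shows "over_gf k v e i j L $ m = (if L = 0 \<and> m = 0 \<and> \<not> (v \<and> e \<and> odd j) then 1 else 0)"
  using over_gf_nth[of i k j m 0 v e L] assms by simp

lemma fps_X_power_dvdI:
  assumes "\<And>m. m < n \<Longrightarrow> (p :: rat fps) $ m = 0"
  shows "fps_X ^ n dvd p"
proof (cases "p = 0")
  case False
  then have "n \<le> subdegree p" using assms by (intro subdegree_geI) auto
  then have "p = fps_X ^ n * fps_shift n p" by (simp add: fps_shift_times_fps_X_power mult.commute)
  then show ?thesis by (metis dvd_triv_left)
qed simp

lemma over_gf_L0:
  assumes "1 \<le> i" "i \<le> k" "1 \<le> j"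
  shows "over_gf k v False i j 0 = 1"
proof -
  have "fps_X ^ (j + d) dvd over_gf k v False i j 0 - 1" for d
    using assms
  proof (induction d arbitrary: i j)
    case 0
    then show ?case by (intro fps_X_power_dvdI) (auto simp: over_gf_low)
  next
    case (Suc d)
    have "fps_X ^ (Suc j + d) dvd over_gf k v False k (Suc j) 0 - 1"
      using Suc.prems by (intro Suc.IH) auto
    then show ?case using over_gf_0_rec[OF Suc.prems, of v 0] by simp
  qed
  then have "over_gf k v False i j 0 - 1 = 0"
    by (intro fps_eq_0_if_dvd) (metis le_add2 power_le_dvd)
  then show ?thesis by simp
qed

section \<open>Closed forms for the words with overlined parts\<close>

definition npoch :: "nat \<Rightarrow> rat fps" where
  "npoch n = (\<Prod>i = 1..n. 1 + fps_X ^ i)"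

lemma npoch_Suc: "npoch (Suc n) = npoch n * (1 + fps_X ^ Suc n)"
  by (simp add: npoch_def mult.commute)

lemma free_gf_expand:
  assumes "1 \<le> i" "i \<le> Suc k" "1 \<le> j" "1 \<le> k"
  shows "free_gf k v i j L = free_gf k v k (Suc j) L +
    (if L = 0 then 0 else
      (\<Sum>f = 1..<i. if part_ok v j f then fps_X ^ (j * f) * cont_gf k v (k - f) (Suc j) (L - 1) else 0))"
  using assms(1,2)
proof (induction i rule: dec_induct)
  case base
  then show ?case using free_gf_1[OF assms(3,4)] by simp
next
  case (step i)
  then show ?case using free_gf_Suc[of i k j v L] assms by simp
qed

text \<open>The first sum comes from plain parts of size j with overlined parts later on, the second
  from an overlined part of size j. As i grows they build up the two terms of the bracket in
  \<open>cont_gf_shift\<close>.\<close>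

lemma barred_expand:
  assumes "1 \<le> i" "i \<le> k" "1 \<le> j" "L \<noteq> 0"
  shows "(\<Sum>f<i. if part_ok v j f then fps_X ^ (j * f) * free_gf k (\<not> v) (Suc (k - f)) (Suc j) L else 0) +
    (\<Sum>f<i. if even j \<or> \<not> v \<and> even f
       then fps_X ^ (j * Suc f) * cont_gf k (\<not> v) (k - Suc f) (Suc j) (L - 1) else 0) =
    (if even j \<or> \<not> v then free_gf k (\<not> v) (Suc i) j L else 0) + fps_X ^ j * cont_gf k (\<not> v) (i - 1) j L"
  using assms(1,2)
proof (induction i rule: dec_induct)
  case base
  then have k: "1 \<le> k" by simp
  show ?case
    using free_gf_2[OF k assms(3), of "\<not> v" L] assms(4) by (auto simp: part_ok_def free_gf_Suc_k)
next
  case (step i)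
  obtain i' where i: "i = Suc i'" using step by (cases i) auto
  have k': "k - i' = Suc (k - i)" using step i by auto
  have o: "part_ok (\<not> v) j i' = part_ok v j i" unfolding i part_ok_def by auto
  have 1: "free_gf k (\<not> v) (Suc (Suc i)) j L = free_gf k (\<not> v) (Suc i) j L +
    (if part_ok (\<not> v) j (Suc i) then fps_X ^ (j * Suc i) * cont_gf k (\<not> v) (k - Suc i) (Suc j) (L - 1) else 0)"
    using free_gf_Suc[of "Suc i" k j "\<not> v" L] assms step by simp
  have 2: "cont_gf k (\<not> v) (Suc i - 1) j L = cont_gf k (\<not> v) (i - 1) j L +
     (if part_ok v j i then fps_X ^ (j * i') * free_gf k (\<not> v) (Suc (k - i)) (Suc j) L else 0)"
    using cont_gf_Suc[of k "\<not> v" i' j L] unfolding o k' by (simp add: i)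
  have p: "fps_X ^ (j * i) = (fps_X ^ j * fps_X ^ (j * i') :: rat fps)"
    unfolding i by (simp add: power_add)
  have IH: "(\<Sum>f<i. if part_ok v j f then fps_X ^ (j * f) * free_gf k (\<not> v) (Suc (k - f)) (Suc j) L else 0) +
    (\<Sum>f<i. if even j \<or> \<not> v \<and> even f
       then fps_X ^ (j * Suc f) * cont_gf k (\<not> v) (k - Suc f) (Suc j) (L - 1) else 0) =
    (if even j \<or> \<not> v then free_gf k (\<not> v) (Suc i) j L else 0) + fps_X ^ j * cont_gf k (\<not> v) (i - 1) j L"
    using step by simp
  have "(\<Sum>f<Suc i. if part_ok v j f then fps_X ^ (j * f) * free_gf k (\<not> v) (Suc (k - f)) (Suc j) L else 0) +
    (\<Sum>f<Suc i. if even j \<or> \<not> v \<and> even f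
       then fps_X ^ (j * Suc f) * cont_gf k (\<not> v) (k - Suc f) (Suc j) (L - 1) else 0) =
    ((\<Sum>f<i. if part_ok v j f then fps_X ^ (j * f) * free_gf k (\<not> v) (Suc (k - f)) (Suc j) L else 0) +
    (\<Sum>f<i. if even j \<or> \<not> v \<and> even f
       then fps_X ^ (j * Suc f) * cont_gf k (\<not> v) (k - Suc f) (Suc j) (L - 1) else 0)) +
    ((if part_ok v j i then fps_X ^ (j * i) * free_gf k (\<not> v) (Suc (k - i)) (Suc j) L else 0) +
     (if even j \<or> \<not> v \<and> even i
       then fps_X ^ (j * Suc i) * cont_gf k (\<not> v) (k - Suc i) (Suc j) (L - 1) else 0))"
    by (simp only: sum.lessThan_Suc add_ac)
  also have "\<dots> = (if even j \<or> \<not> v then free_gf k (\<not> v) (Suc (Suc i)) j L else 0) +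
      fps_X ^ j * cont_gf k (\<not> v) (Suc i - 1) j L"
    unfolding IH 1 2 p by (cases v; cases "even j"; cases "even i") (simp_all add: part_ok_def distrib_left mult.assoc)
  finally show ?case .
qed

text \<open>An overlined part of size j acts as one more plain part with v flipped:
  \<open>part_ok\<close> is unchanged by this, f < i becomes f + 1 < i + 1, and so a second
  \<open>free_gf\<close> with \<open>\<not> v\<close> and \<open>Suc i\<close> appears. The
  discrepancy D moves on to j + 1 unchanged, hence is divisible by all powers of
  \<open>fps_X\<close>.\<close>

lemma over_gf_closed_0:
  assumes 1: "\<And>v i j. 1 \<le> i \<Longrightarrow> i \<le> k \<Longrightarrow> 1 \<le> j \<Longrightarrow>
      fps_X ^ (\<Sum>{..L}) * over_gf k v True i j L = npoch L * cont_gf k v i j L"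
    and "1 \<le> i" "i \<le> k" "1 \<le> j"
  shows "fps_X ^ (\<Sum>{..L}) * over_gf k v False i j (Suc L) =
    npoch L * (free_gf k v i j (Suc L) + free_gf k (\<not> v) (Suc i) j (Suc L))"
proof -
  define D where "D i j = fps_X ^ (\<Sum>{..L}) * over_gf k v False i j (Suc L) -
    npoch L * (free_gf k v i j (Suc L) + free_gf k (\<not> v) (Suc i) j (Suc L))" for i j
  have step: "D i j = D k (Suc j)" if ij: "1 \<le> i" "i \<le> k" "1 \<le> j" for i j
  proof -
    let ?T = "fps_X ^ (\<Sum>{..L}) :: rat fps"
    have c: "?T * over_gf k v True (k - f) (Suc j) L = npoch L * cont_gf k v (k - f) (Suc j) L"
      if "f < k" for f v
      using 1[of "k - f" "Suc j" v] that by auto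
    have a: "?T * (\<Sum>f = 1..<i. if part_ok v j f then fps_X ^ (j * f) * over_gf k v True (k - f) (Suc j) L else 0) =
       npoch L * (\<Sum>f = 1..<i. if part_ok v j f then fps_X ^ (j * f) * cont_gf k v (k - f) (Suc j) L else 0)"
      unfolding sum_distrib_left
    proof (intro sum.cong refl)
      fix f assume "f \<in> {1..<i}"
      then have "f < k" using ij by auto
      from c[OF this, of v] show "?T * (if part_ok v j f then fps_X ^ (j * f) * over_gf k v True (k - f) (Suc j) L else 0) =
         npoch L * (if part_ok v j f then fps_X ^ (j * f) * cont_gf k v (k - f) (Suc j) L else 0)"
        by (simp add: mult.left_commute)
    qed
    have b: "?T * (\<Sum>f<i. if Suc f < k \<and> part_ok v j f
         then fps_X ^ (j * Suc f) * over_gf k (\<not> v) True (k - Suc f) (Suc j) L else 0) =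
       npoch L * (\<Sum>f = 1..<Suc i. if part_ok (\<not> v) j f then fps_X ^ (j * f) * cont_gf k (\<not> v) (k - f) (Suc j) L else 0)"
      unfolding sum_distrib_left
    proof (rule sum.reindex_bij_witness[of _ "\<lambda>f. f - 1" Suc])
      fix f assume "f \<in> {..<i}"
      \<comment> \<open>If f + 1 = k, the overlined part is not allowed; on the other side
        \<open>cont_gf\<close> then has the bound 0 and vanishes.\<close>
      then have "Suc f < k \<or> k - Suc f = 0" by auto
      moreover have "part_ok (\<not> v) j (Suc f) = part_ok v j f" by (auto simp: part_ok_def)
      ultimately show "npoch L * (if part_ok (\<not> v) j (Suc f) then fps_X ^ (j * Suc f) * cont_gf k (\<not> v) (k - Suc f) (Suc j) L else 0) =
        ?T * (if Suc f < k \<and> part_ok v j f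
         then fps_X ^ (j * Suc f) * over_gf k (\<not> v) True (k - Suc f) (Suc j) L else 0)"
        using c[of "Suc f" "\<not> v"] by (auto simp: mult.left_commute)
    qed auto
    show ?thesis
      unfolding D_def over_gf_0_rec[OF ij] using ij
      by (subst (1 2) free_gf_expand)
         (simp_all only: diff_Suc_1 nat.simps if_False a b ring_distribs free_gf_Suc_k, simp_all)
  qed
  have "fps_X ^ (j + d) dvd D i j" if "1 \<le> i" "i \<le> k" "1 \<le> j" for i j d
    using that
  proof (induction d arbitrary: i j)
    case 0
    then have "fps_X ^ j dvd over_gf k v False i j (Suc L)"
      by (intro fps_X_power_dvdI) (auto simp: over_gf_low)
    then show ?case unfolding D_def using 0
      by (auto intro!: dvd_diff dvd_mult dvd_add free_gf_dvd)
  next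
    case (Suc d)
    have "fps_X ^ (Suc j + d) dvd D k (Suc j)" using Suc.prems by (intro Suc.IH) auto
    then show ?case using step[OF Suc.prems] by simp
  qed
  then have "D i j = 0"
    using assms(2-) by (intro fps_eq_0_if_dvd) (metis le_add2 power_le_dvd)
  then show ?thesis unfolding D_def by simp
qed

text \<open>The induction on \<open>L\<close> alternates between the two states:
  \<open>over_gf_closed_0\<close> for L + 1 clusters rests on this lemma for L clusters and is in
  turn used here for L + 1.\<close>

lemma over_gf_closed_1:
  assumes "1 \<le> i" "i \<le> k" "1 \<le> j"
  shows "fps_X ^ (\<Sum>{..L}) * over_gf k v True i j L = npoch L * cont_gf k v i j L"
  using assms
proof (induction L arbitrary: v i j)
  case 0
  have "over_gf k v True i j 0 = cont_gf k v i j 0"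
    unfolding over_gf_1_rec[OF 0] cont_gf_def using 0 by (auto intro!: sum.cong simp: over_gf_L0)
  then show ?case by (simp add: npoch_def)
next
  case (Suc L)
  let ?T = "fps_X ^ (\<Sum>{..L}) :: rat fps"
  let ?B = "(if even j \<or> \<not> v then free_gf k (\<not> v) (Suc i) j (Suc L) else 0) + fps_X ^ j * cont_gf k (\<not> v) (i - 1) j (Suc L)"
  have a: "?T * (\<Sum>f<i. if part_ok v j f then fps_X ^ (j * f) * over_gf k v False (k - f) (Suc j) (Suc L) else 0) =
      npoch L * (cont_gf k v i j (Suc L) +
      (\<Sum>f<i. if part_ok v j f then fps_X ^ (j * f) * free_gf k (\<not> v) (Suc (k - f)) (Suc j) (Suc L) else 0))"
    unfolding cont_gf_def sum.distrib[symmetric] sum_distrib_left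
  proof (intro sum.cong refl)
    fix f assume "f \<in> {..<i}"
    then have "?T * over_gf k v False (k - f) (Suc j) (Suc L) =
       npoch L * (free_gf k v (k - f) (Suc j) (Suc L) + free_gf k (\<not> v) (Suc (k - f)) (Suc j) (Suc L))"
      using Suc.prems by (intro over_gf_closed_0 Suc.IH) auto
    then show "?T * (if part_ok v j f then fps_X ^ (j * f) * over_gf k v False (k - f) (Suc j) (Suc L) else 0) =
      npoch L * ((if part_ok v j f then fps_X ^ (j * f) * free_gf k v (k - f) (Suc j) (Suc L) else 0) +
      (if part_ok v j f then fps_X ^ (j * f) * free_gf k (\<not> v) (Suc (k - f)) (Suc j) (Suc L) else 0))"
      by (auto simp: mult.left_commute distrib_left)
  qed
  have b: "?T * (\<Sum>f<i. if Suc f < k \<and> (even j \<or> \<not> v \<and> even f)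
       then fps_X ^ (j * Suc f) * over_gf k (\<not> v) True (k - Suc f) (Suc j) L else 0) =
      npoch L * (\<Sum>f<i. if even j \<or> \<not> v \<and> even f
       then fps_X ^ (j * Suc f) * cont_gf k (\<not> v) (k - Suc f) (Suc j) L else 0)"
    unfolding sum_distrib_left
  proof (intro sum.cong refl)
    fix f assume "f \<in> {..<i}"
    then have f: "Suc f < k \<or> k - Suc f = 0" by auto
    have "?T * over_gf k (\<not> v) True (k - Suc f) (Suc j) L = npoch L * cont_gf k (\<not> v) (k - Suc f) (Suc j) L"
      if "Suc f < k"
      using Suc.IH[of "k - Suc f" "Suc j" "\<not> v"] that by auto
    with f show "?T * (if Suc f < k \<and> (even j \<or> \<not> v \<and> even f)
       then fps_X ^ (j * Suc f) * over_gf k (\<not> v) True (k - Suc f) (Suc j) L else 0) =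
      npoch L * (if even j \<or> \<not> v \<and> even f
       then fps_X ^ (j * Suc f) * cont_gf k (\<not> v) (k - Suc f) (Suc j) L else 0)"
      by (auto simp: mult.left_commute)
  qed
  have "?T * over_gf k v True i j (Suc L) = npoch L * (cont_gf k v i j (Suc L) + ?B)"
    unfolding over_gf_1_rec[OF Suc.prems] barred_expand[OF Suc.prems nat.simps(3), unfolded diff_Suc_1, symmetric]
    by (simp only: nat.simps if_False diff_Suc_1 distrib_left a b add.assoc)
  then have "fps_X ^ (\<Sum>{..Suc L}) * over_gf k v True i j (Suc L) =
      npoch L * (fps_X ^ Suc L * cont_gf k v i j (Suc L) + fps_X ^ Suc L * ?B)"
    by (simp add: power_add mult_ac distrib_left)
  \<comment> \<open>The shift identity turns the overlined contribution into a multiple of the plain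
    one, which supplies the next factor $1 + q^{L+1}$ of \<open>npoch\<close>.\<close>
  also have "fps_X ^ Suc L * ?B = cont_gf k v i j (Suc L)"
    using cont_gf_shift[of k j i v "Suc L"] Suc.prems by simp
  finally show ?case by (simp add: npoch_Suc algebra_simps)
qed

theorem over_gf_closed:
  assumes "1 \<le> i" "i \<le> k" "1 \<le> j"
  shows "fps_X ^ (\<Sum>{..L}) * over_gf k v False i j (Suc L) =
    npoch L * (free_gf k v i j (Suc L) + free_gf k (\<not> v) (Suc i) j (Suc L))"
  using over_gf_closed_0[OF over_gf_closed_1 assms] .

section \<open>The local form of the parity condition\<close>

text \<open>
  \<open>S s\<close> is the set of marks of the parts of size \<open>s\<close>. Following its cluster backwards from the
  part marked \<open>m\<close> of size \<open>s\<close>, \<open>chain_sum\<close> adds up the sizes, and \<open>vb\<close> at the 1-marked part: at the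
  last part of a cluster this has the parity required to be even.
\<close>

primrec chain_sum :: "(nat \<Rightarrow> nat set) \<Rightarrow> (nat \<Rightarrow> nat) \<Rightarrow> nat \<Rightarrow> nat \<Rightarrow> nat" where
  "chain_sum S vb 0 s = 0"
| "chain_sum S vb (Suc m) s =
     s + (if m = 0 then vb s else if m \<in> S (s - 1) then chain_sum S vb m (s - 1) else chain_sum S vb m s)"

text \<open>The Gordon marking reduced to its sets of marks; \<open>b s\<close> says that s occurs
  overlined and \<open>vb\<close> is \<open>V\<close>. \<open>S_inter\<close> is the rule that only
  the smallest mark may be reused, and only before an overlined part; \<open>S_greedy\<close> is the
  minimality of each mark.\<close>

locale mark_sets =
  fixes S :: "nat \<Rightarrow> nat set" and b :: "nat \<Rightarrow> bool" and vb :: "nat \<Rightarrow> nat"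
  assumes S_0: "S 0 = {}"
    and S_pos: "m \<in> S s \<Longrightarrow> 1 \<le> m"
    and S_finite: "finite (S s)"
    and S_inter: "m \<in> S (Suc s) \<Longrightarrow> m \<in> S s \<Longrightarrow> b (Suc s) \<and> m = Min (S s)"
    and S_greedy: "m \<in> S (Suc s) \<Longrightarrow> 1 \<le> x \<Longrightarrow> x < m \<Longrightarrow> x \<notin> S (Suc s) \<Longrightarrow>
      x \<in> S s \<and> \<not> (b (Suc s) \<and> x = Min (S s))"
    and S_bar: "b s \<Longrightarrow> 1 \<in> S s"
    and S_bounded: "\<exists>n. \<forall>s>n. S s = {}"
    and vb_Suc: "vb (Suc s) = vb s + of_bool (b (Suc s))"
begin

abbreviation csum :: "nat \<Rightarrow> nat \<Rightarrow> nat" where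
  "csum m s \<equiv> chain_sum S vb m s"

text \<open>If the part marked m of size s - 1 exists, the part marked m + 1 of size s belongs to
  the cluster of that one. So a top is the last part of size s in its cluster.\<close>

definition top :: "nat \<Rightarrow> nat \<Rightarrow> bool" where
  "top s m \<longleftrightarrow> m \<in> S s \<and> (Suc m \<in> S s \<longrightarrow> m \<in> S (s - 1))"

definition terminal :: "nat \<Rightarrow> nat \<Rightarrow> bool" where
  "terminal s m \<longleftrightarrow> top s m \<and> Suc m \<notin> S (Suc s)"

text \<open>Equivalently, all m parts of the chain up to this one have size s.\<close>

definition rooted :: "nat \<Rightarrow> nat \<Rightarrow> bool" where
  "rooted s m \<longleftrightarrow> m \<in> S s \<and> (\<forall>x. 1 \<le> x \<and> x < m \<longrightarrow> x \<notin> S (s - 1))"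

text \<open>This demands evenness also of the clusters that go on to size s + 1; at odd s it will
  follow from evenness at the ends of clusters.\<close>

definition good :: "nat \<Rightarrow> bool" where
  "good s \<longleftrightarrow> (\<forall>m. top s m \<longrightarrow> even (csum m s))"

text \<open>At even s the sum of a rooted chain has the parity of \<open>vb s\<close>, so the chain
  may end there only if that is even.\<close>

definition continued :: "nat \<Rightarrow> bool" where
  "continued s \<longleftrightarrow> (\<forall>m. rooted s m \<longrightarrow> top s m \<longrightarrow> odd (vb s) \<longrightarrow> Suc m \<in> S (Suc s))"

lemma S_0' [simp]: "m \<notin> S 0" using S_0 by simp

lemma Min_le: "m \<in> S s \<Longrightarrow> Min (S s) \<le> m"
  using S_finite by simp

lemma Min_in: "m \<in> S s \<Longrightarrow> Min (S s) \<in> S s"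
  using S_finite by (intro Min_in) auto

lemma csum_1: "csum (Suc 0) s = s + vb s" by simp

lemma csum_prev: "1 \<le> m \<Longrightarrow> m \<in> S s \<Longrightarrow> csum (Suc m) (Suc s) = Suc s + csum m s"
  by simp

lemma csum_same: "1 \<le> m \<Longrightarrow> m \<notin> S s \<Longrightarrow> csum (Suc m) (Suc s) = Suc s + csum m (Suc s)"
  by simp

declare chain_sum.simps [simp del]

section \<open>Parities along chains\<close>

lemma csum_root:
  assumes "1 \<le> m" "\<And>x. 1 \<le> x \<Longrightarrow> x < m \<Longrightarrow> x \<notin> S s"
  shows "csum m (Suc s) = m * Suc s + vb (Suc s)"
  using assms
proof (induction m rule: dec_induct)
  case base
  then show ?case by (simp add: csum_1)
next
  case (step m)
  then have "csum (Suc m) (Suc s) = Suc s + csum m (Suc s)" by (intro csum_same) auto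
  with step show ?case by simp
qed

lemma csum_from:
  assumes "y < m" "1 \<le> y" "y \<in> S s" "\<And>x. y < x \<Longrightarrow> x < m \<Longrightarrow> x \<notin> S s"
  shows "csum m (Suc s) = (m - y) * Suc s + csum y s"
  using Suc_leI[OF assms(1)] assms(4)
proof (induction m rule: dec_induct)
  case base
  then show ?case using csum_prev[OF assms(2,3)] by simp
next
  case (step m)
  then have "csum (Suc m) (Suc s) = Suc s + csum m (Suc s)" using assms(2) by (intro csum_same) auto
  moreover have "Suc m - y = Suc (m - y)" using step by auto
  ultimately show ?case using step by (simp add: algebra_simps)
qed

text \<open>By minimality the marks 1, ..., m - 1 all occur at size s - 1. If the other m - 1 parts
  of the chain have that size, the formula is immediate. A further drop, at mark y through a reused
  mark, changes the sizes by y, brings in y - 1 by induction, and lowers \<open>vb\<close> by one;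
  modulo 2 these cancel.\<close>

lemma csum_Min:
  assumes "m \<in> S s" "m = Min (S s)"
  shows "odd (csum m s) = odd (vb s + m * s + (m - 1))"
  using assms
proof (induction s arbitrary: m rule: less_induct)
  case (less s)
  then obtain s' where s: "s = Suc s'" by (cases s) auto
  have min: "x \<notin> S s" if "x < m" for x using that less.prems Min_le by fastforce
  show ?case
  proof (cases "m = 1")
    case True
    then show ?thesis by (cases "even s"; cases "even (vb s)") (simp_all add: csum_1)
  next
    case False
    then obtain x where m: "m = Suc x" and x: "1 \<le> x" using S_pos[OF less.prems(1)] by (cases m) auto
    have nb: "\<not> b s" using S_bar[of s] min[of 1] m x by auto
    have sub: "y \<in> S s'" if "1 \<le> y" "y \<le> x" for y
      using S_greedy[of m s' y] less.prems(1) min[of y] that m s by auto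
    then have 1: "csum m s = s + csum x s'" using csum_prev[of x s'] x m s by auto
    from sub[OF x] obtain s'' where s': "s' = Suc s''" by (cases s') auto
    have vb: "vb s = vb s'" using nb s vb_Suc by simp
    show ?thesis
    proof (cases "\<forall>y. 1 \<le> y \<and> y < x \<longrightarrow> y \<notin> S s''")
      case True
      then have "csum x s' = x * s' + vb s'" unfolding s' by (intro csum_root x) auto
      then show ?thesis using 1 vb by (auto simp: m s)
    next
      case False
      then obtain y where y: "1 \<le> y" "y < x" "y \<in> S s''" by auto
      have ym: "b s'" "y = Min (S s'')" using S_inter[of y s''] sub[of y] y s' by auto
      have "z \<notin> S s''" if "y < z" "z < x" for z
        using S_inter[of z s''] sub[of z] y ym that s' by auto
      then have "csum x s' = (x - y) * s' + csum y s''" using csum_from[OF y(2,1,3)] s' by auto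
      moreover have "odd (csum y s'') = odd (vb s'' + y * s'' + (y - 1))"
        using less.IH[of s'' y] y ym s s' by auto
      moreover have "vb s' = Suc (vb s'')" using vb_Suc ym s' by simp
      ultimately show ?thesis using 1 vb y unfolding m s s' by auto
    qed
  qed
qed

text \<open>A cluster that reaches two sites further is followed by a cluster running two sites behind it.\<close>

lemma csum_shift:
  assumes "m \<in> S s" "m \<in> S (Suc (Suc s))" "m \<notin> S (Suc s)" "m < y" "y \<in> S (Suc s)"
  shows "odd (csum m (Suc (Suc s))) =
    (odd (csum m s) \<noteq> (b (Suc (Suc s)) \<and> m < Min (S (Suc s))))"
  using assms
proof (induction m arbitrary: s y)
  case 0
  then show ?case using S_pos by fastforce
next
  case (Suc x)
  let ?m = "Suc x"
  have Min1: "Min (S (Suc s)) \<in> S (Suc s)" using Suc.prems Min_in by blast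
  obtain t where s: "s = Suc t" using Suc.prems by (cases s) auto
  show ?case
  proof (cases "x = 0")
    case True
    then have "\<not> b (Suc s)" using Suc.prems S_bar[of "Suc s"] by auto
    moreover have "?m < Min (S (Suc s))"
      using Min1 Suc.prems S_pos[OF Min1] True by (metis One_nat_def le_neq_implies_less)
    ultimately show ?thesis using vb_Suc[of s] vb_Suc[of "Suc s"] True by (auto simp: csum_1)
  next
    case False
    then have x: "1 \<le> x" by simp
    show ?thesis
    proof (cases "x \<in> S t")
      case xt: True
      have d: "csum ?m s = s + csum x t" using csum_prev[OF x xt] s by simp
      show ?thesis
      proof (cases "x \<in> S s")
        case False
        have xs: "x \<in> S (Suc s)" using S_greedy[of y s x] Suc.prems x False by auto
        then have d2: "csum ?m (Suc (Suc s)) = Suc (Suc s) + csum x (Suc s)" using csum_prev[OF x] by simp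
        have "odd (csum x (Suc s)) = (odd (csum x t) \<noteq> (b (Suc s) \<and> x < Min (S s)))"
          using Suc.IH[of t ?m] xt xs False Suc.prems s by auto
        moreover have "\<not> (b (Suc s) \<and> x < Min (S s))"
        proof
          assume a: "b (Suc s) \<and> x < Min (S s)"
          then have "?m = Min (S s)" using Min_le[OF Suc.prems(1)] by auto
          with a show False using S_greedy[of y s ?m] Suc.prems by auto
        qed
        moreover have "\<not> ?m < Min (S (Suc s))" using Min_le[OF xs] by auto
        ultimately show ?thesis using d d2 by auto
      next
        case True
        \<comment> \<open>A mark shared by neighbouring sizes is the smallest at the lower one. This
          forces 1, ..., x to occur at s, so among 1, ..., x + 1 only the mark 1 can occur at s + 1,
          and both sums become explicit.\<close>
        then have bx: "b s" "x = Min (S t)" using S_inter[of x t] xt s by auto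
        have Vs: "vb s = Suc (vb t)" using vb_Suc[of t] bx s by simp
        have below: "z \<in> S s" if "1 \<le> z" "z \<le> x" for z
        proof (rule ccontr)
          assume z: "z \<notin> S s"
          then have "z < x" using True that by (cases "z = x") auto
          then have "z \<in> S t" using S_greedy[of x t z] True z that s by auto
          then show False using Min_le[of z t] bx \<open>z < x\<close> by auto
        qed
        have "Min (S s) = 1" using Min_le[OF below[of 1]] S_pos[OF Min_in[OF below[of 1]]] x by auto
        then have above: "z \<notin> S (Suc s)" if "1 < z" "z \<le> ?m" for z
          using S_inter[of z s] below[of z] Suc.prems that by (cases "z = ?m") auto
        have K: "odd (csum x t) = odd (vb t + x * t + (x - 1))" using csum_Min[OF xt bx(2)] .
        show ?thesis
        proof (cases "b (Suc s)")
          case True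
          then have one: "1 \<in> S (Suc s)" by (rule S_bar)
          have "csum ?m (Suc (Suc s)) = (?m - 1) * Suc (Suc s) + csum 1 (Suc s)"
            using one above x by (intro csum_from) auto
          moreover have "\<not> ?m < Min (S (Suc s))" using Min_le[OF one] by auto
          ultimately show ?thesis using d K Vs vb_Suc[of s] True x s by (auto simp: csum_1)
        next
          case False
          then have one: "1 \<notin> S (Suc s)" using S_inter[of 1 s] below[of 1] x by auto
          have none: "z \<notin> S (Suc s)" if "1 \<le> z" "z \<le> ?m" for z
            using one above[of z] that by (cases "z = 1") auto
          have "csum ?m (Suc (Suc s)) = ?m * Suc (Suc s) + vb (Suc (Suc s))"
            using none by (intro csum_root) auto
          moreover have "?m < Min (S (Suc s))"
            using none[OF S_pos[OF Min1]] Min1 by (meson leI)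
          ultimately show ?thesis using d K Vs vb_Suc[of s] vb_Suc[of "Suc s"] False x s by auto
        qed
      qed
    next
      case xt: False
      have d: "csum ?m s = s + csum x s" using csum_same[OF x xt] s by simp
      have xs: "x \<in> S s" using S_greedy[of ?m t x] Suc.prems x xt s by auto
      show ?thesis
      proof (cases "x \<in> S (Suc s)")
        case False
        then have xss: "x \<in> S (Suc (Suc s))" using S_greedy[of ?m "Suc s" x] Suc.prems x by auto
        have d2: "csum ?m (Suc (Suc s)) = Suc (Suc s) + csum x (Suc (Suc s))" using csum_same[OF x False] by simp
        have "x < Min (S (Suc s)) \<longleftrightarrow> ?m < Min (S (Suc s))"
          using Min1 False Suc.prems by (metis Suc_lessD Suc_lessI)
        with Suc.IH[of s y] xs xss False Suc.prems d d2 show ?thesis by auto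
      next
        case True
        then have bx: "b (Suc s)" "x = Min (S s)" using S_inter[of x s] xs by auto
        have d2: "csum ?m (Suc (Suc s)) = Suc (Suc s) + csum x (Suc s)" using csum_prev[OF x True] by simp
        have "z \<notin> S s" if "z < x" for z using Min_le[of z s] bx that by auto
        then have "csum x (Suc s) = x * Suc s + vb (Suc s)" using x by (intro csum_root) auto
        moreover have "odd (csum x s) = odd (vb s + x * s + (x - 1))" using csum_Min[OF xs bx(2)] .
        moreover have "\<not> ?m < Min (S (Suc s))" using Min_le[OF True] by auto
        ultimately show ?thesis using d d2 vb_Suc[of s] bx x by auto
      qed
    qed
  qed
qed

text \<open>The cluster is followed upward in marks within one size; as the size has finitely many
  parts there is a last mark, and it is a top.\<close>

lemma last_run:
  assumes "w < x" "x \<in> S (Suc s)" "\<And>z. w < z \<Longrightarrow> z < x \<Longrightarrow> z \<in> S (Suc s) \<and> z \<notin> S s"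
  obtains w' where "x \<le> w'" "top (Suc s) w'" "\<And>z. w < z \<Longrightarrow> z < w' \<Longrightarrow> z \<in> S (Suc s) \<and> z \<notin> S s"
proof -
  define Q where "Q w' \<longleftrightarrow> x \<le> w' \<and> w' \<in> S (Suc s) \<and> (\<forall>z. w < z \<and> z < w' \<longrightarrow> z \<in> S (Suc s) \<and> z \<notin> S s)" for w'
  have Qx: "Q x" using assms by (auto simp: Q_def)
  have bd: "\<forall>w'. Q w' \<longrightarrow> w' \<le> Max (S (Suc s))" using S_finite by (auto simp: Q_def)
  define g where "g = (GREATEST w'. Q w')"
  have Qg: "Q g" unfolding g_def using GreatestI_nat[of Q x] Qx bd by blast
  have "\<not> Q (Suc g)"
  proof
    assume "Q (Suc g)"
    then have "Suc g \<le> g" unfolding g_def by (rule Greatest_le_nat) (use bd in blast)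
    then show False by simp
  qed
  then have "Suc g \<in> S (Suc s) \<longrightarrow> g \<in> S s"
    using Qg assms(1) less_Suc_eq by (auto simp: Q_def)
  then show thesis using that[of g] Qg by (auto simp: Q_def top_def)
qed

text \<open>The chain enters size s from the largest mark x < m of size s - 1. That part is a top,
  so its sum is even by goodness, and the m - x parts of even size s do not change the
  parity.\<close>

lemma csum_even_unrooted:
  assumes "even s" "\<And>u. s = Suc u \<Longrightarrow> good u" "m \<in> S s" "\<not> rooted s m"
  shows "even (csum m s)"
proof -
  obtain u where s: "s = Suc u" using assms(3) by (cases s) auto
  from assms(3,4) obtain x0 where "1 \<le> x0" "x0 < m" "x0 \<in> S u" by (auto simp: rooted_def s)
  define x where "x = Max {x \<in> S u. x < m}"
  have fin: "finite {x \<in> S u. x < m}" by auto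
  have "x \<in> {x \<in> S u. x < m}" unfolding x_def by (rule Max_in[OF fin]) (use \<open>x0 \<in> S u\<close> \<open>x0 < m\<close> in auto)
  then have x: "x \<in> S u" "x < m" "1 \<le> x" using S_pos by auto
  have above: "z \<notin> S u" if z: "x < z" "z < m" for z
  proof
    assume "z \<in> S u"
    then have "z \<le> x" unfolding x_def using z by (intro Max_ge[OF fin]) auto
    with z show False by simp
  qed
  have "csum m s = (m - x) * Suc u + csum x u"
    unfolding s using x above by (intro csum_from) auto
  moreover have "top u x"
  proof -
    have "Suc x \<notin> S u"
    proof
      assume a: "Suc x \<in> S u"
      with above[of "Suc x"] x have "m = Suc x" by force
      with a assms(3) S_inter[of m u] s have "m = Min (S u)" by auto
      with Min_le[OF x(1)] x show False by simp
    qed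
    with x show ?thesis by (simp add: top_def)
  qed
  ultimately show ?thesis using assms(1,2) s by (auto simp: good_def)
qed

lemma csum_rooted:
  assumes "rooted s m" "even s"
  shows "odd (csum m s) = odd (vb s)"
proof -
  obtain u where s: "s = Suc u" using assms by (cases s) (auto simp: rooted_def)
  have "csum m s = m * s + vb s" unfolding s using assms s S_pos by (intro csum_root) (auto simp: rooted_def)
  with assms show ?thesis by simp
qed

lemma rooted_1:
  assumes "rooted s m" shows "1 \<in> S s"
proof (rule ccontr)
  assume n: "1 \<notin> S s"
  then have "1 < m" using assms S_pos[of m s] by (cases "m = 1") (auto simp: rooted_def)
  obtain u where s: "s = Suc u" using assms by (cases s) (auto simp: rooted_def)
  show False using S_greedy[of m u 1] assms n \<open>1 < m\<close> s by (auto simp: rooted_def)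
qed

lemma rooted_below:
  assumes "rooted s m" "1 \<le> x" "x \<le> m" shows "x \<in> S s"
proof (rule ccontr)
  assume n: "x \<notin> S s"
  then have "x < m" using assms by (cases "x = m") (auto simp: rooted_def)
  obtain u where s: "s = Suc u" using assms by (cases s) (auto simp: rooted_def)
  show False using S_greedy[of m u x] assms n \<open>x < m\<close> s by (auto simp: rooted_def)
qed

text \<open>As there are only finitely many parts, this rules out bad tops at odd sizes.\<close>

lemma bad_top_recurs:
  assumes H: "\<And>s m. terminal s m \<Longrightarrow> even (csum m s)"
    and s: "odd s" and w: "top s w" "odd (csum w s)"
  shows "\<exists>w'. top (Suc (Suc s)) w' \<and> odd (csum w' (Suc (Suc s)))"
proof -
  have w1: "w \<in> S s" "1 \<le> w" using w S_pos by (auto simp: top_def)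
  \<comment> \<open>An odd sum cannot end here, so the cluster goes on with w + 1 at s + 1. The
    parts of even size s + 1 keep the sum odd, so it must go on to s + 2 as well.\<close>
  have Sw: "Suc w \<in> S (Suc s)" using H[of s w] w by (auto simp: terminal_def)
  obtain w' where w': "Suc w \<le> w'" "top (Suc s) w'" "\<And>z. w < z \<Longrightarrow> z < w' \<Longrightarrow> z \<in> S (Suc s) \<and> z \<notin> S s"
    using last_run[of w "Suc w" s] Sw by auto
  have "csum w' (Suc s) = (w' - w) * Suc s + csum w s"
    using w' w1 by (intro csum_from) auto
  then have "odd (csum w' (Suc s))" using s w by simp
  then have Sw': "Suc w' \<in> S (Suc (Suc s))" using H[of "Suc s" w'] w' by (auto simp: terminal_def)
  have dSw: "csum (Suc w) (Suc s) = Suc s + csum w s" using csum_prev w1 by auto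
  show ?thesis
  proof (cases "w \<in> S (Suc s)")
    \<comment> \<open>A reused mark w would be terminal at size s + 1 with an odd sum, which is
      excluded.\<close>
    case True
    then have bw: "b (Suc s)" "w = Min (S s)" using S_inter w1 by auto
    have "z \<notin> S s" if "z < w" for z using Min_le[of z s] bw that by auto
    then have "csum w (Suc s) = w * Suc s + vb (Suc s)" using w1 by (intro csum_root) auto
    moreover have "odd (csum w s) = odd (vb s + w * s + (w - 1))" using csum_Min[OF w1(1) bw(2)] .
    ultimately have "odd (csum w (Suc s))" using w s w1 vb_Suc[of s] bw by auto
    moreover have "terminal (Suc s) w"
      unfolding terminal_def top_def
    proof (intro conjI impI True)
      show "w \<in> S (Suc s - 1)" using w1 by simp
      show "Suc w \<notin> S (Suc (Suc s))"
      proof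
        assume "Suc w \<in> S (Suc (Suc s))"
        then have "Suc w = Min (S (Suc s))" using S_inter[of "Suc w" "Suc s"] Sw by auto
        with Min_le[OF True] show False by simp
      qed
    qed
    ultimately show ?thesis using H by blast
  next
    case wn: False
    have wss: "w \<in> S (Suc (Suc s))" using S_greedy[OF Sw', of w] w' wn w1 by auto
    show ?thesis
    proof (cases "Suc w \<in> S (Suc (Suc s))")
      case True
      then have bw: "b (Suc (Suc s))" "Suc w = Min (S (Suc s))" using S_inter[of "Suc w" "Suc s"] Sw by auto
      have "z \<notin> S (Suc s)" if "z < Suc w" for z using Min_le[of z "Suc s"] bw that by auto
      then have "csum (Suc w) (Suc (Suc s)) = Suc w * Suc (Suc s) + vb (Suc (Suc s))" by (intro csum_root) auto
      moreover have "odd (csum (Suc w) (Suc s)) = odd (vb (Suc s) + Suc w * Suc s + (Suc w - 1))"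
        using csum_Min[OF Sw bw(2)] .
      ultimately have "odd (csum (Suc w) (Suc (Suc s)))" using w s dSw vb_Suc[of "Suc s"] bw by auto
      moreover have "top (Suc (Suc s)) (Suc w)" using True Sw by (auto simp: top_def)
      ultimately show ?thesis by blast
    next
      case False
      have "\<not> (b (Suc (Suc s)) \<and> w < Min (S (Suc s)))"
      proof
        assume a: "b (Suc (Suc s)) \<and> w < Min (S (Suc s))"
        then have "Suc w = Min (S (Suc s))" using Min_le[OF Sw] by auto
        with a show False using S_greedy[OF Sw', of "Suc w"] w' False by auto
      qed
      then have "odd (csum w (Suc (Suc s)))"
        using csum_shift[OF w1(1) wss wn _ Sw] w by auto
      moreover have "top (Suc (Suc s)) w" using False wss by (auto simp: top_def)
      ultimately show ?thesis by blast
    qed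
  qed
qed

lemma good_if_terminal_even:
  assumes H: "\<And>s m. terminal s m \<Longrightarrow> even (csum m s)" and "odd s"
  shows "good s"
proof (rule ccontr)
  assume "\<not> good s"
  then obtain w where "top s w" "odd (csum w s)" by (auto simp: good_def)
  then have "\<exists>w. top (s + 2 * n) w \<and> odd (csum w (s + 2 * n))" for n
  proof (induction n)
    case (Suc n)
    then show ?case using bad_top_recurs[OF H, of "s + 2 * n"] assms by auto
  qed auto
  then have "S (s + 2 * n) \<noteq> {}" for n by (auto simp: top_def)
  moreover obtain B where "\<forall>s>B. S s = {}" using S_bounded by blast
  moreover have "s + 2 * Suc B > B" by simp
  ultimately show False by blast
qed

text \<open>At even sizes an unrooted part inherits evenness from the preceding odd size, and a
  rooted one has the parity of \<open>vb s\<close>, so it must go on if that is odd. At odd sizes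
  the step from terminal parts to all tops is \<open>good_if_terminal_even\<close>.\<close>

lemma terminal_even_iff:
  "(\<forall>s m. terminal s m \<longrightarrow> even (csum m s)) \<longleftrightarrow> (\<forall>s. even s \<longrightarrow> good (Suc s) \<and> continued s)"
proof
  assume H: "\<forall>s m. terminal s m \<longrightarrow> even (csum m s)"
  show "\<forall>s. even s \<longrightarrow> good (Suc s) \<and> continued s"
  proof (intro allI impI conjI)
    fix s :: nat assume "even s"
    then show "good (Suc s)" using good_if_terminal_even[of "Suc s"] H by auto
    show "continued s" unfolding continued_def
      using csum_rooted[OF _ \<open>even s\<close>] H by (auto simp: terminal_def)
  qed
next
  assume H: "\<forall>s. even s \<longrightarrow> good (Suc s) \<and> continued s"
  show "\<forall>s m. terminal s m \<longrightarrow> even (csum m s)"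
  proof (intro allI impI)
    fix s m assume t: "terminal s m"
    then have m: "m \<in> S s" "top s m" by (auto simp: terminal_def top_def)
    show "even (csum m s)"
    proof (cases "odd s")
      case True
      then obtain s' where "s = Suc s'" "even s'" by (cases s) auto
      then show ?thesis using H m by (auto simp: good_def)
    next
      case False
      have g: "good u" if su: "s = Suc u" for u
      proof -
        obtain u' where "u = Suc u'" "even u'" using su False by (cases u) auto
        then show ?thesis using H by blast
      qed
      show ?thesis
      proof (cases "rooted s m")
        case True
        then show ?thesis using csum_rooted[OF True] False H m t
          by (auto simp: continued_def terminal_def)
      next
        case False': False
        show ?thesis using csum_even_unrooted[OF _ g m(1) False'] False by auto
      qed
    qed
  qed
qed

section \<open>The total over the tops of one size\<close>

definition entries :: "nat \<Rightarrow> nat set" where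
  "entries s = {m \<in> S (Suc s). m - 1 \<in> S s}"

text \<open>A part that is no top is followed at the same size by one whose sum is larger by s + 1.
  In the total over all parts of the size these cancel, leaving the tops on one side and the parts
  without a predecessor of this size on the other.\<close>

lemma sum_tops:
  "(\<Sum>m | top (Suc s) m. csum m (Suc s)) =
     card (S (Suc s)) * Suc s + (if 1 \<in> S (Suc s) then vb (Suc s) else 0) + (\<Sum>m\<in>entries s. csum (m - 1) s)"
proof -
  let ?S = "S (Suc s)"
  let ?NT = "{m \<in> ?S. Suc m \<in> ?S \<and> m \<notin> S s}"
  let ?T = "{m. top (Suc s) m}"
  let ?f = "\<lambda>m. csum m (Suc s)"
  have fin [simp]: "finite (S s)" for s by (rule S_finite)
  have U: "entries s \<subseteq> ?S - {1}" using S_pos[of 0 s] by (auto simp: entries_def)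
  have NT: "?S - entries s - {1} = Suc ` ?NT"
  proof (intro subset_antisym subsetI)
    fix m assume m: "m \<in> ?S - entries s - {1}"
    then obtain x where x: "m = Suc x" "1 \<le> x" using S_pos[of m "Suc s"] by (cases m) auto
    then have "x \<in> ?S" using S_greedy[of m s x] m by (auto simp: entries_def)
    then show "m \<in> Suc ` ?NT" using x m by (auto simp: entries_def)
  qed (use S_pos in \<open>fastforce simp: entries_def\<close>)
  have "sum ?f ?T + sum ?f ?NT = sum ?f ?S"
  proof -
    have "finite ?T" by (rule finite_subset[of _ ?S]) (auto simp: top_def)
    then have "sum ?f (?T \<union> ?NT) = sum ?f ?T + sum ?f ?NT"
      by (intro sum.union_disjoint) (auto simp: top_def)
    moreover have "?T \<union> ?NT = ?S" by (auto simp: top_def)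
    ultimately show ?thesis by simp
  qed
  also have "sum ?f ?S = sum ?f (?S \<inter> {1}) + sum ?f (entries s) + sum ?f (?S - entries s - {1})"
  proof -
    have "?S = (?S \<inter> {1}) \<union> entries s \<union> (?S - entries s - {1})" using U by auto
    then have "sum ?f ?S = sum ?f ((?S \<inter> {1}) \<union> entries s \<union> (?S - entries s - {1}))" by (rule arg_cong)
    also have "\<dots> = sum ?f ((?S \<inter> {1}) \<union> entries s) + sum ?f (?S - entries s - {1})"
      using U by (intro sum.union_disjoint) (auto intro: finite_subset[OF U])
    also have "sum ?f ((?S \<inter> {1}) \<union> entries s) = sum ?f (?S \<inter> {1}) + sum ?f (entries s)"
      using U by (intro sum.union_disjoint) (auto intro: finite_subset[OF U])
    finally show ?thesis .
  qed
  also have "sum ?f (?S \<inter> {1}) = (if 1 \<in> ?S then Suc s + vb (Suc s) else 0)"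
    by (auto simp: csum_1)
  also have "sum ?f (entries s) = card (entries s) * Suc s + (\<Sum>m\<in>entries s. csum (m - 1) s)"
  proof -
    have "sum ?f (entries s) = (\<Sum>m\<in>entries s. Suc s + csum (m - 1) s)"
    proof (intro sum.cong refl)
      fix m assume "m \<in> entries s"
      then show "?f m = Suc s + csum (m - 1) s"
        using csum_prev[of "m - 1" s] S_pos[of "m - 1" s] by (cases m) (auto simp: entries_def)
    qed
    then show ?thesis unfolding sum.distrib by simp
  qed
  also have "sum ?f (?S - entries s - {1}) = card (?S - entries s - {1}) * Suc s + sum ?f ?NT"
  proof -
    have "sum ?f (?S - entries s - {1}) = (\<Sum>m\<in>?NT. ?f (Suc m))"
      unfolding NT by (subst sum.reindex) auto
    also have "\<dots> = (\<Sum>m\<in>?NT. Suc s + ?f m)"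
      using S_pos by (intro sum.cong refl csum_same) auto
    also have "\<dots> = (\<Sum>m\<in>?NT. Suc s) + sum ?f ?NT" by (rule sum.distrib)
    finally show ?thesis unfolding NT by (simp add: card_image)
  qed
  finally have main: "sum ?f ?T = (if 1 \<in> ?S then Suc s + vb (Suc s) else 0) +
     (card (entries s) * Suc s + (\<Sum>m\<in>entries s. csum (m - 1) s)) + card (?S - entries s - {1}) * Suc s"
    by simp
  have "card (entries s) \<le> card ?S" using U by (intro card_mono) auto
  then have "card ?S = card (entries s) + card (?S - entries s)"
    using U by (subst card_Diff_subset) (auto intro: finite_subset[OF U])
  also have "card (?S - entries s) = (if 1 \<in> ?S then 1 else 0) + card (?S - entries s - {1})"
  proof (cases "1 \<in> ?S")
    case True
    then have "1 \<in> ?S - entries s" using U by auto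
    then have "card (?S - entries s) = Suc (card (?S - entries s - {1}))" by (intro card.remove) auto
    with True show ?thesis by simp
  qed auto
  finally show ?thesis using main by (simp add: algebra_simps)
qed

definition root_entries :: "nat \<Rightarrow> nat set" where
  "root_entries s = {m \<in> entries s. rooted s (m - 1)}"

text \<open>A rooted chain requires all smaller marks to occur at its size. So the smaller of two
  such entries would be a mark shared with size s, hence the smallest there, although its
  predecessor has a smaller mark.\<close>

lemma root_entries_unique:
  assumes "m \<in> root_entries s" "m' \<in> root_entries s"
  shows "m = m'"
proof -
  have "\<not> m < m'" if "m \<in> root_entries s" "m' \<in> root_entries s" for m m'
  proof
    assume lt: "m < m'"
    have m: "m \<in> S (Suc s)" "m - 1 \<in> S s" "rooted s (m' - 1)"
      using that by (auto simp: root_entries_def entries_def)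
    then have "m \<in> S s" using rooted_below[of s "m' - 1" m] lt S_pos[of m] by auto
    then have "m = Min (S s)" using S_inter m by blast
    with Min_le[OF m(2)] S_pos[OF m(1)] show False by linarith
  qed
  with assms show ?thesis by (metis linorder_neqE_nat)
qed

text \<open>Entries from unrooted chains contribute even sums, and the rooted chain that enters, if
  any, contributes \<open>vb s\<close>.\<close>

lemma tops_parity:
  assumes s: "even s" and g: "\<And>u. s = Suc u \<Longrightarrow> good u"
  shows "odd (\<Sum>m | top (Suc s) m. csum m (Suc s)) =
    odd (card (S (Suc s)) + (if 1 \<in> S (Suc s) then vb (Suc s) else 0) +
         (if root_entries s \<noteq> {} then vb s else 0))"
proof -
  have fin: "finite (entries s)" unfolding entries_def using S_finite by auto
  have "(\<Sum>m\<in>entries s. csum (m - 1) s) =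
     (\<Sum>m\<in>root_entries s. csum (m - 1) s) + (\<Sum>m\<in>entries s - root_entries s. csum (m - 1) s)"
    using fin by (metis (no_types, lifting) add.commute mem_Collect_eq root_entries_def subsetI sum.subset_diff)
  moreover have "even (\<Sum>m\<in>entries s - root_entries s. csum (m - 1) s)"
    using csum_even_unrooted[OF s g] by (intro dvd_sum) (auto simp: root_entries_def entries_def)
  moreover have "odd (\<Sum>m\<in>root_entries s. csum (m - 1) s) = odd (if root_entries s \<noteq> {} then vb s else 0)"
  proof (cases "root_entries s = {}")
    case False
    then obtain m where "m \<in> root_entries s" by blast
    then have "root_entries s = {m}" using root_entries_unique by blast
    then show ?thesis using csum_rooted[OF _ s, of "m - 1"] by (auto simp: root_entries_def)
  qed auto
  ultimately show ?thesis unfolding sum_tops using s by auto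
qed

abbreviation site_ok :: "nat \<Rightarrow> bool" where
  "site_ok s \<equiv> letter_ok (odd (vb s)) (1 \<in> S s) (Suc s) (card (S (Suc s)) - of_bool (b (Suc s))) (b (Suc s))"

lemma card_bar: "b s \<Longrightarrow> 1 \<le> card (S s)"
  using S_bar[of s] S_finite[of s] by (metis One_nat_def Suc_leI card_gt_0_iff empty_iff)

text \<open>The counterpart of \<open>new_mark\<close> for the actual marks.\<close>

lemma one_in:
  "1 \<in> S (Suc s) \<longleftrightarrow> b (Suc s) \<or> (1 \<notin> S s \<and> S (Suc s) \<noteq> {})"
proof (cases "b (Suc s)")
  case False
  show ?thesis
  proof (cases "1 \<in> S s")
    case True
    with False show ?thesis using S_inter[of 1 s] by auto
  next
    case n: False
    show ?thesis
    proof (cases "S (Suc s) = {}")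
      case F: False
      then obtain m where m: "m \<in> S (Suc s)" by blast
      have "1 \<in> S (Suc s)"
      proof (rule ccontr)
        assume "1 \<notin> S (Suc s)"
        moreover from this have "1 < m" using S_pos[OF m] m by (cases "m = 1") auto
        ultimately show False using S_greedy[OF m, of 1] n by auto
      qed
      with n F show ?thesis by auto
    qed (use False in auto)
  qed
next
  case True
  then have "1 \<in> S (Suc s)" by (rule S_bar)
  with True show ?thesis by simp
qed

lemma root_entries_nonempty:
  assumes "1 \<in> S s" "\<And>m. rooted s m \<Longrightarrow> top s m \<Longrightarrow> Suc m \<in> S (Suc s)"
  shows "root_entries s \<noteq> {}"
proof -
  obtain u where s: "s = Suc u" using assms by (cases s) auto
  obtain m where m: "1 \<le> m" "top s m" "\<And>z. 0 < z \<Longrightarrow> z < m \<Longrightarrow> z \<in> S s \<and> z \<notin> S u"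
    using last_run[of 0 1 u] assms(1) s by auto
  then have "rooted s m" by (auto simp: rooted_def top_def s)
  with assms(2)[of m] m have "Suc m \<in> root_entries s" by (auto simp: root_entries_def entries_def top_def)
  then show ?thesis by blast
qed

lemma root_entries_empty: "1 \<notin> S s \<Longrightarrow> root_entries s = {}"
  using rooted_1 by (auto simp: root_entries_def)

text \<open>The even total over the tops fixes the parity of the number of parts;
  \<open>continued\<close> makes a rooted chain enter when \<open>vb s\<close> is odd and 1 is a
  mark at s. That no overlined part may follow in this case is seen from the top with mark
  1.\<close>

lemma site_ok_if_good:
  assumes s: "even s" and g: "\<And>u. s = Suc u \<Longrightarrow> good u" and G: "good (Suc s)" "continued s"
  shows "site_ok s"
proof -
  have par: "even (card (S (Suc s)) + (if 1 \<in> S (Suc s) then vb (Suc s) else 0) +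
         (if root_entries s \<noteq> {} then vb s else 0))"
  proof -
    have "even (\<Sum>m | top (Suc s) m. csum m (Suc s))"
      using G(1) by (intro dvd_sum) (auto simp: good_def)
    then show ?thesis using tops_parity[OF s g] by blast
  qed
  have ex: "\<not> (odd (vb s) \<and> b (Suc s) \<and> 1 \<in> S s)"
  proof
    assume a: "odd (vb s) \<and> b (Suc s) \<and> 1 \<in> S s"
    then have "top (Suc s) 1" using S_bar[of "Suc s"] by (auto simp: top_def)
    then have "even (csum 1 (Suc s))" using G(1) by (simp add: good_def)
    with a s vb_Suc[of s] show False by (simp add: csum_1)
  qed
  have re: "root_entries s \<noteq> {}" if "odd (vb s)" "1 \<in> S s"
    using G(2) that by (intro root_entries_nonempty) (auto simp: continued_def)
  have ce: "card (S (Suc s)) = 0 \<longleftrightarrow> S (Suc s) = {}" using S_finite by simp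
  show ?thesis
    using par ex re one_in[of s] ce root_entries_empty[of s] card_bar[of "Suc s"] vb_Suc[of s] s
    by (cases "b (Suc s)"; cases "1 \<in> S s"; cases "odd (vb s)"; cases "S (Suc s) = {}")
       (auto simp: letter_ok_def split: if_splits)
qed

text \<open>If m were not continued, minimality of a mark at s + 1 would put m + 1 at size s and, m
  being a top, m at size s - 1. There m is the reused smallest mark and a top, and by
  \<open>csum_Min\<close> its sum is odd, against goodness.\<close>

lemma continued_if_site_ok:
  assumes s: "even s" and g: "\<And>u. s = Suc u \<Longrightarrow> good u" and ok: "site_ok s"
  shows "continued s"
  unfolding continued_def
proof (intro allI impI)
  fix m assume m: "rooted s m" "top s m" "odd (vb s)"
  have one: "1 \<in> S s" using rooted_1 m by blast
  have mS: "m \<in> S s" "1 \<le> m" using m S_pos by (auto simp: top_def)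
  have nb: "\<not> b (Suc s)" and "S (Suc s) \<noteq> {}"
    using ok m(3) one s by (auto simp: letter_ok_def)
  then obtain z where z: "z \<in> S (Suc s)" by blast
  show "Suc m \<in> S (Suc s)"
  proof (rule ccontr)
    assume n: "Suc m \<notin> S (Suc s)"
    have "\<not> z \<le> m" using rooted_below[OF m(1), of z] S_pos[OF z] S_inter[OF z] nb by auto
    with n z have "Suc m < z" by (metis Suc_lessI not_le)
    then have Sm: "Suc m \<in> S s" using S_greedy[OF z, of "Suc m"] n by auto
    obtain u where u: "s = Suc u" using one by (cases s) auto
    from Sm m(2) have mu: "m \<in> S u" by (auto simp: top_def u)
    then have bm: "b s" "m = Min (S u)" using S_inter[of m u] mS u by auto
    have "odd (csum m u) = odd (vb u + m * u + (m - 1))" using csum_Min[OF mu bm(2)] .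
    then have "odd (csum m u)" using m(3) vb_Suc[of u] bm u s mS by auto
    moreover have "Suc m \<notin> S u"
    proof
      assume "Suc m \<in> S u"
      then have "Suc m = Min (S u)" using S_inter[of "Suc m" u] Sm u by auto
      with bm show False by simp
    qed
    then have "top u m" using mu by (simp add: top_def)
    ultimately show False using g u by (auto simp: good_def)
  qed
qed

text \<open>A letter knows only the number of parts, so it fixes just the total over the tops. For
  tops below the largest mark evenness comes from the preceding size or, for a reused mark 1, from
  the ban on overlined parts (\<open>nonmax\<close>); the total then settles the last top.\<close>

lemma good_if_site_ok:
  assumes s: "even s" and g: "\<And>u. s = Suc u \<Longrightarrow> good u" and ok: "site_ok s"
  shows "good (Suc s)"
  unfolding good_def
proof (intro allI impI)
  have cont: "continued s" by (rule continued_if_site_ok) (use assms in auto)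
  have nonmax: "even (csum w (Suc s))" if w: "top (Suc s) w" "w < y" "y \<in> S (Suc s)" for w y
  proof -
    have wS: "w \<in> S (Suc s)" "1 \<le> w" using w S_pos by (auto simp: top_def)
    have both: ?thesis if ws: "w \<in> S s"
    proof -
      have bw: "b (Suc s)" "w = Min (S s)" using S_inter[OF wS(1) ws] by auto
      have below: "z \<notin> S s" if "z < w" for z using Min_le[of z s] bw that by auto
      then have d: "csum w (Suc s) = w * Suc s + vb (Suc s)" using wS by (intro csum_root) auto
      have K: "odd (csum w s) = odd (vb s + w * s + (w - 1))" using csum_Min[OF ws bw(2)] .
      show ?thesis
      proof (cases "w = 1")
        case True
        then have "1 \<in> S s" using ws by simp
        then have "even (vb s)" using ok bw(1) s by (auto simp: letter_ok_def split: if_splits)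
        then show ?thesis using d True s bw vb_Suc[of s] by simp
      next
        case False
        then obtain x where x: "w = Suc x" "1 \<le> x" using wS by (cases w) auto
        obtain u where u: "s = Suc u" using ws by (cases s) auto
        have xu: "x \<in> S u" using S_greedy[of w u x] ws below[of x] x u by auto
        have "Suc x \<notin> S u"
        proof
          assume "Suc x \<in> S u"
          then have "w = Min (S u)" using S_inter[of w u] ws x u by auto
          with Min_le[OF xu] x show False by simp
        qed
        then have "even (csum x u)" using g[OF u] xu by (auto simp: good_def top_def)
        moreover have "csum w s = s + csum x u" using csum_prev[OF x(2) xu] x u by simp
        ultimately show ?thesis using K d s bw vb_Suc[of s] wS by auto
      qed
    qed
    show ?thesis
    proof (cases "Suc w \<in> S (Suc s)")
      case True
      with w both show ?thesis by (auto simp: top_def)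
    next
      case False
      then have "Suc w < y" using w by (metis Suc_lessI)
      then have Sw: "Suc w \<in> S s" "\<not> (b (Suc s) \<and> Suc w = Min (S s))"
        using S_greedy[OF w(3), of "Suc w"] False by auto
      show ?thesis
      proof (cases "w \<in> S s")
        case ws: False
        obtain u where u: "s = Suc u" using Sw by (cases s) auto
        have wu: "w \<in> S u" using S_greedy[of "Suc w" u w] Sw ws wS u by auto
        have "\<not> (b (Suc s) \<and> w < Min (S s))" using Min_le[OF Sw(1)] Sw(2) by auto
        then have "odd (csum w (Suc s)) = odd (csum w u)"
          using csum_shift[of w u "Suc w"] wu wS ws Sw u by auto
        moreover have "Suc w \<notin> S u"
        proof
          assume "Suc w \<in> S u"
          then have "Suc w = Min (S u)" using S_inter[of "Suc w" u] Sw u by auto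
          with Min_le[OF wu] show False by simp
        qed
        then have "top u w" using wu by (simp add: top_def)
        then have "even (csum w u)" using g[OF u] by (simp add: good_def)
        ultimately show ?thesis by simp
      qed (use both in blast)
    qed
  qed
  fix m assume m: "top (Suc s) m"
  show "even (csum m (Suc s))"
  proof (cases "\<exists>y \<in> S (Suc s). m < y")
    case True
    with nonmax m show ?thesis by blast
  next
    case False
    let ?T = "{m. top (Suc s) m}"
    have finT: "finite ?T" by (rule finite_subset[OF _ S_finite[of "Suc s"]]) (auto simp: top_def)
    have mS: "m \<in> S (Suc s)" using m by (simp add: top_def)
    have "(\<Sum>m\<in>?T. csum m (Suc s)) = csum m (Suc s) + (\<Sum>m\<in>?T - {m}. csum m (Suc s))"
      using finT m by (intro sum.remove) auto
    moreover have "even (\<Sum>m\<in>?T - {m}. csum m (Suc s))"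
    proof (intro dvd_sum)
      fix w assume w: "w \<in> ?T - {m}"
      then have "w < m" using False by (auto simp: top_def)
      with w mS nonmax[of w m] show "even (csum w (Suc s))" by auto
    qed
    moreover have "even (\<Sum>m\<in>?T. csum m (Suc s))"
    proof -
      have re: "root_entries s \<noteq> {}" if "odd (vb s)" "1 \<in> S s"
        using cont that by (intro root_entries_nonempty) (auto simp: continued_def)
      have "S (Suc s) \<noteq> {}" using mS by blast
      moreover have "card (S (Suc s)) \<noteq> 0" using mS S_finite by auto
      ultimately have "\<not> odd (card (S (Suc s)) + (if 1 \<in> S (Suc s) then vb (Suc s) else 0) +
         (if root_entries s \<noteq> {} then vb s else 0))"
        using ok re one_in[of s] root_entries_empty[of s] vb_Suc[of s] s
        by (cases "b (Suc s)"; cases "1 \<in> S s"; cases "odd (vb s)")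
           (auto simp: letter_ok_def)
      then show ?thesis using tops_parity[OF s g] by blast
    qed
    ultimately show ?thesis by simp
  qed
qed

text \<open>The lemmas for a single site assume goodness of the preceding odd size, hence the
  induction over the even sizes.\<close>

theorem terminal_even_iff_site_ok:
  "(\<forall>s m. terminal s m \<longrightarrow> even (csum m s)) \<longleftrightarrow> (\<forall>s. even s \<longrightarrow> site_ok s)"
  unfolding terminal_even_iff
proof
  assume H: "\<forall>s. even s \<longrightarrow> good (Suc s) \<and> continued s"
  show "\<forall>s. even s \<longrightarrow> site_ok s"
  proof (intro allI impI)
    fix s :: nat assume s: "even s"
    have "good u" if su: "s = Suc u" for u
    proof -
      obtain u' where "u = Suc u'" "even u'" using su s by (cases u) auto
      then show ?thesis using H by blast
    qed
    with s H show "site_ok s" by (intro site_ok_if_good) auto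
  qed
next
  assume H: "\<forall>s. even s \<longrightarrow> site_ok s"
  have "good (Suc (2 * n)) \<and> continued (2 * n)" for n
  proof (induction n)
    case 0
    then show ?case using good_if_site_ok[of 0] continued_if_site_ok[of 0] H by auto
  next
    case (Suc n)
    then have "good u" if "2 * Suc n = Suc u" for u using that by auto
    then show ?case using good_if_site_ok[of "2 * Suc n"] continued_if_site_ok[of "2 * Suc n"] H by auto
  qed
  then show "\<forall>s. even s \<longrightarrow> good (Suc s) \<and> continued s" by (auto elim!: evenE)
qed

end

text \<open>A cluster is identified by the size of its 1-marked part, as parts of equal size have
  different marks.\<close>

primrec chain_root :: "(nat \<Rightarrow> nat set) \<Rightarrow> nat \<Rightarrow> nat \<Rightarrow> nat" where
  "chain_root S 0 s = s"
| "chain_root S (Suc m) s =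
     (if m = 0 then s else if m \<in> S (s - 1) then chain_root S m (s - 1) else chain_root S m s)"

section \<open>The left decomposition\<close>

lemma even_length_filter_odd: "even (length (filter (\<lambda>p. odd (f p)) c)) = even (sum_list (map f c))" for f :: "'a \<Rightarrow> nat"
  by (induction c) auto

locale marked_parts = mark_sets S b vb
  for S :: "nat \<Rightarrow> nat set" and b vb +
  fixes M :: "mpart set"
  assumes M_finite: "finite M"
    and S_M: "S s = {pmark p | p. p \<in> M \<and> psize p = s}"
    and M_inj: "p \<in> M \<Longrightarrow> p' \<in> M \<Longrightarrow> psize p = psize p' \<Longrightarrow> pmark p = pmark p' \<Longrightarrow> p = p'"
begin

declare chain_root.simps [simp del]

abbreviation root :: "nat \<Rightarrow> nat \<Rightarrow> nat" where
  "root m s \<equiv> chain_root S m s"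

lemma root_1: "root (Suc 0) s = s"
  by (simp add: chain_root.simps)

text \<open>\<open>link s m t\<close>: the part marked \<open>m + 1\<close> of size \<open>t\<close> follows the part marked \<open>m\<close> of size \<open>s\<close>
  in its cluster.\<close>

definition link :: "nat \<Rightarrow> nat \<Rightarrow> nat \<Rightarrow> bool" where
  "link s m t \<longleftrightarrow> m \<in> S s \<and> Suc m \<in> S t \<and> (t = Suc s \<or> t = s \<and> m \<notin> S (s - 1))"

lemma link_root: "link s m t \<Longrightarrow> root (Suc m) t = root m s"
  using S_pos[of m s] by (auto simp: link_def chain_root.simps(2))

lemma link_csum: "link s m t \<Longrightarrow> csum (Suc m) t = t + csum m s"
  using S_pos[of m s] by (auto simp: link_def chain_sum.simps(2))

lemma link_ex: "Suc m \<in> S t \<Longrightarrow> 1 \<le> m \<Longrightarrow> \<exists>s. link s m t"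
proof -
  assume a: "Suc m \<in> S t" "1 \<le> m"
  then obtain u where t: "t = Suc u" by (cases t) auto
  show ?thesis
  proof (cases "m \<in> S u")
    case True
    with a t show ?thesis by (auto simp: link_def)
  next
    case False
    then have "m \<in> S t" using S_greedy[of "Suc m" u m] a t by auto
    with False a t show ?thesis by (auto simp: link_def)
  qed
qed

text \<open>Two successors would carry the mark m + 1 at both s and s + 1, making it the smallest
  mark at s, where m is smaller.\<close>

lemma link_fun: "link s m t \<Longrightarrow> link s m t' \<Longrightarrow> t = t'"
proof -
  have "False" if "link s m s" "link s m (Suc s)"
  proof -
    have "Suc m = Min (S s)" using S_inter[of "Suc m" s] that by (auto simp: link_def)
    with Min_le[of m s] that show False by (auto simp: link_def)
  qed
  then show "link s m t \<Longrightarrow> link s m t' \<Longrightarrow> t = t'" by (auto simp: link_def)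
qed

text \<open>Chains neither meet nor cross: parts with the same mark have predecessors in the same
  order, because \<open>link\<close> has at most one target.\<close>

lemma root_strict_mono:
  assumes "m \<in> S s" "m \<in> S s'" "s < s'"
  shows "root m s < root m s'"
  using assms
proof (induction m arbitrary: s s')
  case 0
  then show ?case using S_pos[of 0 s] by simp
next
  case (Suc m)
  show ?case
  proof (cases "m = 0")
    case True
    with Suc.prems show ?thesis by (simp add: root_1)
  next
    case False
    then have "1 \<le> m" by simp
    then obtain t t' where t: "link t m s" "link t' m s'"
      using link_ex[OF Suc.prems(1)] link_ex[OF Suc.prems(2)] by blast
    have "t < t'"
    proof (rule ccontr)
      assume "\<not> t < t'"
      with t Suc.prems have "t' = t" by (auto simp: link_def)
      with t(2) have "link t m s'" by simp
      with t(1) have "s = s'" by (rule link_fun)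
      with Suc.prems(3) show False by simp
    qed
    moreover have "m \<in> S t" "m \<in> S t'" using t by (auto simp: link_def)
    ultimately have "root m t < root m t'" by (intro Suc.IH)
    then show ?thesis unfolding link_root[OF t(1)] link_root[OF t(2)] .
  qed
qed

lemma root_in: "m \<in> S s \<Longrightarrow> 1 \<in> S (root m s)"
proof (induction m arbitrary: s)
  case 0
  then show ?case using S_pos[of 0 s] by simp
next
  case (Suc m)
  show ?case
  proof (cases "m = 0")
    case True
    with Suc.prems show ?thesis by (simp add: root_1)
  next
    case False
    then have "1 \<le> m" by simp
    then obtain t where t: "link t m s" using link_ex[OF Suc.prems] by blast
    then have "m \<in> S t" by (simp add: link_def)
    then show ?thesis unfolding link_root[OF t] by (rule Suc.IH)
  qed
qed

text \<open>Every stage of the left decomposition has this form: what is left are the whole chains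
  whose roots have not been taken yet.\<close>

definition parts_from :: "nat set \<Rightarrow> mpart set" where
  "parts_from R = {p \<in> M. root (pmark p) (psize p) \<in> R}"

lemma mark_in: "p \<in> M \<Longrightarrow> pmark p \<in> S (psize p)"
  using S_M by blast

lemma M_root_unique:
  assumes "p \<in> M" "p' \<in> M" "pmark p = pmark p'" "root (pmark p) (psize p) = root (pmark p') (psize p')"
  shows "p = p'"
proof -
  have "pmark p \<in> S (psize p)" "pmark p \<in> S (psize p')"
    using mark_in[OF assms(1)] mark_in[OF assms(2)] assms(3) by auto
  then have "\<not> psize p < psize p'" "\<not> psize p' < psize p"
    using root_strict_mono[of "pmark p" "psize p" "psize p'"] root_strict_mono[of "pmark p" "psize p'" "psize p"]
      assms(3,4) by auto
  then have "psize p = psize p'" by simp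
  then show ?thesis using assms(1-3) by (intro M_inj)
qed

context
  fixes R c
  assumes c: "cluster (parts_from R) c"
    and hd_min: "\<And>p. p \<in> parts_from R \<Longrightarrow> pmark p = 1 \<Longrightarrow> psize (hd c) \<le> psize p"
begin

lemma c_ne: "c \<noteq> []" and c_mark: "j < length c \<Longrightarrow> pmark (c ! j) = Suc j"
  and c_in: "j < length c \<Longrightarrow> c ! j \<in> parts_from R"
  and c_size: "Suc j < length c \<Longrightarrow> psize (c ! Suc j) = psize (c ! j) \<or> psize (c ! Suc j) = Suc (psize (c ! j))"
proof -
  show "c \<noteq> []" using c unfolding cluster_def by blast
  show "j < length c \<Longrightarrow> pmark (c ! j) = Suc j" using c unfolding cluster_def by blast
  show "j < length c \<Longrightarrow> c ! j \<in> parts_from R" using c unfolding cluster_def by (meson nth_mem subsetD)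
  assume "Suc j < length c"
  then have "psize (c ! j) \<le> psize (c ! Suc j) \<and> psize (c ! Suc j) \<le> psize (c ! j) + 1"
    using c unfolding cluster_def by blast
  then show "psize (c ! Suc j) = psize (c ! j) \<or> psize (c ! Suc j) = Suc (psize (c ! j))" by linarith
qed

lemma hd_min_root: "p \<in> parts_from R \<Longrightarrow> psize (hd c) \<le> root (pmark p) (psize p)"
proof -
  assume p: "p \<in> parts_from R"
  then have "1 \<in> S (root (pmark p) (psize p))" using root_in mark_in by (auto simp: parts_from_def)
  then obtain p' where p': "p' \<in> M" "psize p' = root (pmark p) (psize p)" "pmark p' = 1"
    unfolding S_M[of "root (pmark p) (psize p)"] by auto
  then have "p' \<in> parts_from R" using p by (auto simp: parts_from_def root_1)
  with hd_min[of p'] p' show ?thesis by simp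
qed

text \<open>The definition of a cluster leaves a choice between two sizes for the next part. A
  choice that breaks \<open>link\<close> takes a part whose chain starts further left, against the
  minimality of the head.\<close>

lemma extend_link:
  assumes j: "j < length c" and r: "root (pmark (c ! j)) (psize (c ! j)) = psize (hd c)"
    and p: "p \<in> parts_from R" "pmark p = Suc (Suc j)" "psize p = psize (c ! j) \<or> psize p = Suc (psize (c ! j))"
  shows "link (psize (c ! j)) (Suc j) (psize p)"
proof -
  have m: "Suc j \<in> S (psize (c ! j))" "Suc (Suc j) \<in> S (psize p)"
    using mark_in[of "c ! j"] mark_in[of p] c_in[OF j] c_mark[OF j] p by (auto simp: parts_from_def)
  have "Suc j \<notin> S (psize (c ! j) - 1)" if eq: "psize p = psize (c ! j)"
  proof
    assume a: "Suc j \<in> S (psize (c ! j) - 1)"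
    then have pos: "psize (c ! j) - 1 < psize (c ! j)" using m by (cases "psize (c ! j)") auto
    then have "link (psize (c ! j) - 1) (Suc j) (psize p)" using a m eq by (auto simp: link_def)
    then have "root (pmark p) (psize p) = root (Suc j) (psize (c ! j) - 1)" using link_root p(2) by simp
    also have "\<dots> < root (Suc j) (psize (c ! j))" using root_strict_mono a m pos by blast
    finally show False using hd_min_root[OF p(1)] r c_mark[OF j] by simp
  qed
  with m p(3) show ?thesis by (auto simp: link_def)
qed

lemma cluster_step:
  "j < length c \<Longrightarrow> root (Suc j) (psize (c ! j)) = psize (hd c) \<and>
     csum (Suc j) (psize (c ! j)) = (\<Sum>i\<le>j. psize (c ! i)) + vb (psize (hd c))"
proof (induction j)
  case 0
  then show ?case by (simp add: root_1 csum_1 hd_conv_nth[OF c_ne])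
next
  case (Suc j)
  then have IH: "root (Suc j) (psize (c ! j)) = psize (hd c)"
    "csum (Suc j) (psize (c ! j)) = (\<Sum>i\<le>j. psize (c ! i)) + vb (psize (hd c))" by auto
  have "link (psize (c ! j)) (Suc j) (psize (c ! Suc j))"
    using Suc.prems IH c_in[of "Suc j"] c_mark[of "Suc j"] c_mark[of j] c_size[of j]
    by (intro extend_link) simp_all
  then show ?case using link_root link_csum IH by simp
qed

lemma cluster_link:
  assumes "Suc j < length c"
  shows "link (psize (c ! j)) (Suc j) (psize (c ! Suc j))"
  using assms cluster_step[of j] c_in[of "Suc j"] c_mark[of "Suc j"] c_mark[of j] c_size[of j]
  by (intro extend_link) simp_all

lemma hd_in: "psize (hd c) \<in> R"
  using cluster_step[of 0] c_in[of 0] c_mark[of 0] c_ne by (auto simp: parts_from_def)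

text \<open>The marks on the chain of a root have no gaps, so a part beyond the end of c would
  produce one with mark \<open>length c + 1\<close> next to \<open>last c\<close>, against the final
  clause of \<open>cluster\<close>.\<close>

lemma cluster_max:
  assumes "p \<in> M" "root (pmark p) (psize p) = psize (hd c)"
  shows "pmark p \<le> length c"
proof -
  have "m \<noteq> Suc (length c)" if pm: "p \<in> M" "root (pmark p) (psize p) = psize (hd c)" "pmark p = m" for p m
  proof
    assume m: "m = Suc (length c)"
    obtain n where n: "length c = Suc n" using c_ne by (cases c) auto
    have "pmark p \<in> S (psize p)" using mark_in pm by blast
    then obtain s where s: "link s (length c) (psize p)" using link_ex[of "length c" "psize p"] pm m n by fastforce
    then have "length c \<in> S s" by (simp add: link_def)
    then obtain p' where p': "p' \<in> M" "psize p' = s" "pmark p' = length c" unfolding S_M[of s] by auto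
    have "root (pmark p') (psize p') = root (pmark p) (psize p)" using link_root[OF s] pm m p' by simp
    then have "p' = c ! n"
      using p' pm cluster_step[of n] c_mark[of n] c_in[of n] n
      by (intro M_root_unique) (auto simp: parts_from_def)
    then have l: "last c = p'" using n by (simp add: last_conv_nth c_ne)
    have "p \<in> parts_from R" using pm hd_in by (auto simp: parts_from_def)
    moreover have "psize p = psize (last c) \<or> psize p = psize (last c) + 1"
      using s l p' by (auto simp: link_def)
    ultimately show False using c pm m by (auto simp: cluster_def)
  qed
  then have ne: "\<not> (\<exists>p' \<in> M. root (pmark p') (psize p') = psize (hd c) \<and> pmark p' = Suc (length c))"
    by blast
  have ex: "\<exists>p' \<in> M. root (pmark p') (psize p') = psize (hd c) \<and> pmark p' = m"
    if "1 \<le> m" "m \<le> pmark p" for m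
    using that(2,1)
  proof (induction m rule: inc_induct)
    case base
    then show ?case using assms by auto
  next
    case (step m)
    then obtain p' where p': "p' \<in> M" "root (pmark p') (psize p') = psize (hd c)" "pmark p' = Suc m" by auto
    then have "Suc m \<in> S (psize p')" using mark_in[OF p'(1)] by simp
    then obtain s where s: "link s m (psize p')" using link_ex step.prems by blast
    then have "m \<in> S s" by (simp add: link_def)
    then obtain p2 where "p2 \<in> M" "psize p2 = s" "pmark p2 = m" unfolding S_M[of s] by auto
    then show ?case using link_root[OF s] p' by (intro bexI[of _ p2]) auto
  qed
  have "\<not> Suc (length c) \<le> pmark p" using ex[of "Suc (length c)"] ne by auto
  then show ?thesis by simp
qed

lemma set_cluster: "set c = {p \<in> M. root (pmark p) (psize p) = psize (hd c)}"
proof (intro subset_antisym subsetI)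
  fix p assume "p \<in> set c"
  then obtain j where "j < length c" "p = c ! j" by (auto simp: in_set_conv_nth)
  then show "p \<in> {p \<in> M. root (pmark p) (psize p) = psize (hd c)}"
    using cluster_step[of j] c_in[of j] c_mark[of j] by (auto simp: parts_from_def)
next
  fix p assume p: "p \<in> {p \<in> M. root (pmark p) (psize p) = psize (hd c)}"
  then have le: "pmark p \<le> length c" using cluster_max by blast
  have pos: "1 \<le> pmark p" using p mark_in S_pos by blast
  then have j: "pmark p - 1 < length c" using le by auto
  then have "c ! (pmark p - 1) = p"
    using p pos cluster_step[OF j] c_in[OF j] c_mark[OF j]
    by (intro M_root_unique) (auto simp: parts_from_def)
  then show "p \<in> set c" using nth_mem[OF j] by simp
qed

lemma parts_from_minus: "parts_from R - set c = parts_from (R - {psize (hd c)})"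
  unfolding set_cluster by (auto simp: parts_from_def)

lemma cluster_terminal:
  assumes "p \<in> set c"
  shows "terminal (psize p) (pmark p) \<longleftrightarrow> p = last c"
proof
  assume t: "terminal (psize p) (pmark p)"
  obtain j where j: "j < length c" "p = c ! j" using assms by (auto simp: in_set_conv_nth)
  have "\<not> Suc j < length c"
  proof
    assume "Suc j < length c"
    then have "link (psize p) (pmark p) (psize (c ! Suc j))" using cluster_link j c_mark by auto
    with t show False by (auto simp: link_def terminal_def top_def)
  qed
  with j have "j = length c - 1" by simp
  with j show "p = last c" by (simp add: last_conv_nth c_ne)
next
  assume l: "p = last c"
  obtain n where n: "length c = Suc n" using c_ne by (cases c) auto
  with l have p: "p = c ! n" by (simp add: last_conv_nth c_ne)
  then have pm: "pmark p = length c" "p \<in> M" using c_mark[of n] c_in[of n] n by (auto simp: parts_from_def)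
  have none: "\<not> link (psize p) (pmark p) t" for t
  proof
    assume a: "link (psize p) (pmark p) t"
    then have "Suc (pmark p) \<in> S t" by (simp add: link_def)
    then obtain p' where p': "p' \<in> M" "psize p' = t" "pmark p' = Suc (pmark p)" unfolding S_M[of t] by auto
    have "root (pmark p') (psize p') = psize (hd c)"
      using link_root[OF a] p' p cluster_step[of n] n c_mark[of n] by simp
    with cluster_max[OF p'(1)] p' pm show False by simp
  qed
  show "terminal (psize p) (pmark p)"
    using none[of "psize p"] none[of "Suc (psize p)"] mark_in[OF pm(2)]
    by (auto simp: link_def terminal_def top_def)
qed

lemma cluster_csum: "csum (pmark (last c)) (psize (last c)) = sum_list (map psize c) + vb (psize (hd c))"
proof -
  obtain n where n: "length c = Suc n" using c_ne by (cases c) auto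
  then have l: "last c = c ! n" by (simp add: last_conv_nth c_ne)
  have "sum_list (map psize c) = (\<Sum>i\<le>n. psize (c ! i))"
    using n by (simp add: sum_list_sum_nth atLeast0LessThan lessThan_Suc_atMost)
  then show ?thesis using cluster_step[of n] n l c_mark[of n] by simp
qed

end

text \<open>Each cluster taken is a full chain whose last part is its only terminal one, so
  conditions on clusters and on terminal parts correspond one to one, whatever the
  decomposition.\<close>

lemma decomposition_terminal:
  assumes "left_decomposition (parts_from R) cs"
  shows "(\<forall>c \<in> set cs. even (sum_list (map psize c) + vb (psize (hd c)))) \<longleftrightarrow>
    (\<forall>p \<in> parts_from R. terminal (psize p) (pmark p) \<longrightarrow> even (csum (pmark p) (psize p)))"
  using assms
proof (induction "parts_from R" cs arbitrary: R rule: left_decomposition.induct)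
  case empty
  then show ?case by simp
next
  case (step c cs)
  note c = step(1,2)
  have minus: "parts_from R - set c = parts_from (R - {psize (hd c)})"
    using parts_from_minus c by blast
  have IH: "(\<forall>c \<in> set cs. even (sum_list (map psize c) + vb (psize (hd c)))) \<longleftrightarrow>
    (\<forall>p \<in> parts_from R - set c. terminal (psize p) (pmark p) \<longrightarrow> even (csum (pmark p) (psize p)))"
    using step(4)[OF minus] unfolding minus .
  have sub: "set c \<subseteq> parts_from R" using c(1) by (auto simp: cluster_def)
  have "last c \<in> set c" using c(1) by (simp add: cluster_def)
  moreover have "terminal (psize p) (pmark p) \<longleftrightarrow> p = last c" if "p \<in> set c" for p
    using cluster_terminal[of R c p] c that by blast
  moreover have "csum (pmark (last c)) (psize (last c)) = sum_list (map psize c) + vb (psize (hd c))"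
    using cluster_csum[of R c] c by blast
  ultimately have "even (sum_list (map psize c) + vb (psize (hd c))) \<longleftrightarrow>
    (\<forall>p \<in> set c. terminal (psize p) (pmark p) \<longrightarrow> even (csum (pmark p) (psize p)))"
    by auto
  with IH sub show ?case by auto
qed

text \<open>A longest chain starting at p0 works; lengths are bounded because the marks in a chain
  are distinct.\<close>

lemma ex_cluster:
  assumes "p0 \<in> parts_from R" "pmark p0 = 1"
  shows "\<exists>c. cluster (parts_from R) c \<and> hd c = p0"
proof -
  define Q where "Q c \<longleftrightarrow> c \<noteq> [] \<and> hd c = p0 \<and> set c \<subseteq> parts_from R \<and> (\<forall>j < length c. pmark (c ! j) = Suc j) \<and>
     (\<forall>j. Suc j < length c \<longrightarrow>
        psize (c ! j) \<le> psize (c ! Suc j) \<and> psize (c ! Suc j) \<le> psize (c ! j) + 1)" for c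
  have Q0: "Q [p0]" using assms by (simp add: Q_def)
  have bd: "length c \<le> card M" if "Q c" for c
  proof -
    have "distinct (map pmark c)" using that by (auto simp: Q_def distinct_conv_nth)
    then have "distinct c" by (rule distinct_map[THEN iffD1, THEN conjunct1])
    then have "length c = card (set c)" by (simp add: distinct_card)
    also have "\<dots> \<le> card M" using that M_finite by (intro card_mono) (auto simp: Q_def parts_from_def)
    finally show ?thesis .
  qed
  define n where "n = (GREATEST n. \<exists>c. Q c \<and> length c = n)"
  have "\<exists>c. Q c \<and> length c = n"
    unfolding n_def by (rule GreatestI_nat[of "\<lambda>n. \<exists>c. Q c \<and> length c = n" "length [p0]" "card M"]) (use Q0 bd in auto)
  then obtain c where c: "Q c" "length c = n" by blast
  have "cluster (parts_from R) c"
    unfolding cluster_def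
  proof (intro conjI notI)
    assume "\<exists>p\<in>parts_from R. pmark p = length c + 1 \<and> (psize p = psize (last c) \<or> psize p = psize (last c) + 1)"
    then obtain p where p: "p \<in> parts_from R" "pmark p = length c + 1" "psize p = psize (last c) \<or> psize p = psize (last c) + 1"
      by blast
    have q: "c \<noteq> []" "hd c = p0" "set c \<subseteq> parts_from R" "\<And>j. j < length c \<Longrightarrow> pmark (c ! j) = Suc j"
      "\<And>j. Suc j < length c \<Longrightarrow> psize (c ! j) \<le> psize (c ! Suc j) \<and> psize (c ! Suc j) \<le> psize (c ! j) + 1"
      using c(1) unfolding Q_def by blast+
    have "pmark ((c @ [p]) ! j) = Suc j" if "j < length (c @ [p])" for j
      using that q(4)[of j] p(2) by (cases "j < length c") (auto simp: nth_append less_Suc_eq)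
    moreover have "psize ((c @ [p]) ! j) \<le> psize ((c @ [p]) ! Suc j) \<and>
        psize ((c @ [p]) ! Suc j) \<le> psize ((c @ [p]) ! j) + 1" if j: "Suc j < length (c @ [p])" for j
    proof (cases "Suc j < length c")
      case True
      then show ?thesis using q(5)[OF True] by (simp add: nth_append)
    next
      case False
      with j have l: "length c = Suc j" by simp
      then have "last c = c ! j" using q(1) by (simp add: last_conv_nth)
      with l p(3) show ?thesis by (auto simp: nth_append)
    qed
    ultimately have "Q (c @ [p])"
      unfolding Q_def using q(1-3) p(1) by simp
    then have "length (c @ [p]) \<le> n"
      unfolding n_def by (intro Greatest_le_nat[of "\<lambda>n. \<exists>c. Q c \<and> length c = n" _ "card M"]) (use bd in auto)
    with c show False by simp
  qed (use c(1) in \<open>auto simp: Q_def\<close>)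
  moreover have "hd c = p0" using c(1) by (simp add: Q_def)
  ultimately show ?thesis by blast
qed

text \<open>As long as a part is left, so is the 1-marked part at its root, and a cluster can be
  taken.\<close>

lemma ex_decomposition: "\<exists>cs. left_decomposition (parts_from R) cs"
proof (induction "card (parts_from R)" arbitrary: R rule: less_induct)
  case less
  have fin: "finite (parts_from R)" using M_finite by (auto simp: parts_from_def)
  show ?case
  proof (cases "parts_from R = {}")
    case True
    then show ?thesis using left_decomposition.empty by auto
  next
    case False
    then obtain p where p: "p \<in> parts_from R" by blast
    define A where "A = {p \<in> parts_from R. pmark p = 1}"
    have "1 \<in> S (root (pmark p) (psize p))" using p root_in mark_in by (auto simp: parts_from_def)
    then obtain p' where "p' \<in> M" "psize p' = root (pmark p) (psize p)" "pmark p' = 1"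
      unfolding S_M[of "root (pmark p) (psize p)"] by auto
    then have "p' \<in> A" using p by (auto simp: A_def parts_from_def root_1)
    then obtain p0 where p0: "p0 \<in> A" "\<And>p. p \<in> A \<Longrightarrow> psize p0 \<le> psize p"
      using ex_has_least_nat[of "\<lambda>p. p \<in> A" p' psize] by blast
    obtain c where c: "cluster (parts_from R) c" "hd c = p0" using ex_cluster[of p0 R] p0 by (auto simp: A_def)
    have c': "\<And>p. p \<in> parts_from R \<Longrightarrow> pmark p = 1 \<Longrightarrow> psize (hd c) \<le> psize p"
      using p0 c by (auto simp: A_def)
    have "set c \<subseteq> parts_from R" "c \<noteq> []" using c(1) by (auto simp: cluster_def)
    then have "card (parts_from R - set c) < card (parts_from R)"
      using fin by (intro psubset_card_mono) (auto simp: neq_Nil_conv)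
    moreover have minus: "parts_from R - set c = parts_from (R - {psize (hd c)})"
      using parts_from_minus c c' by blast
    ultimately obtain cs where "left_decomposition (parts_from R - set c) cs"
      using less(1)[of "R - {psize (hd c)}"] by auto
    then have "left_decomposition (parts_from R) (c # cs)"
      using c(1) c' by (intro left_decomposition.step)
    then show ?thesis by blast
  qed
qed

theorem decomposition_iff_site_ok:
  "(\<exists>cs. left_decomposition M cs \<and> (\<forall>c \<in> set cs. even (sum_list (map psize c) + vb (psize (hd c))))) \<longleftrightarrow>
   (\<forall>s. even s \<longrightarrow> site_ok s)"
proof -
  have M: "parts_from UNIV = M" by (auto simp: parts_from_def)
  have "(\<forall>p \<in> M. terminal (psize p) (pmark p) \<longrightarrow> even (csum (pmark p) (psize p))) \<longleftrightarrow>
    (\<forall>s m. terminal s m \<longrightarrow> even (csum m s))" (is "?A \<longleftrightarrow> ?B")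
  proof
    assume A: ?A
    show ?B
    proof (intro allI impI)
      fix s m assume t: "terminal s m"
      then have "m \<in> S s" by (auto simp: terminal_def top_def)
      then obtain p where "p \<in> M" "psize p = s" "pmark p = m" unfolding S_M[of s] by auto
      with A t show "even (csum m s)" by auto
    qed
  qed auto
  moreover have "(\<forall>c \<in> set cs. even (sum_list (map psize c) + vb (psize (hd c)))) \<longleftrightarrow>
    (\<forall>p \<in> M. terminal (psize p) (pmark p) \<longrightarrow> even (csum (pmark p) (psize p)))"
    if "left_decomposition M cs" for cs
    using decomposition_terminal[of UNIV cs] that unfolding M .
  moreover obtain cs where "left_decomposition M cs" using ex_decomposition[of UNIV] unfolding M by blast
  ultimately show ?thesis unfolding terminal_even_iff_site_ok by blast
qed

end

section \<open>The Gordon marking\<close>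

lemma map_fst_mark_from: "map fst (mark_from ps M rest) = map fst M @ rest"
  by (induction rest arbitrary: M) auto

lemma marks_at_image: "marks_at M s = pmark ` {p \<in> set M. psize p = s}"
  unfolding marks_at_def by blast

lemma marks_at_append:
  "marks_at (M @ [(p, r)]) s = (if fst p = s then insert r (marks_at M s) else marks_at M s)"
proof -
  have "{q \<in> set (M @ [(p, r)]). psize q = s} =
      (if fst p = s then insert (p, r) {q \<in> set M. psize q = s} else {q \<in> set M. psize q = s})"
    by auto
  then show ?thesis unfolding marks_at_image by simp
qed

lemma finite_marks_at: "finite (marks_at M s)"
  unfolding marks_at_image by simp

definition freed_marks :: "opart list \<Rightarrow> mpart list \<Rightarrow> nat \<Rightarrow> nat set" where
  "freed_marks ps M s = (if (s, True) \<in> set ps then {Min (marks_at M (s - 1))} else {})"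

lemma forbidden_marks_eq:
  "forbidden_marks ps M s = marks_at M s \<union> (marks_at M (s - 1) - freed_marks ps M s)"
  by (simp add: forbidden_marks_def freed_marks_def)

text \<open>The clauses refer to the whole current list, not to the list at the time of marking.
  This is stable because sizes come in increasing order: once size s is reached, the marks at s - 1,
  and with them the freed mark, are settled.\<close>

definition marking_inv :: "opart list \<Rightarrow> mpart list \<Rightarrow> bool" where
  "marking_inv ps M \<longleftrightarrow>
     distinct (map (\<lambda>p. (psize p, pmark p)) M) \<and>
     (\<forall>p \<in> set M. 1 \<le> pmark p \<and> 1 \<le> psize p \<and>
        pmark p \<notin> marks_at M (psize p - 1) - freed_marks ps M (psize p) \<and>
        (\<forall>x. 1 \<le> x \<longrightarrow> x < pmark p \<longrightarrow>
           x \<in> marks_at M (psize p) \<union> (marks_at M (psize p - 1) - freed_marks ps M (psize p))) \<and>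
        (snd (fst p) \<longrightarrow> pmark p = 1))"

lemma marking_inv_step:
  assumes inv: "marking_inv ps M"
    and le: "\<And>q. q \<in> set M \<Longrightarrow> psize q \<le> fst p"
    and bar: "snd p \<Longrightarrow> \<forall>q \<in> set M. psize q < fst p"
    and pos: "1 \<le> fst p" and p: "p \<in> set ps"
  defines "r \<equiv> (LEAST r. 1 \<le> r \<and> r \<notin> forbidden_marks ps M (fst p))"
  shows "marking_inv ps (M @ [(p, r)])"
proof -
  let ?M = "M @ [(p, r)]"
  let ?F = "\<lambda>M s. marks_at M (s - 1) - freed_marks ps M s"
  have "finite (insert 0 (forbidden_marks ps M (fst p)))"
    unfolding forbidden_marks_eq using finite_marks_at by auto
  then obtain x where "x \<notin> insert 0 (forbidden_marks ps M (fst p))"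
    using ex_new_if_finite[OF infinite_UNIV_nat] by blast
  then have ex: "1 \<le> x \<and> x \<notin> forbidden_marks ps M (fst p)" by (cases x) auto
  have r: "1 \<le> r" "r \<notin> forbidden_marks ps M (fst p)"
    using LeastI[of "\<lambda>r. 1 \<le> r \<and> r \<notin> forbidden_marks ps M (fst p)", OF ex] unfolding r_def by auto
  have below: "y \<in> forbidden_marks ps M (fst p)" if "1 \<le> y" "y < r" for y
    using not_less_Least[of y "\<lambda>r. 1 \<le> r \<and> r \<notin> forbidden_marks ps M (fst p)"] that unfolding r_def by auto
  have F: "?F ?M s = ?F M s" if "1 \<le> s" "s \<le> fst p" for s
  proof -
    have "fst p \<noteq> s - 1" using that pos by auto
    then have "marks_at ?M (s - 1) = marks_at M (s - 1)" by (simp add: marks_at_append)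
    then show ?thesis by (simp add: freed_marks_def)
  qed
  have sub: "marks_at M s \<subseteq> marks_at ?M s" for s by (auto simp: marks_at_append)
  have r': "r \<notin> marks_at M (fst p)" "r \<notin> ?F M (fst p)" using r(2) unfolding forbidden_marks_eq by auto
  show ?thesis
    unfolding marking_inv_def
  proof (intro conjI ballI)
    have "(fst p, r) \<notin> (\<lambda>p. (psize p, pmark p)) ` set M"
      using r'(1) by (auto simp: marks_at_def)
    then show "distinct (map (\<lambda>p. (psize p, pmark p)) ?M)"
      using inv by (auto simp: marking_inv_def)
  next
    fix q assume q: "q \<in> set ?M"
    consider "q \<in> set M" | "q = (p, r)" using q by auto
    then have all: "1 \<le> pmark q \<and> 1 \<le> psize q \<and> pmark q \<notin> ?F ?M (psize q) \<and>
        (\<forall>x. 1 \<le> x \<longrightarrow> x < pmark q \<longrightarrow> x \<in> marks_at ?M (psize q) \<union> ?F ?M (psize q)) \<and>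
        (snd (fst q) \<longrightarrow> pmark q = 1)"
    proof cases
      case 1
      then have qi: "1 \<le> pmark q" "1 \<le> psize q" "pmark q \<notin> ?F M (psize q)"
        "\<forall>x. 1 \<le> x \<longrightarrow> x < pmark q \<longrightarrow> x \<in> marks_at M (psize q) \<union> ?F M (psize q)"
        "snd (fst q) \<longrightarrow> pmark q = 1"
        using inv unfolding marking_inv_def by blast+
      have FF: "?F ?M (psize q) = ?F M (psize q)" using qi(2) le[OF 1] by (rule F)
      show "1 \<le> pmark q \<and> 1 \<le> psize q \<and> pmark q \<notin> ?F ?M (psize q) \<and>
        (\<forall>x. 1 \<le> x \<longrightarrow> x < pmark q \<longrightarrow> x \<in> marks_at ?M (psize q) \<union> ?F ?M (psize q)) \<and>
        (snd (fst q) \<longrightarrow> pmark q = 1)"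
        unfolding FF using qi sub[of "psize q"] by blast
    next
      case 2
      have FF: "?F ?M (fst p) = ?F M (fst p)" using pos by (intro F) auto
      \<comment> \<open>An overlined part is the first of its size, so only the preceding size could
        block mark 1; but there 1 would be the smallest mark, which the overlined part
        frees.\<close>
      have "r = 1" if "snd p"
      proof (rule ccontr)
        assume "r \<noteq> 1"
        then have "1 \<in> forbidden_marks ps M (fst p)" using below[of 1] r by auto
        moreover have e: "marks_at M (fst p) = {}" using bar[OF that] by (auto simp: marks_at_def)
        ultimately have 1: "1 \<in> ?F M (fst p)" unfolding forbidden_marks_eq by auto
        have "1 \<le> x" if "x \<in> marks_at M s" for x s
          using inv that unfolding marking_inv_def marks_at_def by auto
        then have "Min (marks_at M (fst p - 1)) = 1"
          using 1 finite_marks_at by (intro Min_eqI) auto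
        moreover have "(fst p, True) \<in> set ps" using p that by (metis prod.collapse)
        ultimately show False using 1 by (auto simp: freed_marks_def)
      qed
      moreover have "y \<in> marks_at ?M (fst p) \<union> ?F M (fst p)" if "1 \<le> y" "y < r" for y
        using below[OF that] sub[of "fst p"] unfolding forbidden_marks_eq by blast
      ultimately show "1 \<le> pmark q \<and> 1 \<le> psize q \<and> pmark q \<notin> ?F ?M (psize q) \<and>
        (\<forall>x. 1 \<le> x \<longrightarrow> x < pmark q \<longrightarrow> x \<in> marks_at ?M (psize q) \<union> ?F ?M (psize q)) \<and>
        (snd (fst q) \<longrightarrow> pmark q = 1)"
        unfolding 2 using r(1) pos FF r'(2) by simp
    qed
    show "1 \<le> pmark q" "1 \<le> psize q" "pmark q \<notin> ?F ?M (psize q)"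
      "\<forall>x. 1 \<le> x \<longrightarrow> x < pmark q \<longrightarrow> x \<in> marks_at ?M (psize q) \<union> ?F ?M (psize q)"
      "snd (fst q) \<longrightarrow> pmark q = 1"
      using all by blast+
  qed
qed

lemma marking_inv_mark_from:
  assumes "marking_inv ps M" "sorted (map gordon_key (map fst M @ rest))"
    and "\<And>s. count_list (map fst M @ rest) (s, True) \<le> 1"
    and "\<And>p. p \<in> set rest \<Longrightarrow> 1 \<le> fst p \<and> p \<in> set ps"
  shows "marking_inv ps (mark_from ps M rest)"
  using assms
proof (induction rest arbitrary: M)
  case (Cons p rest)
  let ?r = "LEAST r. 1 \<le> r \<and> r \<notin> forbidden_marks ps M (fst p)"
  have key: "gordon_key (fst q) \<le> gordon_key p" if "q \<in> set M" for q
    using Cons.prems(2) that by (auto simp: sorted_append)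
  have "marking_inv ps (M @ [(p, ?r)])"
  proof (rule marking_inv_step[OF Cons.prems(1)])
    fix q assume "q \<in> set M"
    from key[OF this] show "psize q \<le> fst p" by (auto simp: gordon_key_def split: if_splits)
  next
    assume sp: "snd p"
    show "\<forall>q\<in>set M. psize q < fst p"
    proof
      fix q assume q: "q \<in> set M"
      have "fst q \<noteq> p"
      proof
        assume "fst q = p"
        then have "p \<in> set (map fst M)" using q by auto
        then have "count_list (map fst M) p \<noteq> 0" using count_list_0_iff[of "map fst M" p] by blast
        moreover have "p = (fst p, True)" using sp by (metis prod.collapse)
        ultimately show False using Cons.prems(3)[of "fst p"] by (auto simp: count_list_append)
      qed
      moreover have "gordon_key (fst q) \<le> 2 * fst p" using key[OF q] sp by (simp add: gordon_key_def)
      ultimately show "psize q < fst p" using sp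
        by (cases q, cases "fst q", cases p) (auto simp: gordon_key_def split: if_splits)
    qed
  qed (use Cons.prems(4) in auto)
  moreover have "1 \<le> fst q \<and> q \<in> set ps" if "q \<in> set rest" for q using Cons.prems(4)[of q] that by simp
  ultimately have "marking_inv ps (mark_from ps (M @ [(p, ?r)]) rest)"
    using Cons.prems(2,3) by (intro Cons.IH) simp_all
  then show ?case by simp
qed simp

lemma overpartition_count_bar:
  assumes "overpartition ps"
  shows "count_list ps (s, True) \<le> 1"
proof (rule ccontr)
  assume "\<not> count_list ps (s, True) \<le> 1"
  then have c: "1 < length (filter ((=) (s, True)) ps)" by (simp add: count_list_eq_length_filter)
  then have "\<not> card {i. i < length ps \<and> (s, True) = ps ! i} \<le> Suc 0" by (simp add: length_filter_conv_card)
  then obtain i j where ij: "i < length ps" "j < length ps" "ps ! i = (s, True)" "ps ! j = (s, True)" "i \<noteq> j"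
    by (subst (asm) card_le_Suc0_iff_eq) auto
  have False if "j < i" "i < length ps" "ps ! i = (s, True)" "ps ! j = (s, True)" for i j
  proof -
    have "\<forall>j<i. fst (ps ! j) \<noteq> fst (ps ! i)" 
    proof -
      have "snd (ps ! i) \<longrightarrow> (\<forall>j<i. fst (ps ! j) \<noteq> fst (ps ! i))"
        using assms that(2) unfolding overpartition_def by blast
      then show ?thesis using that(3) by simp
    qed
    then have "fst (ps ! j) \<noteq> fst (ps ! i)" using that(1) by blast
    with that show False by simp
  qed
  with ij show False by (cases i j rule: linorder_cases) blast+
qed

lemma V_Suc:
  assumes "overpartition ps"
  shows "V ps (Suc s) = V ps s + of_bool ((Suc s, True) \<in> set ps)"
proof -
  have "length (filter (\<lambda>p. snd p \<and> fst p \<le> Suc s) xs) =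
      length (filter (\<lambda>p. snd p \<and> fst p \<le> s) xs) + count_list xs (Suc s, True)" for xs
    by (induction xs) auto
  moreover have "count_list ps (Suc s, True) = of_bool ((Suc s, True) \<in> set ps)"
    using overpartition_count_bar[OF assms, of "Suc s"] count_list_0_iff[of ps "(Suc s, True)"]
    by (auto simp: le_Suc_eq)
  ultimately show ?thesis by (simp add: V_def)
qed

context
  fixes ps :: "opart list"
  assumes ps: "overpartition ps"
begin

abbreviation "gm \<equiv> gordon_marking ps"

lemma map_fst_gm: "map fst gm = sort_key gordon_key ps"
  by (simp add: gordon_marking_def map_fst_mark_from)

lemma marking_inv_gm: "marking_inv ps gm"
  unfolding gordon_marking_def
proof (rule marking_inv_mark_from)
  fix s
  have "count_list (sort_key gordon_key ps) (s, True) = count_list ps (s, True)"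
    by (simp add: count_list_eq_length_filter filter_sort)
  then show "count_list (map fst [] @ sort_key gordon_key ps) (s, True) \<le> 1"
    using overpartition_count_bar[OF ps] by simp
qed (use ps in \<open>auto simp: marking_inv_def overpartition_def Suc_le_eq\<close>)

lemma marked_parts_gm:
  "marked_parts (marks_at gm) (\<lambda>s. (s, True) \<in> set ps) (V ps) (set gm)"
proof unfold_locales
  have inv: "1 \<le> pmark p" "1 \<le> psize p" "pmark p \<notin> marks_at gm (psize p - 1) - freed_marks ps gm (psize p)"
    "snd (fst p) \<Longrightarrow> pmark p = 1"
    "\<And>x. 1 \<le> x \<Longrightarrow> x < pmark p \<Longrightarrow> x \<in> marks_at gm (psize p) \<union> (marks_at gm (psize p - 1) - freed_marks ps gm (psize p))"
    if "p \<in> set gm" for p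
    using marking_inv_gm that unfolding marking_inv_def by blast+
  have set_ps: "fst ` set gm = set ps" using arg_cong[OF map_fst_gm, of set] by simp
  show "marks_at gm 0 = {}" using inv(2) by (force simp: marks_at_def)
  show "finite (marks_at gm s)" for s by (rule finite_marks_at)
  show "1 \<le> m" if "m \<in> marks_at gm s" for m s using inv(1) that by (auto simp: marks_at_def)
  show "(Suc s, True) \<in> set ps \<and> m = Min (marks_at gm s)"
    if "m \<in> marks_at gm (Suc s)" "m \<in> marks_at gm s" for m s
  proof -
    from that obtain p where "p \<in> set gm" "psize p = Suc s" "pmark p = m" by (auto simp: marks_at_def)
    with inv(3)[of p] that(2) show ?thesis by (auto simp: freed_marks_def split: if_splits)
  qed
  show "x \<in> marks_at gm s \<and> \<not> ((Suc s, True) \<in> set ps \<and> x = Min (marks_at gm s))"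
    if "m \<in> marks_at gm (Suc s)" "1 \<le> x" "x < m" "x \<notin> marks_at gm (Suc s)" for m s x
  proof -
    from that(1) obtain p where "p \<in> set gm" "psize p = Suc s" "pmark p = m" by (auto simp: marks_at_def)
    with inv(5)[of p x] that show ?thesis by (auto simp: freed_marks_def split: if_splits)
  qed
  show "1 \<in> marks_at gm s" if "(s, True) \<in> set ps" for s
  proof -
    from that have "(s, True) \<in> fst ` set gm" unfolding set_ps .
    then obtain p where "p \<in> set gm" "fst p = (s, True)" by force
    with inv(4)[of p] have "p \<in> set gm \<and> psize p = s \<and> pmark p = 1" by simp
    then show ?thesis unfolding marks_at_image by force
  qed
  show "\<exists>n. \<forall>s>n. marks_at gm s = {}"
  proof (intro exI allI impI)
    fix s assume s: "sum_list (map psize gm) < s"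
    have "psize p \<le> sum_list (map psize gm)" if "p \<in> set gm" for p
      using that by (intro member_le_sum_list) auto
    with s show "marks_at gm s = {}" by (fastforce simp: marks_at_def)
  qed
  show "V ps (Suc s) = V ps s + of_bool ((Suc s, True) \<in> set ps)" for s by (rule V_Suc[OF ps])
  show "marks_at gm s = {pmark p |p. p \<in> set gm \<and> psize p = s}" for s by (rule marks_at_def)
  show "p = p'" if "p \<in> set gm" "p' \<in> set gm" "psize p = psize p'" "pmark p = pmark p'" for p p'
  proof -
    have "inj_on (\<lambda>p. (psize p, pmark p)) (set gm)"
      using marking_inv_gm by (auto simp: marking_inv_def distinct_map)
    with that show ?thesis by (auto dest: inj_onD)
  qed
qed simp

lemma card_marks_gm: "card (marks_at gm s) = count_list ps (s, False) + of_bool ((s, True) \<in> set ps)"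
proof -
  have d: "distinct (map (\<lambda>p. (psize p, pmark p)) gm)" using marking_inv_gm by (simp add: marking_inv_def)
  then have dg: "distinct gm" by (simp add: distinct_map)
  have "marks_at gm s = pmark ` {p \<in> set gm. psize p = s}" by (rule marks_at_image)
  moreover have "inj_on pmark {p \<in> set gm. psize p = s}"
    using d by (auto simp: inj_on_def distinct_map)
  ultimately have "card (marks_at gm s) = card {p \<in> set gm. psize p = s}" by (simp add: card_image)
  also have "\<dots> = length (filter (\<lambda>p. psize p = s) gm)"
    using distinct_card[OF distinct_filter[OF dg, of "\<lambda>p. psize p = s"]] by simp
  also have "\<dots> = length (filter (\<lambda>p. fst p = s) (map fst gm))" by (simp add: filter_map o_def)
  also have "\<dots> = length (filter (\<lambda>p. fst p = s) ps)"
    unfolding map_fst_gm by (simp add: filter_sort)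
  also have "\<dots> = count_list ps (s, False) + count_list ps (s, True)"
    by (induction ps) auto
  also have "count_list ps (s, True) = of_bool ((s, True) \<in> set ps)"
    using overpartition_count_bar[OF ps, of s] count_list_0_iff[of ps "(s, True)"]
    by (auto simp: le_Suc_eq)
  finally show ?thesis .
qed

end

section \<open>Overpartitions as words\<close>

text \<open>The words counted by \<open>trunc_gf\<close>, with the same test for the zero letters
  after the end.\<close>

fun accepts :: "nat \<Rightarrow> bool \<Rightarrow> bool \<Rightarrow> nat \<Rightarrow> nat \<Rightarrow> (nat \<times> bool) list \<Rightarrow> bool" where
  "accepts k v e i j [] \<longleftrightarrow> \<not> (v \<and> e \<and> odd j)"
| "accepts k v e i j ((f, b) # w) \<longleftrightarrow>
     f < i \<and> f + of_bool b < k \<and> letter_ok v e j f b \<and>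
     accepts k (v \<noteq> b) (new_mark e f b) (k - f - of_bool b) (Suc j) w"

fun word_weight :: "nat \<Rightarrow> (nat \<times> bool) list \<Rightarrow> nat" where
  "word_weight j [] = 0"
| "word_weight j ((f, b) # w) = j * (f + of_bool b) + word_weight (Suc j) w"

fun from_word :: "nat \<Rightarrow> (nat \<times> bool) list \<Rightarrow> opart list" where
  "from_word j [] = []"
| "from_word j ((f, b) # w) =
     from_word (Suc j) w @ (if b then [(j, True)] else []) @ replicate f (j, False)"

definition to_word :: "nat \<Rightarrow> opart list \<Rightarrow> (nat \<times> bool) list" where
  "to_word n ps = map (\<lambda>s. (count_list ps (s, False), (s, True) \<in> set ps)) [1..<Suc n]"

text \<open>In contrast to \<open>gordon_key\<close> the overlined copy ranks above the plain ones,
  so that overpartitions are non-increasing in this key.\<close>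

definition part_key :: "opart \<Rightarrow> nat" where
  "part_key p = 2 * fst p + of_bool (snd p)"

lemma part_key_inj: "inj part_key"
proof (rule injI)
  fix p q :: opart assume "part_key p = part_key q"
  then have "2 * fst p + of_bool (snd p) = 2 * fst q + (of_bool (snd q) :: nat)" by (simp add: part_key_def)
  then show "p = q" by (cases p; cases q; cases "snd p"; cases "snd q") (auto, presburger+)
qed

lemma overpartition_iff:
  "overpartition ps \<longleftrightarrow> (\<forall>p \<in> set ps. 0 < fst p) \<and> sorted_wrt (\<ge>) (map part_key ps) \<and>
     (\<forall>s. count_list ps (s, True) \<le> 1)" (is "_ \<longleftrightarrow> ?R")
proof
  assume o: "overpartition ps"
  have "part_key (ps ! j) \<le> part_key (ps ! i)" if "i < j" "j < length ps" for i j
  proof -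
    have "sorted_wrt (\<ge>) (map fst ps)" using o by (simp add: overpartition_def)
    then have 1: "fst (ps ! j) \<le> fst (ps ! i)"
      using that by (auto simp: sorted_wrt_iff_nth_less)
    have "snd (ps ! j) \<longrightarrow> (\<forall>i<j. fst (ps ! i) \<noteq> fst (ps ! j))"
      using o that unfolding overpartition_def by blast
    then have "snd (ps ! j) \<Longrightarrow> fst (ps ! i) \<noteq> fst (ps ! j)" using that by blast
    with 1 show ?thesis unfolding part_key_def by (cases "snd (ps ! j)") auto
  qed
  then show ?R using o overpartition_count_bar[OF o]
    by (auto simp: sorted_wrt_iff_nth_less overpartition_def)
next
  assume R: ?R
  have le: "part_key (ps ! j) \<le> part_key (ps ! i)" if "i < j" "j < length ps" for i j
    using R that by (auto simp: sorted_wrt_iff_nth_less)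
  have "sorted_wrt (\<ge>) (map fst ps)"
  proof -
    have "fst (ps ! j) \<le> fst (ps ! i)" if "i < j" "j < length ps" for i j
      using le[OF that] unfolding part_key_def by (cases "snd (ps ! j)"; cases "snd (ps ! i)") auto
    then show ?thesis by (auto simp: sorted_wrt_iff_nth_less)
  qed
  moreover have "fst (ps ! j) \<noteq> fst (ps ! i)" if ij: "i < length ps" "snd (ps ! i)" "j < i" for i j
  proof
    assume eq: "fst (ps ! j) = fst (ps ! i)"
    define s where "s = fst (ps ! i)"
    have i: "ps ! i = (s, True)" using ij(2) by (simp add: s_def prod_eq_iff)
    have "snd (ps ! j)" using le[OF ij(3,1)] ij(2) eq by (cases "snd (ps ! j)") (auto simp: part_key_def)
    then have j: "ps ! j = (s, True)" using eq by (simp add: s_def prod_eq_iff)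
    have "card {j, i} \<le> card {l. l < length ps \<and> (s, True) = ps ! l}"
      using i j ij by (intro card_mono) auto
    then have "2 \<le> count_list ps (s, True)"
      using ij(3) by (simp add: count_list_eq_length_filter length_filter_conv_card)
    with R show False by (metis Suc_1 not_less_eq_eq)
  qed
  ultimately show "overpartition ps" using R unfolding overpartition_def by blast
qed

lemma overpartition_unique:
  assumes "overpartition ps" "overpartition qs"
    and F: "\<And>s. count_list ps (s, False) = count_list qs (s, False)"
    and T: "\<And>s. (s, True) \<in> set ps \<longleftrightarrow> (s, True) \<in> set qs"
  shows "ps = qs"
proof -
  have c: "count_list xs (s, True) = of_bool ((s, True) \<in> set xs)" if "overpartition xs" for xs s
    using overpartition_count_bar[OF that, of s] count_list_0_iff[of xs "(s, True)"]
    by (auto simp: le_Suc_eq)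
  have "count_list ps (s, b) = count_list qs (s, b)" for s b
    using F[of s] T[of s] c[OF assms(1), of s] c[OF assms(2), of s] by (cases b) auto
  then have "mset ps = mset qs" by (intro multiset_eqI) (auto simp: count_mset)
  then have "mset (map part_key ps) = mset (map part_key qs)" by simp
  moreover have "sorted (rev (map part_key ps))" "sorted (rev (map part_key qs))"
    using assms(1,2) unfolding overpartition_iff sorted_wrt_rev by (auto simp: sorted_wrt_rev)
  ultimately have "sort (map part_key ps) = rev (map part_key ps)" "sort (map part_key ps) = rev (map part_key qs)"
    by (auto intro!: properties_for_sort)
  then have "rev (map part_key ps) = rev (map part_key qs)" by simp
  then show ?thesis using inj_map_eq_map[OF part_key_inj] by simp
qed

lemma set_from_word: "p \<in> set (from_word j w) \<Longrightarrow> j \<le> fst p \<and> fst p < j + length w"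
  by (induction j w rule: from_word.induct) (fastforce split: if_splits)+

lemma count_list_replicate: "count_list (replicate n x) y = (if x = y then n else 0)"
  by (induction n) auto

lemma count_from_word_False:
  "count_list (from_word j w) (s, False) = (if j \<le> s \<and> s < j + length w then fst (w ! (s - j)) else 0)"
proof (induction j w rule: from_word.induct)
  case (2 j f b w)
  have d: "s - j = Suc (s - Suc j)" if "Suc j \<le> s" using that by simp
  show ?case using 2 by (cases "s = j") (auto simp: count_list_replicate d)
qed auto

lemma count_from_word_True:
  "count_list (from_word j w) (s, True) = of_bool (j \<le> s \<and> s < j + length w \<and> snd (w ! (s - j)))"
proof (induction j w rule: from_word.induct)
  case (2 j f b w)
  have d: "s - j = Suc (s - Suc j)" if "Suc j \<le> s" using that by simp
  show ?case using 2 by (cases "s = j") (auto simp: count_list_replicate d)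
qed auto

lemmas count_from_word = count_from_word_False count_from_word_True

lemma overpartition_from_word:
  assumes "1 \<le> j"
  shows "overpartition (from_word j w)"
proof -
  have "sorted_wrt (\<ge>) (map part_key (from_word j w))"
  proof (induction j w rule: from_word.induct)
    case (2 j f b w)
    have 1: "2 * j + 1 \<le> x" "2 * j \<le> x" if "x \<in> set (map part_key (from_word (Suc j) w))" for x
      using that set_from_word[of _ "Suc j" w] by (force simp: part_key_def)+
    have r: "sorted_wrt (\<ge>) (replicate f x)" for x :: nat by (induction f) auto
    have "map part_key (from_word j ((f, b) # w)) =
        map part_key (from_word (Suc j) w) @ (if b then [2 * j + 1] else []) @ replicate f (2 * j)"
      by (simp add: part_key_def)
    then show ?case using 1 r 2 by (simp add: sorted_wrt_append del: set_map)
  qed simp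
  moreover have "0 < fst p" if "p \<in> set (from_word j w)" for p
    using set_from_word[OF that] assms by simp
  ultimately show ?thesis unfolding overpartition_iff count_from_word by auto
qed

lemma sum_list_from_word: "sum_list (map fst (from_word j w)) = word_weight j w"
  by (induction j w rule: from_word.induct) (auto simp: sum_list_replicate algebra_simps)

lemma True_in_from_word:
  "(s, True) \<in> set (from_word j w) \<longleftrightarrow> j \<le> s \<and> s < j + length w \<and> snd (w ! (s - j))"
proof -
  have "(s, True) \<in> set (from_word j w) \<longleftrightarrow> count_list (from_word j w) (s, True) \<noteq> 0"
    using count_list_0_iff[of "from_word j w" "(s, True)"] by simp
  then show ?thesis unfolding count_from_word_True by auto
qed

lemma length_to_word [simp]: "length (to_word n ps) = n"
  by (simp add: to_word_def)

lemma to_word_nth: "i < n \<Longrightarrow> to_word n ps ! i = (count_list ps (Suc i, False), (Suc i, True) \<in> set ps)"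
  using nth_upt[of 1 i "Suc n"] by (simp add: to_word_def del: upt_Suc)

lemma to_word_from_word:
  assumes "length w = n"
  shows "to_word n (from_word 1 w) = w"
proof (rule nth_equalityI)
  fix i assume "i < length (to_word n (from_word 1 w))"
  then show "to_word n (from_word 1 w) ! i = w ! i"
    using assms by (simp add: to_word_nth True_in_from_word count_from_word_False)
qed (simp add: assms)

lemma from_word_to_word:
  assumes o: "overpartition ps" and le: "\<And>p. p \<in> set ps \<Longrightarrow> fst p \<le> n"
  shows "from_word 1 (to_word n ps) = ps"
proof (rule overpartition_unique[OF overpartition_from_word o])
  have nth: "to_word n ps ! (s - 1) = (count_list ps (s, False), (s, True) \<in> set ps)" if "1 \<le> s \<and> s \<le> n" for s
  proof -
    have "s - 1 < n" using that by auto
    then show ?thesis using to_word_nth[of "s - 1" n ps] that by simp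
  qed
  have out: "(s, b) \<notin> set ps" if "\<not> (1 \<le> s \<and> s \<le> n)" for s b
  proof
    assume a: "(s, b) \<in> set ps"
    then have "0 < fst (s, b)" using o unfolding overpartition_def by blast
    with le[OF a] that show False by simp
  qed
  fix s
  show "count_list (from_word 1 (to_word n ps)) (s, False) = count_list ps (s, False)"
  proof (cases "1 \<le> s \<and> s \<le> n")
    case True
    with nth[OF True] show ?thesis by (simp add: count_from_word_False)
  next
    case False
    then have "count_list ps (s, False) = 0" using out[OF False, of False] count_list_0_iff[of ps "(s, False)"] by simp
    with False show ?thesis by (auto simp: count_from_word_False)
  qed
  show "(s, True) \<in> set (from_word 1 (to_word n ps)) \<longleftrightarrow> (s, True) \<in> set ps"
  proof (cases "1 \<le> s \<and> s \<le> n")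
    case True
    with nth[OF True] show ?thesis by (simp add: True_in_from_word)
  next
    case False
    with out[OF False, of True] show ?thesis by (auto simp: True_in_from_word)
  qed
qed simp

text \<open>Only the first occurrence of x matters: in a sorted list the entries between y and x
  form a block that starts there, and the block has at least k entries iff the entry k - 1 places
  further on is still at least y.\<close>

lemma window_iff:
  fixes xs :: "nat list"
  assumes s: "sorted_wrt (\<ge>) xs" and k: "1 \<le> k"
  shows "(\<forall>j. j + k - 1 < length xs \<longrightarrow> xs ! j = x \<longrightarrow> xs ! (j + k - 1) < y) \<longleftrightarrow>
    (x \<in> set xs \<longrightarrow> length (filter (\<lambda>z. y \<le> z \<and> z \<le> x) xs) < k)" (is "?L \<longleftrightarrow> ?R")
proof -
  let ?A = "{i. i < length xs \<and> y \<le> xs ! i \<and> xs ! i \<le> x}"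
  have len: "length (filter (\<lambda>z. y \<le> z \<and> z \<le> x) xs) = card ?A" by (simp add: length_filter_conv_card)
  have mono: "xs ! j \<le> xs ! i" if "i \<le> j" "j < length xs" for i j
    using s that by (cases "i = j") (auto simp: sorted_wrt_iff_nth_less)
  show ?thesis
  proof
    assume L: ?L
    show ?R
    proof (intro impI, rule ccontr)
      assume x: "x \<in> set xs" and c: "\<not> length (filter (\<lambda>z. y \<le> z \<and> z \<le> x) xs) < k"
      define j where "j = (LEAST j. j < length xs \<and> xs ! j = x)"
      have ex: "\<exists>j. j < length xs \<and> xs ! j = x" using x by (auto simp: in_set_conv_nth)
      have j: "j < length xs" "xs ! j = x" using LeastI_ex[OF ex] unfolding j_def by auto
      have first: "i \<ge> j" if "i \<in> ?A" for i
      proof (rule ccontr)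
        assume "\<not> i \<ge> j"
        then have "xs ! i = x" using mono[of i j] j that by auto
        then have "j \<le> i" unfolding j_def using that by (intro Least_le) auto
        with \<open>\<not> i \<ge> j\<close> show False by simp
      qed
      have "\<not> ?A \<subseteq> {j..<j + k - 1}"
      proof
        assume "?A \<subseteq> {j..<j + k - 1}"
        then have "card ?A \<le> card {j..<j + k - 1}" by (intro card_mono) auto
        with c k show False unfolding len by simp
      qed
      then obtain i where i: "i \<in> ?A" "j + k - 1 \<le> i" using first k by fastforce
      then have "y \<le> xs ! (j + k - 1)" "j + k - 1 < length xs" using mono[of "j + k - 1" i] by auto
      with L j show False by force
    qed
  next
    assume R: ?R
    show ?L
    proof (intro allI impI, rule ccontr)
      fix j assume j: "j + k - 1 < length xs" "xs ! j = x" "\<not> xs ! (j + k - 1) < y"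
      have "{j..j + k - 1} \<subseteq> ?A"
      proof
        fix i assume "i \<in> {j..j + k - 1}"
        then show "i \<in> ?A" using mono[of i "j + k - 1"] mono[of j i] j by auto
      qed
      then have "card {j..j + k - 1} \<le> card ?A" by (intro card_mono) auto
      then have "k \<le> card ?A" using k by simp
      moreover have "x \<in> set xs" using nth_mem[of j xs] j k by auto
      ultimately show False using R unfolding len by simp
    qed
  qed
qed

lemma length_filter_disj:
  assumes "\<And>x. \<not> (P x \<and> Q x)"
  shows "length (filter (\<lambda>x. P x \<or> Q x) xs) = length (filter P xs) + length (filter Q xs)"
  using assms by (induction xs) auto

lemma difference_iff:
  assumes o: "overpartition ps" and k: "1 \<le> k"
  defines "f \<equiv> \<lambda>s. count_list ps (s, False)" and "b \<equiv> \<lambda>s. (s, True) \<in> set ps"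
  shows "(\<forall>j. j + k - 1 < length ps \<longrightarrow>
             int (fst (ps ! j)) - int (fst (ps ! (j + k - 1))) \<ge> (if snd (ps ! j) then 1 else 2)) \<longleftrightarrow>
    (\<forall>s. f s + of_bool (b s) + f (Suc s) < k)"
proof -
  \<comment> \<open>The keys from \<open>low p\<close> on are too close to p: they begin with the
    plain part of the same size if p is overlined, and with the plain part of the preceding size
    otherwise.\<close>
  define low where "low p = (if snd p then 2 * fst p else 2 * fst p - 2)" for p :: opart
  have pos: "0 < fst p" if "p \<in> set ps" for p using o that by (simp add: overpartition_def)
  have srt: "sorted_wrt (\<ge>) (map part_key ps)" using o overpartition_iff by blast
  have bc: "count_list ps (s, True) = of_bool (b s)" for s
    using overpartition_count_bar[OF o, of s] count_list_0_iff[of ps "(s, True)"]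
    by (auto simp: le_Suc_eq b_def)
  have cl: "length (filter (\<lambda>p. p = q) ps) = count_list ps q" for q
    by (induction ps) auto
  have "(int (fst p) - int (fst q) \<ge> (if snd p then 1 else 2)) \<longleftrightarrow> part_key q < low p"
    if "p \<in> set ps" for p q
    using pos[OF that] unfolding low_def part_key_def by (cases "snd p"; cases "snd q"; simp; linarith)
  note e0 = this
  have e: "(int (fst (ps ! j)) - int (fst (ps ! (j + k - 1))) \<ge> (if snd (ps ! j) then 1 else 2)) \<longleftrightarrow>
      part_key (ps ! (j + k - 1)) < low (ps ! j)" if "j + k - 1 < length ps" for j
  proof (rule e0)
    show "ps ! j \<in> set ps" using that k by (intro nth_mem) simp
  qed
  have "(\<forall>j. j + k - 1 < length ps \<longrightarrow>
             int (fst (ps ! j)) - int (fst (ps ! (j + k - 1))) \<ge> (if snd (ps ! j) then 1 else 2)) \<longleftrightarrow>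
    (\<forall>j. j + k - 1 < length ps \<longrightarrow> part_key (ps ! (j + k - 1)) < low (ps ! j))"
    by (simp only: e cong: imp_cong)
  also have "\<dots> \<longleftrightarrow> (\<forall>p \<in> set ps. length (filter (\<lambda>z. low p \<le> part_key z \<and> part_key z \<le> part_key p) ps) < k)"
    (is "?L \<longleftrightarrow> ?R")
  proof -
    have jl: "j < length ps" if "j + k - 1 < length ps" for j using that k by simp
    have win: "(\<forall>j. j + k - 1 < length ps \<longrightarrow> part_key (ps ! j) = part_key p \<longrightarrow> part_key (ps ! (j + k - 1)) < low p) \<longleftrightarrow>
      length (filter (\<lambda>z. low p \<le> part_key z \<and> part_key z \<le> part_key p) ps) < k" if "p \<in> set ps" for p
    proof -
      have "part_key p \<in> set (map part_key ps)" using that by simp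
      moreover have "length (filter (\<lambda>z. low p \<le> z \<and> z \<le> part_key p) (map part_key ps)) =
          length (filter (\<lambda>z. low p \<le> part_key z \<and> part_key z \<le> part_key p) ps)"
        by (simp add: filter_map o_def)
      moreover have "map part_key ps ! j = part_key (ps ! j)"
        "map part_key ps ! (j + k - 1) = part_key (ps ! (j + k - 1))" if "j + k - 1 < length ps" for j
        using jl[OF that] that by simp_all
      ultimately show ?thesis
        using window_iff[OF srt k, of "part_key p" "low p"] by (simp only: length_map simp_thms cong: imp_cong)
    qed
    show ?thesis
    proof
      assume L: ?L
      show ?R
      proof
        fix p assume p: "p \<in> set ps"
        have "part_key (ps ! (j + k - 1)) < low p"
          if "j + k - 1 < length ps" "part_key (ps ! j) = part_key p" for j
          using L that injD[OF part_key_inj that(2)] by auto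
        with win[OF p] show "length (filter (\<lambda>z. low p \<le> part_key z \<and> part_key z \<le> part_key p) ps) < k" by blast
      qed
    next
      assume R: ?R
      show ?L
      proof (intro allI impI)
        fix j assume j: "j + k - 1 < length ps"
        have "ps ! j \<in> set ps" by (rule nth_mem[OF jl[OF j]])
        with win[of "ps ! j"] R j show "part_key (ps ! (j + k - 1)) < low (ps ! j)" by blast
      qed
    qed
  qed
  also have "\<dots> \<longleftrightarrow> (\<forall>p \<in> set ps. if snd p then Suc (f (fst p)) < k
      else f (fst p) + of_bool (b (fst p - 1)) + f (fst p - 1) < k)"
  proof (intro ball_cong refl)
    fix p assume p: "p \<in> set ps"
    show "length (filter (\<lambda>z. low p \<le> part_key z \<and> part_key z \<le> part_key p) ps) < k \<longleftrightarrow>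
      (if snd p then Suc (f (fst p)) < k else f (fst p) + of_bool (b (fst p - 1)) + f (fst p - 1) < k)"
    proof (cases "snd p")
      case True
      then have "low p \<le> part_key z \<and> part_key z \<le> part_key p \<longleftrightarrow> z = (fst p, False) \<or> z = (fst p, True)" for z
        unfolding low_def part_key_def prod_eq_iff by (cases "snd z"; simp; linarith)
      then have "length (filter (\<lambda>z. low p \<le> part_key z \<and> part_key z \<le> part_key p) ps) = f (fst p) + of_bool (b (fst p))"
        by (simp add: length_filter_disj cl bc f_def)
      moreover have "b (fst p)" using p True by (metis b_def prod.collapse)
      ultimately show ?thesis using True by simp
    next
      case False
      obtain t where t: "fst p = Suc t" using pos[OF p] by (cases "fst p") auto
      have "low p \<le> part_key z \<and> part_key z \<le> part_key p \<longleftrightarrow>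
         z = (fst p, False) \<or> (z = (fst p - 1, True) \<or> z = (fst p - 1, False))" for z
        using t False unfolding low_def part_key_def prod_eq_iff by (cases "snd z"; simp; linarith)
      then have "length (filter (\<lambda>z. low p \<le> part_key z \<and> part_key z \<le> part_key p) ps) =
         f (fst p) + (of_bool (b (fst p - 1)) + f (fst p - 1))"
        using t by (simp add: length_filter_disj cl bc f_def)
      then show ?thesis using False by simp
    qed
  qed
  also have "\<dots> \<longleftrightarrow> (\<forall>s. f s + of_bool (b s) + f (Suc s) < k)" (is "?L \<longleftrightarrow> ?R")
  proof
    assume L: ?L
    have F: "f (Suc s) + of_bool (b s) + f s < k" if "f (Suc s) \<noteq> 0" for s
    proof -
      have "(Suc s, False) \<in> set ps" using that count_list_0_iff[of ps "(Suc s, False)"] unfolding f_def by simp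
      from L[rule_format, OF this] show ?thesis by simp
    qed
    have T: "Suc (f s) < k" if "b s" for s
      using L[rule_format, of "(s, True)"] that by (simp add: b_def)
    have f0: "f 0 = 0" using pos[of "(0, False)"] count_list_0_iff[of ps "(0, False)"] unfolding f_def by auto
    show ?R
    proof
      fix s
      show "f s + of_bool (b s) + f (Suc s) < k"
      \<comment> \<open>Without plain parts of size s + 1 the bound has to come from the parts of
        size s themselves.\<close>
      proof (cases "f (Suc s) = 0")
        case True
        show ?thesis
        proof (cases s)
          case (Suc t)
          then show ?thesis using T[of s] F[of t] True k by (cases "b s"; cases "f s = 0") auto
        qed (use T[of s] True f0 k in \<open>cases "b s"; auto\<close>)
      qed (use F[of s] in auto)
    qed
  next
    assume R: ?R
    show ?L
    proof
      fix p assume p: "p \<in> set ps"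
      obtain t where t: "fst p = Suc t" using pos[OF p] by (cases "fst p") auto
      have "b (fst p)" if "snd p" using p that by (metis b_def prod.collapse)
      then show "if snd p then Suc (f (fst p)) < k else f (fst p) + of_bool (b (fst p - 1)) + f (fst p - 1) < k"
        using R[rule_format, of "fst p"] R[rule_format, of t] t by (cases "snd p") simp_all
    qed
  qed
  finally show ?thesis .
qed

lemma accepts_map:
  assumes "\<And>s. j \<le> s \<Longrightarrow> vp (Suc s) = (vp s \<noteq> b s)"
    and "\<And>s. j \<le> s \<Longrightarrow> ep (Suc s) = new_mark (ep s) (f s) (b s)"
    and "\<And>s. j \<le> s \<Longrightarrow> cap (Suc s) = k - f s - of_bool (b s)"
  shows "accepts k (vp j) (ep j) (cap j) j (map (\<lambda>s. (f s, b s)) [j..<j + n]) \<longleftrightarrow>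
    (\<forall>s \<in> {j..<j + n}. f s < cap s \<and> f s + of_bool (b s) < k \<and> letter_ok (vp s) (ep s) s (f s) (b s)) \<and>
    \<not> (vp (j + n) \<and> ep (j + n) \<and> odd (j + n))"
  using assms
proof (induction n arbitrary: j)
  case 0
  then show ?case by simp
next
  case (Suc n)
  have l: "[j..<j + Suc n] = j # [Suc j..<Suc j + n]" by (simp add: upt_conv_Cons del: upt_Suc)
  have s: "{j..<j + Suc n} = insert j {Suc j..<Suc j + n}" by auto
  have "accepts k (vp (Suc j)) (ep (Suc j)) (cap (Suc j)) (Suc j) (map (\<lambda>s. (f s, b s)) [Suc j..<Suc j + n]) \<longleftrightarrow>
    (\<forall>s \<in> {Suc j..<Suc j + n}. f s < cap s \<and> f s + of_bool (b s) < k \<and> letter_ok (vp s) (ep s) s (f s) (b s)) \<and>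
    \<not> (vp (Suc j + n) \<and> ep (Suc j + n) \<and> odd (Suc j + n))"
    by (rule Suc.IH) (use Suc.prems in auto)
  then show ?case
    unfolding l s list.map accepts.simps Suc.prems(1)[OF order_refl, symmetric]
      Suc.prems(2)[OF order_refl, symmetric] Suc.prems(3)[OF order_refl, symmetric]
    by auto
qed

lemma parity_condition_iff:
  "parity_condition ps c \<longleftrightarrow> even (sum_list (map psize c) + V ps (psize (hd c)))"
  unfolding parity_condition_def using even_length_filter_odd[of psize c] by simp

definition obar_set :: "nat \<Rightarrow> nat \<Rightarrow> nat \<Rightarrow> opart list set" where
  "obar_set k a n = {ps \<in> Bbar_set k a n. \<exists>cs. left_decomposition (set (gordon_marking ps)) cs \<and>
            (\<forall>c \<in> set cs. parity_condition ps c)}"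

lemma obar_set_iff:
  assumes o: "overpartition ps" and n: "sum_list (map fst ps) = n" and a: "1 \<le> a" "a \<le> k"
  shows "ps \<in> obar_set k a n \<longleftrightarrow> accepts k False False a 1 (to_word n ps)"
proof -
  interpret marked_parts "marks_at (gordon_marking ps)" "\<lambda>s. (s, True) \<in> set ps" "V ps" "set (gordon_marking ps)"
    by (rule marked_parts_gm[OF o])
  define f b where "f s = count_list ps (s, False)" and "b s \<longleftrightarrow> (s, True) \<in> set ps" for s
  define S where "S = marks_at (gordon_marking ps)"
  define vp ep where "vp s \<longleftrightarrow> odd (V ps (s - 1))" and "ep s \<longleftrightarrow> 1 \<in> S (s - 1)" for s
  define cap where "cap s = (if s = 1 then a else k - f (s - 1) - of_bool (b (s - 1)))" for s
  have k: "1 \<le> k" using a by simp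
  have le: "fst p \<le> n" if "p \<in> set ps" for p
    using that unfolding n[symmetric] by (intro member_le_sum_list) auto
  have f_out: "f s = 0" if "n < s" for s
    using le[of "(s, False)"] that count_list_0_iff[of ps "(s, False)"] by (auto simp: f_def)
  have b_out: "\<not> b s" if "n < s" for s using le[of "(s, True)"] that by (auto simp: b_def)
  have card: "card (S s) = f s + of_bool (b s)" for s
    unfolding S_def f_def b_def by (rule card_marks_gm[OF o])
  have vp_Suc: "vp (Suc s) = (vp s \<noteq> b s)" if "1 \<le> s" for s
    using vb_Suc[of "s - 1"] that by (simp add: vp_def b_def)
  have ep_Suc: "ep (Suc s) = new_mark (ep s) (f s) (b s)" if "1 \<le> s" for s
  proof -
    have "S s \<noteq> {} \<longleftrightarrow> 0 < f s \<or> b s" using card[of s] S_finite[of s] by (auto simp: S_def)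
    then show ?thesis using one_in[of "s - 1"] that by (auto simp: ep_def new_mark_def S_def b_def)
  qed
  have V0: "V ps 0 = 0" using o by (auto simp: V_def overpartition_def filter_empty_conv)
  have init: "vp 1 = False" "ep 1 = False" "cap 1 = a"
    using V0 S_0' by (simp_all add: vp_def ep_def cap_def S_def)
  have acc: "accepts k False False a 1 (to_word n ps) \<longleftrightarrow>
    (\<forall>s \<in> {1..<1 + n}. f s < cap s \<and> f s + of_bool (b s) < k \<and> letter_ok (vp s) (ep s) s (f s) (b s)) \<and>
    \<not> (vp (1 + n) \<and> ep (1 + n) \<and> odd (1 + n))"
    using accepts_map[of 1 vp b ep f cap k n, OF vp_Suc ep_Suc] unfolding init
    by (simp add: to_word_def f_def b_def cap_def del: upt_Suc)
  \<comment> \<open>Beyond n all letters are zero, and from n + 2 on there is no part of the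
    preceding size; so only the letter at n + 1 adds a condition, the end test of
    \<open>accepts\<close>.\<close>
  have site: "letter_ok (vp s) (ep s) s (f s) (b s) \<longleftrightarrow> \<not> (vp s \<and> ep s \<and> odd s)" if "n < s" for s
    using f_out[OF that] b_out[OF that] by (simp add: letter_ok_0)
  have ep_out: "\<not> ep s" if "Suc n < s" for s
  proof -
    have "n < s - 1" using that by auto
    then have "card (S (s - 1)) = 0" using card f_out b_out by simp
    then show ?thesis using S_finite[of "s - 1"] by (auto simp: ep_def S_def)
  qed
  have dec: "(\<exists>cs. left_decomposition (set (gordon_marking ps)) cs \<and> (\<forall>c \<in> set cs. parity_condition ps c)) \<longleftrightarrow>
    (\<forall>s\<ge>1. letter_ok (vp s) (ep s) s (f s) (b s))"
  proof -
    have so: "site_ok s \<longleftrightarrow> letter_ok (vp (Suc s)) (ep (Suc s)) (Suc s) (f (Suc s)) (b (Suc s))" for s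
      using card[of "Suc s"] by (simp add: vp_def ep_def S_def b_def)
    have "(\<forall>s. even s \<longrightarrow> site_ok s) \<longleftrightarrow> (\<forall>s\<ge>1. letter_ok (vp s) (ep s) s (f s) (b s))"
    proof
      assume L: "\<forall>s. even s \<longrightarrow> site_ok s"
      show "\<forall>s\<ge>1. letter_ok (vp s) (ep s) s (f s) (b s)"
      proof (intro allI impI)
        fix s :: nat assume "1 \<le> s"
        then obtain t where t: "s = Suc t" by (cases s) auto
        show "letter_ok (vp s) (ep s) s (f s) (b s)"
        proof (cases "even t")
          case True
          with L have "site_ok t" by blast
          then show ?thesis unfolding so t .
        qed (simp add: letter_ok_def t)
      qed
    next
      assume R: "\<forall>s\<ge>1. letter_ok (vp s) (ep s) s (f s) (b s)"
      show "\<forall>s. even s \<longrightarrow> site_ok s" unfolding so using R by simp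
    qed
    then show ?thesis unfolding decomposition_iff_site_ok[symmetric] parity_condition_iff .
  qed
  have lets: "(\<forall>s\<ge>1. letter_ok (vp s) (ep s) s (f s) (b s)) \<longleftrightarrow>
    (\<forall>s \<in> {1..<1 + n}. letter_ok (vp s) (ep s) s (f s) (b s)) \<and> \<not> (vp (1 + n) \<and> ep (1 + n) \<and> odd (1 + n))"
  proof
    assume L: "\<forall>s\<ge>1. letter_ok (vp s) (ep s) s (f s) (b s)"
    then have "letter_ok (vp (1 + n)) (ep (1 + n)) (1 + n) (f (1 + n)) (b (1 + n))" by simp
    with L show "(\<forall>s \<in> {1..<1 + n}. letter_ok (vp s) (ep s) s (f s) (b s)) \<and> \<not> (vp (1 + n) \<and> ep (1 + n) \<and> odd (1 + n))"
      using site[of "1 + n"] by auto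
  next
    assume R: "(\<forall>s \<in> {1..<1 + n}. letter_ok (vp s) (ep s) s (f s) (b s)) \<and> \<not> (vp (1 + n) \<and> ep (1 + n) \<and> odd (1 + n))"
    show "\<forall>s\<ge>1. letter_ok (vp s) (ep s) s (f s) (b s)"
    proof (intro allI impI)
      fix s :: nat assume s: "1 \<le> s"
      consider "s < 1 + n" | "s = 1 + n" | "Suc n < s" by linarith
      then show "letter_ok (vp s) (ep s) s (f s) (b s)"
      proof cases
        case 3
        then show ?thesis using site[of s] ep_out[of s] by simp
      qed (use R s site[of s] in auto)
    qed
  qed
  have caps: "(f 1 \<le> a - 1 \<and> (\<forall>s. f s + of_bool (b s) + f (Suc s) < k)) \<longleftrightarrow>
    (\<forall>s \<in> {1..<1 + n}. f s < cap s \<and> f s + of_bool (b s) < k)" (is "?L \<longleftrightarrow> ?R")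
  proof
    assume L: ?L
    show ?R
    proof
      fix s assume s: "s \<in> {1..<1 + n}"
      have "f s < cap s"
      proof (cases "s = 1")
        case False
        then obtain t where "s = Suc t" "1 \<le> t" using s by (cases s) auto
        with L[THEN conjunct2, rule_format, of t] show ?thesis by (simp add: cap_def)
      qed (use L a in \<open>auto simp: cap_def\<close>)
      moreover have "f s + of_bool (b s) < k" using L[THEN conjunct2, rule_format, of s] by linarith
      ultimately show "f s < cap s \<and> f s + of_bool (b s) < k" by blast
    qed
  next
    assume R: ?R
    have 1: "f 1 \<le> a - 1"
      using R[rule_format, of 1] f_out[of 1] by (cases "n = 0") (auto simp: cap_def)
    have f0: "f 0 = 0" "\<not> b 0"
    proof -
      have "(0, c) \<notin> set ps" for c using o unfolding overpartition_def by fastforce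
      then show "f 0 = 0" "\<not> b 0" using count_list_0_iff[of ps "(0, False)"] by (auto simp: f_def b_def)
    qed
    have "f s + of_bool (b s) + f (Suc s) < k" for s
    proof (cases "s = 0")
      case True
      then show ?thesis using f0 1 a by simp
    next
      case False
      show ?thesis
      proof (cases "Suc s < 1 + n")
        case True
        with R[rule_format, of "Suc s"] False show ?thesis by (auto simp: cap_def)
      next
        case F: False
        then have "f (Suc s) = 0" by (intro f_out) simp
        moreover have "f s + of_bool (b s) < k"
        proof (cases "s < 1 + n")
          case True
          with R False show ?thesis by auto
        next
          case False
          then show ?thesis using f_out[of s] b_out[of s] k by simp
        qed
        ultimately show ?thesis by simp
      qed
    qed
    with 1 show ?L by blast
  qed
  have "ps \<in> obar_set k a n \<longleftrightarrow> (f 1 \<le> a - 1 \<and> (\<forall>s. f s + of_bool (b s) + f (Suc s) < k)) \<and>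
     (\<forall>s\<ge>1. letter_ok (vp s) (ep s) s (f s) (b s))"
    unfolding obar_set_def Bbar_set_def mem_Collect_eq dec difference_iff[OF o k] using o n
    by (simp add: f_def b_def)
  then show ?thesis unfolding caps lets acc by blast
qed

text \<open>No part exceeds n, so every overpartition of n is a word of length exactly n, padded
  with zero letters.\<close>

theorem Obar_words:
  assumes "1 \<le> a" "a \<le> k"
  shows "Obar k a n = card {w. length w = n \<and> accepts k False False a 1 w \<and> word_weight 1 w = n}"
proof -
  have o: "overpartition ps" "sum_list (map fst ps) = n" if "ps \<in> obar_set k a n" for ps
    using that by (auto simp: obar_set_def Bbar_set_def)
  have "bij_betw (to_word n) (obar_set k a n) {w. length w = n \<and> accepts k False False a 1 w \<and> word_weight 1 w = n}"
  proof (rule bij_betw_byWitness[where f' = "from_word 1"])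
    have fw: "from_word 1 (to_word n ps) = ps" if "ps \<in> obar_set k a n" for ps
    proof (rule from_word_to_word[OF o(1)[OF that]])
      fix p assume "p \<in> set ps"
      then show "fst p \<le> n" unfolding o(2)[OF that, symmetric] by (intro member_le_sum_list) auto
    qed
    then show "\<forall>ps \<in> obar_set k a n. from_word 1 (to_word n ps) = ps" by blast
    show "\<forall>w \<in> {w. length w = n \<and> accepts k False False a 1 w \<and> word_weight 1 w = n}. to_word n (from_word 1 w) = w"
      using to_word_from_word by blast
    show "to_word n ` obar_set k a n \<subseteq> {w. length w = n \<and> accepts k False False a 1 w \<and> word_weight 1 w = n}"
    proof (intro image_subsetI CollectI conjI)
      fix ps assume ps: "ps \<in> obar_set k a n"
      show "accepts k False False a 1 (to_word n ps)"
        using obar_set_iff[OF o[OF ps] assms] ps by blast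
      show "word_weight 1 (to_word n ps) = n"
        using sum_list_from_word[of 1 "to_word n ps"] o(2)[OF ps] unfolding fw[OF ps] by simp
    qed simp
    show "from_word 1 ` {w. length w = n \<and> accepts k False False a 1 w \<and> word_weight 1 w = n} \<subseteq> obar_set k a n"
    proof (intro image_subsetI)
      fix w assume w: "w \<in> {w. length w = n \<and> accepts k False False a 1 w \<and> word_weight 1 w = n}"
      have "sum_list (map fst (from_word 1 w)) = n" using w sum_list_from_word[of 1 w] by simp
      from obar_set_iff[OF overpartition_from_word[OF order_refl] this assms] to_word_from_word[of w n] w
      show "from_word 1 w \<in> obar_set k a n" by simp
    qed
  qed
  then show ?thesis using bij_betw_same_card unfolding Obar_def obar_set_def by blast
qed

section \<open>Counting accepted words by clusters and weight\<close>

fun word_marks :: "bool \<Rightarrow> (nat \<times> bool) list \<Rightarrow> nat" where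
  "word_marks e [] = 0"
| "word_marks e ((f, b) # w) = of_bool (new_mark e f b) + word_marks (new_mark e f b) w"

definition words :: "nat \<Rightarrow> nat \<Rightarrow> bool \<Rightarrow> bool \<Rightarrow> nat \<Rightarrow> nat \<Rightarrow> nat \<Rightarrow> nat \<Rightarrow> (nat \<times> bool) list set" where
  "words k n v e i j L m =
     {w. length w = n \<and> accepts k v e i j w \<and> word_marks e w = L \<and> word_weight j w = m}"

lemma words_0: "words k 0 v e i j L m = (if L = 0 \<and> m = 0 \<and> \<not> (v \<and> e \<and> odd j) then {[]} else {})"
  by (auto simp: words_def)

lemma words_Suc:
  "words k (Suc n) v e i j L m = (\<Union>(f, b) \<in> {..<i} \<times> UNIV.
     if step_ok k v e j L f b \<and> j * (f + of_bool b) \<le> m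
     then (\<lambda>w. (f, b) # w) ` words k n (v \<noteq> b) (new_mark e f b) (k - f - of_bool b) (Suc j)
       (L - of_bool (new_mark e f b)) (m - j * (f + of_bool b)) else {})" (is "?A = ?B")
proof (intro subset_antisym subsetI)
  fix x assume x: "x \<in> ?A"
  then obtain f b w where w: "x = (f, b) # w" by (cases x) (auto simp: words_def)
  from x show "x \<in> ?B"
    unfolding w by (intro UN_I[of "(f, b)"]) (auto simp: words_def step_ok_def)
next
  fix x assume "x \<in> ?B"
  then obtain f b where fb: "f < i" "x \<in> (if step_ok k v e j L f b \<and> j * (f + of_bool b) \<le> m
     then (\<lambda>w. (f, b) # w) ` words k n (v \<noteq> b) (new_mark e f b) (k - f - of_bool b) (Suc j)
       (L - of_bool (new_mark e f b)) (m - j * (f + of_bool b)) else {})" by auto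
  then have st: "step_ok k v e j L f b" "j * (f + of_bool b) \<le> m" by (auto split: if_splits)
  with fb obtain w where "x = (f, b) # w" "w \<in> words k n (v \<noteq> b) (new_mark e f b) (k - f - of_bool b) (Suc j)
       (L - of_bool (new_mark e f b)) (m - j * (f + of_bool b))" by auto
  with fb(1) st show "x \<in> ?A" by (auto simp: words_def step_ok_def)
qed

lemma card_words:
  "finite (words k n v e i j L m) \<and> of_nat (card (words k n v e i j L m)) = trunc_gf k n v e i j L $ m"
proof (induction n arbitrary: v e i j L m)
  case 0
  then show ?case by (auto simp: words_0)
next
  case (Suc n)
  let ?W = "\<lambda>(f, b). if step_ok k v e j L f b \<and> j * (f + of_bool b) \<le> m
     then (\<lambda>w. (f, b) # w) ` words k n (v \<noteq> b) (new_mark e f b) (k - f - of_bool b) (Suc j)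
       (L - of_bool (new_mark e f b)) (m - j * (f + of_bool b)) else {}"
  let ?t = "\<lambda>f b. if step_ok k v e j L f b
        then fps_X ^ (j * (f + of_bool b)) *
          trunc_gf k n (v \<noteq> b) (new_mark e f b) (k - f - of_bool b) (Suc j) (L - of_bool (new_mark e f b))
        else 0"
  have fin: "finite (?W p)" for p using Suc.IH by (cases p) auto
  have "card (words k (Suc n) v e i j L m) = (\<Sum>p \<in> {..<i} \<times> UNIV. card (?W p))"
    unfolding words_Suc using fin by (intro card_UN_disjoint) (auto split: if_splits)
  then have "of_nat (card (words k (Suc n) v e i j L m)) = (\<Sum>p \<in> {..<i} \<times> UNIV. of_nat (card (?W p)) :: rat)"
    by simp
  also have "\<dots> = (\<Sum>(f, b) \<in> {..<i} \<times> UNIV. ?t f b $ m)"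
  proof (intro sum.cong refl)
    fix p :: "nat \<times> bool"
    obtain f b where p: "p = (f, b)" by (cases p)
    show "of_nat (card (?W p)) = (case p of (f, b) \<Rightarrow> ?t f b $ m)"
      unfolding p prod.case
      using Suc.IH[of "v \<noteq> b" "new_mark e f b" "k - f - of_bool b" "Suc j" "L - of_bool (new_mark e f b)"
        "m - j * (f + of_bool b)"]
      by (cases "step_ok k v e j L f b"; cases "j * (f + of_bool b) \<le> m")
         (auto simp: fps_X_power_mult_nth card_image simp del: mult_Suc_right)
  qed
  also have "\<dots> = (\<Sum>f<i. \<Sum>b\<in>UNIV. ?t f b $ m)"
    by (simp add: sum.cartesian_product)
  also have "\<dots> = trunc_gf k (Suc n) v e i j L $ m"
    unfolding trunc_gf.simps fps_sum_nth ..
  finally show ?case using fin unfolding words_Suc by auto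
qed

text \<open>Each cluster has a 1-marked part of its own, so at most n clusters occur; n letters
  determine the coefficient of $q^n$ because sizes start at 1.\<close>

theorem Obar_over_gf:
  assumes "1 \<le> a" "a \<le> k"
  shows "of_nat (Obar k a n) = (\<Sum>L\<le>n. over_gf k False False a 1 L $ n)"
proof -
  have le: "word_marks e w \<le> word_weight j w" if "1 \<le> j" for e j w
    using that
  proof (induction e w arbitrary: j rule: word_marks.induct)
    case (2 e f b w)
    have "of_bool (new_mark e f b) \<le> 1 * (f + of_bool b)" by (auto simp: new_mark_def)
    also have "\<dots> \<le> j * (f + of_bool b)" using 2 by (intro mult_le_mono1)
    finally show ?case using 2(1)[of "Suc j"] by auto
  qed auto
  have "{w. length w = n \<and> accepts k False False a 1 w \<and> word_weight 1 w = n} =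
      (\<Union>L\<in>{..n}. words k n False False a 1 L n)"
  proof -
    have "word_marks False w \<le> n" if "word_weight 1 w = n" for w using le[of 1 False w] that by simp
    then show ?thesis unfolding words_def by blast
  qed
  moreover have "card (\<Union>L\<in>{..n}. words k n False False a 1 L n) = (\<Sum>L\<le>n. card (words k n False False a 1 L n))"
    using card_words by (intro card_UN_disjoint) (auto simp: words_def)
  ultimately have "of_nat (Obar k a n) = (\<Sum>L\<le>n. trunc_gf k n False False a 1 L $ n)"
    using card_words Obar_words[OF assms] by (simp add: of_nat_sum)
  also have "\<dots> = (\<Sum>L\<le>n. over_gf k False False a 1 L $ n)"
    using assms by (intro sum.cong refl over_gf_nth[symmetric]) auto
  finally show ?thesis .
qed

section \<open>Summation\<close>

lemma fps_X_power_dvd_iff: "fps_X ^ n dvd (p :: rat fps) \<longleftrightarrow> (\<forall>d<n. p $ d = 0)"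
proof
  assume "fps_X ^ n dvd p"
  then obtain r where "p = fps_X ^ n * r" by (elim dvdE)
  then show "\<forall>d<n. p $ d = 0" by (simp add: fps_X_power_mult_nth)
qed (auto intro: fps_X_power_dvdI)

lemma dist_fps_to_fls_le:
  assumes "\<And>d. d < n \<Longrightarrow> (p :: rat fps) $ d = r $ d"
  shows "dist (fps_to_fls p) (fps_to_fls r) \<le> inverse (2 ^ n)"
proof (cases "p = r")
  case False
  then have "n \<le> subdegree (p - r)" using assms by (intro subdegree_geI) auto
  moreover have "fps_to_fls p \<noteq> fps_to_fls r" using False by simp
  ultimately show ?thesis
    by (simp add: dist_fls_def fls_subdegree_fls_to_fps flip: fps_to_fls_minus)
qed simp

lemma fps_to_fls_tendsto:
  assumes "\<And>n d. d < n \<Longrightarrow> (p n :: rat fps) $ d = r $ d"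
  shows "(\<lambda>n. fps_to_fls (p n)) \<longlonglongrightarrow> fps_to_fls r"
proof (rule metric_tendsto_imp_tendsto[OF LIMSEQ_inverse_realpow_zero[of 2]])
  have "dist (fps_to_fls (p n)) (fps_to_fls r) \<le> dist (inverse (2 ^ n)) (0::real)" for n
    using dist_fps_to_fls_le[of n "p n" r] assms by simp
  then show "\<forall>\<^sub>F n in sequentially. dist (fps_to_fls (p n)) (fps_to_fls r) \<le> dist (inverse (2 ^ n)) (0::real)"
    by simp
qed simp

text \<open>Grouping by \<open>L\<close> makes the unordered convergence visible: below $q^n$ only
  the finitely many indices in \<open>C L\<close> with L < n count, whatever finite superset is
  summed.\<close>

lemma has_sum_fps_to_fls:
  fixes t :: "'a \<Rightarrow> rat fps"
  assumes A: "A = (\<Union>L. C L)" and fin: "\<And>L. finite (C L)"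
    and disj: "\<And>L M. L \<noteq> M \<Longrightarrow> C L \<inter> C M = {}"
    and dvd: "\<And>L x. x \<in> C L \<Longrightarrow> fps_X ^ L dvd t x"
    and g: "\<And>m. g $ m = (\<Sum>L\<le>m. (\<Sum>x \<in> C L. t x) $ m)"
  shows "((\<lambda>x. fps_to_fls (t x)) has_sum fps_to_fls g) A"
  unfolding has_sum_def tendsto_iff eventually_finite_subsets_at_top
proof (intro allI impI)
  fix e :: real assume "e > 0"
  then obtain n where n: "inverse (2 ^ n) < e"
    using LIMSEQ_inverse_realpow_zero[of 2] by (auto simp: LIMSEQ_iff dest!: spec[of _ e])
  let ?X = "\<Union>L\<in>{..n}. C L"
  show "\<exists>X. finite X \<and> X \<subseteq> A \<and> (\<forall>Y. finite Y \<and> X \<subseteq> Y \<and> Y \<subseteq> A \<longrightarrow>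
      dist (\<Sum>x\<in>Y. fps_to_fls (t x)) (fps_to_fls g) < e)"
  proof (intro exI[of _ ?X] conjI allI impI)
    show "finite ?X" using fin by auto
    show "?X \<subseteq> A" using A by auto
    fix Y assume Y: "finite Y \<and> ?X \<subseteq> Y \<and> Y \<subseteq> A"
    have s: "(\<Sum>x\<in>Y. fps_to_fls (t x)) = fps_to_fls (\<Sum>x\<in>Y. t x)"
      using conjunct1[OF Y] by (induction Y rule: finite_induct) auto
    have "(\<Sum>x\<in>Y. t x) $ d = g $ d" if d: "d < n" for d
    proof -
      have "(\<Sum>x\<in>Y. t x) $ d = (\<Sum>x\<in>Y. t x $ d)" by (simp add: fps_sum_nth)
      also have "\<dots> = (\<Sum>x\<in>(\<Union>L\<in>{..d}. C L). t x $ d)"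
      proof (intro sum.mono_neutral_right ballI)
        show "(\<Union>L\<in>{..d}. C L) \<subseteq> Y" using Y d by force
        fix x assume x: "x \<in> Y - (\<Union>L\<in>{..d}. C L)"
        then obtain L where "x \<in> C L" using Y A by auto
        then have "fps_X ^ L dvd t x" using dvd by blast
        moreover have "d < L" using x \<open>x \<in> C L\<close> by (meson DiffD2 UN_I atMost_iff not_le)
        ultimately show "t x $ d = 0" by (simp add: fps_X_power_dvd_iff)
      qed (use Y in auto)
      also have "\<dots> = (\<Sum>L\<le>d. \<Sum>x\<in>C L. t x $ d)"
        using fin disj by (intro sum.UNION_disjoint) auto
      also have "\<dots> = g $ d" unfolding g by (simp add: fps_sum_nth)
      finally show ?thesis .
    qed
    then have "dist (fps_to_fls (\<Sum>x\<in>Y. t x)) (fps_to_fls g) \<le> inverse (2 ^ n)"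
      by (rule dist_fps_to_fls_le)
    with n show "dist (\<Sum>x\<in>Y. fps_to_fls (t x)) (fps_to_fls g) < e" unfolding s by simp
  qed
qed

text \<open>For negative index, $(-q)_{-1} = (-q)_\infty / (-1)_\infty = 1/2$.\<close>

definition npoch_pred :: "nat \<Rightarrow> rat fps" where
  "npoch_pred L = (if L = 0 then fps_const (1 / 2) else npoch (L - 1))"

lemma fps_to_fls_prod: "fps_to_fls (prod f A) = (\<Prod>x\<in>A. fps_to_fls (f x))" for f :: "'a \<Rightarrow> rat fps"
  by (induction A rule: infinite_finite_induct) (auto simp: fls_times_fps_to_fls)

lemma fls_X_power: "fls_X ^ n = fps_to_fls (fps_X ^ n :: rat fps)"
  by (simp add: fps_to_fls_power)

lemma qpoch_qden: "qpoch (fls_X\<^sup>2) (fls_X\<^sup>2) (int m) = fps_to_fls (qden m)"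
proof -
  have "1 - fls_X\<^sup>2 * (fls_X\<^sup>2) ^ i = fps_to_fls (1 - fps_X ^ (2 * Suc i) :: rat fps)" for i
  proof -
    have "fls_X\<^sup>2 * (fls_X\<^sup>2) ^ i = (fls_X ^ (2 * Suc i) :: rat fls)"
      by (simp only: power_mult power_Suc)
    then show ?thesis by (simp only: fls_X_power fps_to_fls_minus fps_one_to_fls)
  qed
  then show ?thesis unfolding qpoch_def qden_def fps_to_fls_prod by simp
qed

lemma factor_fps: "1 - (- fls_X) * fls_X ^ i = fps_to_fls (1 + fps_X ^ Suc i :: rat fps)"
  by (simp add: fls_X_power fls_times_fps_to_fls)

lemma npoch_fps: "(\<Prod>i<n. 1 - (- fls_X) * fls_X ^ i) = fps_to_fls (npoch n)"
proof -
  have "npoch n = (\<Prod>i<n. 1 + fps_X ^ Suc i)"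
    unfolding npoch_def by (rule prod.reindex_bij_witness[of _ Suc "\<lambda>i. i - 1"]) auto
  then show ?thesis unfolding factor_fps by (simp only: fps_to_fls_prod)
qed

lemma npoch_nth_stable: "d \<le> n \<Longrightarrow> npoch n $ d = npoch d $ d"
proof (induction n rule: dec_induct)
  case (step n)
  have "npoch (Suc n) $ d = npoch n $ d + (npoch n * fps_X ^ Suc n) $ d"
    unfolding npoch_Suc by (simp add: distrib_left)
  also have "(npoch n * fps_X ^ Suc n) $ d = 0"
    using step by (simp add: fps_X_power_mult_right_nth del: power_Suc)
  finally show ?case using step by simp
qed simp

text \<open>The infinite product at -1 has the first factor 2, followed by the factors of the one at
  -q. Both converge as series since each coefficient of \<open>npoch n\<close> becomes
  constant.\<close>

lemma qpoch_inf_half: "qpoch_inf (- fls_X) (fls_X :: rat fls) / qpoch_inf (- fls_X * fls_X powi (- 1)) fls_X =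
  fps_to_fls (fps_const (1 / 2))"
proof -
  define l :: "rat fps" where "l = Abs_fps (\<lambda>m. npoch m $ m)"
  have l_nth: "npoch n $ d = l $ d" if "d \<le> n" for d n
    using npoch_nth_stable[OF that] by (simp add: l_def)
  have l0: "l \<noteq> 0"
  proof
    assume "l = 0"
    then have "l $ 0 = 0" by simp
    then show False by (simp add: l_def npoch_def)
  qed
  have 1: "qpoch_inf (- fls_X) (fls_X :: rat fls) = fps_to_fls l"
  proof -
    have "(\<lambda>n. fps_to_fls (npoch (Suc n))) \<longlonglongrightarrow> fps_to_fls l"
      by (rule fps_to_fls_tendsto) (simp add: l_nth)
    then have "(\<lambda>n. \<Prod>i\<le>n. 1 - (- fls_X) * fls_X ^ i) \<longlonglongrightarrow> fps_to_fls l"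
      unfolding npoch_fps[symmetric] lessThan_Suc_atMost .
    then have "(\<lambda>i. 1 - (- fls_X) * fls_X ^ i) has_prod fps_to_fls l"
      unfolding has_prod_def raw_has_prod_def using l0 by simp
    then show ?thesis unfolding qpoch_inf_def by (rule has_prod_unique[symmetric])
  qed
  have m1: "- fls_X * fls_X powi (- 1) = (- 1 :: rat fls)"
  proof -
    have "fls_X * fls_X powi (- 1) = (1 :: rat fls)"
      by (simp add: power_int_minus)
    then show ?thesis by simp
  qed
  have 2: "qpoch_inf (- 1) (fls_X :: rat fls) = fps_to_fls (2 * l)"
  proof -
    have p: "(\<Prod>i\<le>n. 1 - (- 1) * fls_X ^ i) = fps_to_fls (2 * npoch n)" for n
    proof -
      have "(\<Prod>i\<le>n. 1 - (- 1) * fls_X ^ i) = (2 :: rat fls) * (\<Prod>i<n. 1 - (- fls_X) * fls_X ^ i)"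
        unfolding lessThan_Suc_atMost[symmetric] prod.lessThan_Suc_shift by simp
      then show ?thesis unfolding npoch_fps by (simp add: fls_times_fps_to_fls)
    qed
    have "(\<lambda>n. fps_to_fls (2 * npoch n)) \<longlonglongrightarrow> fps_to_fls (2 * l)"
      by (rule fps_to_fls_tendsto) (simp add: l_nth numeral_fps_const)
    then have "(\<lambda>i. 1 - (- 1) * fls_X ^ i) has_prod fps_to_fls (2 * l)"
      unfolding has_prod_def raw_has_prod_def using l0 p by simp
    then show ?thesis unfolding qpoch_inf_def by (rule has_prod_unique[symmetric])
  qed
  have "fps_const (1 / 2) * (2 * l) = l" by (simp add: numeral_fps_const fps_const_mult_left fps_eq_iff)
  then have "fps_to_fls (fps_const (1 / 2)) * fps_to_fls (2 * l) = fps_to_fls l"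
    by (simp only: flip: fls_times_fps_to_fls)
  moreover have "fps_to_fls (2 * l) \<noteq> 0" using l0 by simp
  ultimately show ?thesis unfolding 1 m1 2 by (metis nonzero_mult_div_cancel_right)
qed

lemma qpoch_npoch_pred: "qpoch (- fls_X) fls_X (int L - 1) = fps_to_fls (npoch_pred L)"
proof (cases L)
  case 0
  then show ?thesis using qpoch_inf_half by (simp add: qpoch_def npoch_pred_def)
next
  case (Suc M)
  then show ?thesis using npoch_fps[of M] by (simp add: qpoch_def npoch_pred_def)
qed

lemma fls_divide_prod_qden:
  fixes x :: "rat fps"
  shows "fps_to_fls x / (\<Prod>i\<in>A. fps_to_fls (qden (n i))) = fps_to_fls (x * (\<Prod>i\<in>A. inverse (qden (n i))))"
proof -
  have "inverse (fps_to_fls (qden m)) = fps_to_fls (inverse (qden m))" for m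
    using qden_nth_0[of m] by (intro fls_inverse_fps_to_fls) (simp add: subdegree_eq_0_iff)
  then show ?thesis
    by (simp add: divide_inverse prod_inversef[symmetric] fls_times_fps_to_fls fps_to_fls_prod o_def)
qed

definition summand :: "nat \<Rightarrow> (nat \<Rightarrow> nat) \<Rightarrow> nat \<Rightarrow> nat \<Rightarrow> nat \<Rightarrow> rat fps" where
  "summand k n e0 e1 e2 = fps_X ^ e0 * (fps_X ^ e1 + fps_X ^ e2) * npoch_pred (N k n 1) *
     (\<Prod>r = 1..k - 1. inverse (qden (n r)))"

lemma summand_fls:
  "fls_X ^ e0 * (fls_X ^ e1 + fls_X ^ e2) * qpoch (- fls_X) fls_X (int (N k n 1) - 1) /
     (\<Prod>i = 1..k - 1. qpoch (fls_X\<^sup>2) (fls_X\<^sup>2) (int (n i))) = fps_to_fls (summand k n e0 e1 e2)"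
  unfolding qpoch_qden qpoch_npoch_pred summand_def
  unfolding fls_X_power
  by (simp only: fls_times_fps_to_fls[symmetric] fps_to_fls_plus[symmetric] fls_divide_prod_qden)

lemma N_1_comps: "n \<in> comps k L \<Longrightarrow> N k n 1 = L"
  by (simp add: comps_def N_def)

text \<open>Multiplication by $q^{L(L-1)/2}$, the power in \<open>over_gf_closed\<close>, turns the
  summands into multiples of \<open>msum_term\<close>.\<close>

lemma sum_summand:
  assumes a: "1 \<le> a" "a \<le> k"
    and e1: "\<And>n. n \<in> comps k L \<Longrightarrow> (\<Sum>{..<L}) + e0 n + e1 n =
      (\<Sum>i = 1..k - 1. (N k n i)\<^sup>2) + (\<Sum>r = 1..k - 1. free_exp False a 1 r * n r)"
    and e2: "\<And>n. n \<in> comps k L \<Longrightarrow> (\<Sum>{..<L}) + e0 n + e2 n =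
      (\<Sum>i = 1..k - 1. (N k n i)\<^sup>2) + (\<Sum>r = 1..k - 1. free_exp True (Suc a) 1 r * n r)"
  shows "(\<Sum>n\<in>comps k L. summand k n (e0 n) (e1 n) (e2 n)) = over_gf k False False a 1 L"
proof -
  have s: "fps_X ^ (\<Sum>{..<L}) * summand k n (e0 n) (e1 n) (e2 n) =
      npoch_pred L * (msum_term k (free_exp False a 1) n + msum_term k (free_exp True (Suc a) 1) n)"
    if "n \<in> comps k L" for n
    unfolding summand_def msum_term_def N_1_comps[OF that] e1[OF that, symmetric] e2[OF that, symmetric]
    by (simp add: power_add algebra_simps)
  have S: "fps_X ^ (\<Sum>{..<L}) * (\<Sum>n\<in>comps k L. summand k n (e0 n) (e1 n) (e2 n)) =
      npoch_pred L * (free_gf k False a 1 L + free_gf k True (Suc a) 1 L)"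
    unfolding free_gf_def msum_def sum.distrib[symmetric] sum_distrib_left
    by (intro sum.cong refl s)
  show ?thesis
  proof (cases L)
    case 0
    \<comment> \<open>At \<open>L = 0\<close> both multisums are 1, and the value 1/2 from the
      negative index reduces their sum to the single empty overpartition.\<close>
    have "fps_const (1 / 2) * 2 = (1 :: rat fps)" by (simp add: numeral_fps_const)
    then show ?thesis using S 0 over_gf_L0[of a k 1 False] a by (simp add: npoch_pred_def)
  next
    case (Suc M)
    have "fps_X ^ (\<Sum>{..<L}) * (\<Sum>n\<in>comps k L. summand k n (e0 n) (e1 n) (e2 n)) =
        fps_X ^ (\<Sum>{..<L}) * over_gf k False False a 1 L"
      using S over_gf_closed[OF a order_refl, of M False] unfolding Suc
      by (simp add: npoch_pred_def lessThan_Suc_atMost)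
    then show ?thesis by (rule fps_X_power_cancel)
  qed
qed

lemma has_sum_summand:
  assumes a: "1 \<le> a" "a \<le> k"
    and e0: "\<And>n. N k n 1 \<le> e0 n"
    and e1: "\<And>L n. n \<in> comps k L \<Longrightarrow> (\<Sum>{..<L}) + e0 n + e1 n =
      (\<Sum>i = 1..k - 1. (N k n i)\<^sup>2) + (\<Sum>r = 1..k - 1. free_exp False a 1 r * n r)"
    and e2: "\<And>L n. n \<in> comps k L \<Longrightarrow> (\<Sum>{..<L}) + e0 n + e2 n =
      (\<Sum>i = 1..k - 1. (N k n i)\<^sup>2) + (\<Sum>r = 1..k - 1. free_exp True (Suc a) 1 r * n r)"
  shows "((\<lambda>n. fps_to_fls (summand k n (e0 n) (e1 n) (e2 n))) has_sum Obar_gf k a) ({1..k - 1} \<rightarrow>\<^sub>E UNIV)"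
  unfolding Obar_gf_def
proof (rule has_sum_fps_to_fls[where C = "comps k"])
  show "{1..k - 1} \<rightarrow>\<^sub>E UNIV = (\<Union>L. comps k L)" by (auto simp: comps_def)
  show "comps k L \<inter> comps k M = {}" if "L \<noteq> M" for L M using that by (auto simp: comps_def)
  fix L n assume n: "n \<in> comps k L"
  have "fps_X ^ L dvd (fps_X ^ e0 n :: rat fps)"
    using e0[of n] N_1_comps[OF n] by (intro le_imp_power_dvd) simp
  then show "fps_X ^ L dvd summand k n (e0 n) (e1 n) (e2 n)"
    unfolding summand_def by (intro dvd_mult2)
next
  fix m
  show "Abs_fps (\<lambda>n. of_nat (Obar k a n)) $ m = (\<Sum>L\<le>m. (\<Sum>n\<in>comps k L. summand k n (e0 n) (e1 n) (e2 n)) $ m)"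
  proof -
    have "(\<Sum>n\<in>comps k L. summand k n (e0 n) (e1 n) (e2 n)) = over_gf k False False a 1 L" for L
      by (rule sum_summand[OF a]) (use e1 e2 in blast)+
    then show ?thesis using Obar_over_gf[OF a, of m] by (simp only: fps_nth_Abs_fps)
  qed
qed simp

section \<open>Comparison of the exponents\<close>

lemma sum_N_from:
  assumes "1 \<le> s"
  shows "(\<Sum>i = s..k - 1. N k n i) = (\<Sum>r = 1..k - 1. (Suc r - s) * n r)"
proof -
  have "(\<Sum>i = s..k - 1. N k n i) = (\<Sum>i = s..k - 1. \<Sum>r = 1..k - 1. if i \<le> r then n r else 0)"
    unfolding N_def using assms by (intro sum.cong refl sum.mono_neutral_cong_left) auto
  also have "\<dots> = (\<Sum>r = 1..k - 1. \<Sum>i = s..k - 1. if i \<le> r then n r else 0)"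
    by (rule sum.swap)
  also have "\<dots> = (\<Sum>r = 1..k - 1. (Suc r - s) * n r)"
  proof (intro sum.cong refl)
    fix r assume "r \<in> {1..k - 1}"
    then have "(\<Sum>i = s..k - 1. if i \<le> r then n r else 0) = (\<Sum>i \<in> {s..r}. n r)"
      by (intro sum.mono_neutral_cong_right) auto
    then show "(\<Sum>i = s..k - 1. if i \<le> r then n r else 0) = (Suc r - s) * n r" by simp
  qed
  finally show ?thesis .
qed

lemma N_as_sum: "1 \<le> a \<Longrightarrow> N k n a = (\<Sum>r = 1..k - 1. of_bool (a \<le> r) * n r)"
  unfolding N_def by (intro sum.mono_neutral_cong_left) auto

lemma sum_filter_as_sum:
  fixes n :: "nat \<Rightarrow> nat"
  assumes "1 \<le> s" "u \<le> k - 1"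
  shows "(\<Sum>i | i \<in> {s..u} \<and> P i. n i) = (\<Sum>r = 1..k - 1. of_bool (s \<le> r \<and> r \<le> u \<and> P r) * n r)"
  using assms by (intro sum.mono_neutral_cong_left) auto

text \<open>This absorbs the cost of the overlined parts: \<open>msum_term\<close> has $N_1^2$ where
  the theorem has $N_1(N_1+1)/2$.\<close>

lemma triangle: fixes L :: nat shows "(\<Sum>{..<L}) + L * (L + 1) div 2 = L\<^sup>2"
proof -
  have "2 * (\<Sum>{..<L}) = L * (L - 1)" by (induction L) (auto simp: algebra_simps)
  moreover have "even (L * (L + 1))" by simp
  ultimately have "2 * ((\<Sum>{..<L}) + L * (L + 1) div 2) = L * (L - 1) + L * (L + 1)" by simp
  also have "\<dots> = 2 * L\<^sup>2" by (cases L) (auto simp: power2_eq_square algebra_simps)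
  finally show ?thesis by simp
qed

lemma exponent_eq:
  assumes "n \<in> comps k L"
    and "X + Y = (\<Sum>r = 1..k - 1. c r * n r)"
  shows "(\<Sum>{..<L}) + (N k n 1 * (N k n 1 + 1) div 2 + (\<Sum>i = 2..k - 1. (N k n i)\<^sup>2) + X) + Y =
    (\<Sum>i = 1..k - 1. (N k n i)\<^sup>2) + (\<Sum>r = 1..k - 1. c r * n r)"
proof -
  have L: "N k n 1 = L" using N_1_comps[OF assms(1)] .
  have "(\<Sum>i = 1..k - 1. (N k n i)\<^sup>2) = L\<^sup>2 + (\<Sum>i = 2..k - 1. (N k n i)\<^sup>2)"
  proof (cases "1 \<le> k - 1")
    case True
    then have "{1..k - 1} = insert 1 {2..k - 1}" by auto
    then show ?thesis using L by simp
  next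
    \<comment> \<open>For k at most 1 there are no indices, and L = 0.\<close>
    case False
    then have "L = 0" using L by (simp add: N_def)
    with False show ?thesis by simp
  qed
  then show ?thesis unfolding L assms(2)[symmetric] using triangle[of L] by simp
qed

text \<open>These are coefficients of n_r: $N_{a+1} + ... + N_{k-1}$ gives r - a, truncated at 0,
  N_a gives 1 from r = a on, and the n_i of one parity below a supply the parity correction in
  \<open>free_exp\<close>.\<close>

lemma exponent_odd:
  assumes "odd a" "1 \<le> r"
  shows "(Suc r - (a + 1)) + (of_bool (a \<le> r) + of_bool (1 \<le> r \<and> r \<le> a - 2 \<and> odd r)) = free_exp False a 1 r"
    and "(Suc r - (a + 1)) + of_bool (2 \<le> r \<and> r \<le> a - 1 \<and> even r) = free_exp True (Suc a) 1 r"
proof -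
  obtain b where b: "a = 2 * b + 1" using assms(1) by (rule oddE)
  have f: "free_exp False a 1 r = of_bool (odd r) + 2 * ((r + 1 - a) div 2)"
    "free_exp True (Suc a) 1 r = of_bool (even r) + 2 * ((r - a) div 2)"
    using assms(1) by (simp_all add: free_exp_def stair_sum_def)
  show "(Suc r - (a + 1)) + (of_bool (a \<le> r) + of_bool (1 \<le> r \<and> r \<le> a - 2 \<and> odd r)) = free_exp False a 1 r"
    unfolding f unfolding b of_bool_def using assms(2) by presburger
  show "(Suc r - (a + 1)) + of_bool (2 \<le> r \<and> r \<le> a - 1 \<and> even r) = free_exp True (Suc a) 1 r"
    unfolding f unfolding b of_bool_def using assms(2) by presburger
qed

text \<open>At r = a the first exponent has to be 2, which forces N_a, not $N_{a+1}$, in the first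
  summand.\<close>

lemma exponent_even:
  assumes "even a" "1 \<le> a" "1 \<le> r"
  shows "(Suc r - a) + (of_bool (a \<le> r) + of_bool (1 \<le> r \<and> r \<le> a - 1 \<and> odd r)) = free_exp False a 1 r"
    and "(Suc r - a) + of_bool (2 \<le> r \<and> r \<le> a - 2 \<and> even r) = free_exp True (Suc a) 1 r"
proof -
  obtain b where b: "a = 2 * b" using assms(1) by (rule evenE)
  have f: "free_exp False a 1 r = of_bool (odd r) + 2 * ((r + 2 - a) div 2)"
    "free_exp True (Suc a) 1 r = of_bool (even r) + 2 * ((r + 1 - a) div 2)"
    using assms(1) by (simp_all add: free_exp_def stair_sum_def)
  show "(Suc r - a) + (of_bool (a \<le> r) + of_bool (1 \<le> r \<and> r \<le> a - 1 \<and> odd r)) = free_exp False a 1 r"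
    unfolding f unfolding b of_bool_def using assms(2,3) unfolding b by presburger
  show "(Suc r - a) + of_bool (2 \<le> r \<and> r \<le> a - 2 \<and> even r) = free_exp True (Suc a) 1 r"
    unfolding f unfolding b of_bool_def using assms(2,3) unfolding b by presburger
qed

theorem theorem2p2:
  fixes k a :: nat and q :: "rat fls"
  assumes "1 \<le> a" and "a \<le> k" and "q = fls_X"
  shows
    "(odd a \<longrightarrow>
       ((\<lambda>n.
           q ^ (N k n 1 * (N k n 1 + 1) div 2 + (\<Sum>i = 2..k - 1. (N k n i)\<^sup>2)
                + (\<Sum>i = a + 1..k - 1. N k n i))
           * (q ^ (N k n a + (\<Sum>i | i \<in> {1..a - 2} \<and> odd i. n i))
              + q ^ (\<Sum>i | i \<in> {2..a - 1} \<and> even i. n i))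
           * qpoch (- q) q (int (N k n 1) - 1)
           / (\<Prod>i = 1..k - 1. qpoch (q\<^sup>2) (q\<^sup>2) (int (n i))))
        has_sum Obar_gf k a) ({1..k - 1} \<rightarrow>\<^sub>E UNIV)) \<and>
     (even a \<longrightarrow>
       ((\<lambda>n.
           q ^ (N k n 1 * (N k n 1 + 1) div 2 + (\<Sum>i = 2..k - 1. (N k n i)\<^sup>2)
                + (\<Sum>i = a..k - 1. N k n i))
           * (q ^ (N k n a + (\<Sum>i | i \<in> {1..a - 1} \<and> odd i. n i))
              + q ^ (\<Sum>i | i \<in> {2..a - 2} \<and> even i. n i))
           * qpoch (- q) q (int (N k n 1) - 1)
           / (\<Prod>i = 1..k - 1. qpoch (q\<^sup>2) (q\<^sup>2) (int (n i))))
        has_sum Obar_gf k a) ({1..k - 1} \<rightarrow>\<^sub>E UNIV))"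
proof (intro conjI impI)
  \<comment> \<open>For convergence: the common power of q is already divisible by
    $q^{N_1}$.\<close>
  have N1: "N k n 1 \<le> N k n 1 * (N k n 1 + 1) div 2 + x + y" for n x y
  proof -
    have "2 * N k n 1 \<le> N k n 1 * (N k n 1 + 1)" by (cases "N k n 1") auto
    then show ?thesis by linarith
  qed
  {
    assume a: "odd a"
    have 1: "(Suc r - (a + 1)) + (of_bool (a \<le> r) + of_bool (1 \<le> r \<and> r \<le> a - 2 \<and> odd r)) = free_exp False a 1 r"
      if "1 \<le> r" for r
      by (rule exponent_odd(1)) (use a that assms(1) in auto)
    have 2: "(Suc r - (a + 1)) + of_bool (2 \<le> r \<and> r \<le> a - 1 \<and> even r) = free_exp True (Suc a) 1 r"
      if "1 \<le> r" for r
      by (rule exponent_odd(2)) (use a that assms(1) in auto)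
    show "((\<lambda>n.
           q ^ (N k n 1 * (N k n 1 + 1) div 2 + (\<Sum>i = 2..k - 1. (N k n i)\<^sup>2)
                + (\<Sum>i = a + 1..k - 1. N k n i))
           * (q ^ (N k n a + (\<Sum>i | i \<in> {1..a - 2} \<and> odd i. n i))
              + q ^ (\<Sum>i | i \<in> {2..a - 1} \<and> even i. n i))
           * qpoch (- q) q (int (N k n 1) - 1)
           / (\<Prod>i = 1..k - 1. qpoch (q\<^sup>2) (q\<^sup>2) (int (n i))))
        has_sum Obar_gf k a) ({1..k - 1} \<rightarrow>\<^sub>E UNIV)"
      unfolding assms(3) summand_fls
    proof (intro has_sum_summand assms(1,2) N1 exponent_eq)
      fix n :: "nat \<Rightarrow> nat"
      have f: "(\<Sum>i | i \<in> {1..a - 2} \<and> odd i. n i) = (\<Sum>r = 1..k - 1. of_bool (1 \<le> r \<and> r \<le> a - 2 \<and> odd r) * n r)"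
        "(\<Sum>i | i \<in> {2..a - 1} \<and> even i. n i) = (\<Sum>r = 1..k - 1. of_bool (2 \<le> r \<and> r \<le> a - 1 \<and> even r) * n r)"
        using assms(2) by (intro sum_filter_as_sum; simp)+
      have s: "(\<Sum>i = a + 1..k - 1. N k n i) = (\<Sum>r = 1..k - 1. (Suc r - (a + 1)) * n r)"
        by (rule sum_N_from) simp
      show "(\<Sum>i = a + 1..k - 1. N k n i) + (N k n a + (\<Sum>i | i \<in> {1..a - 2} \<and> odd i. n i)) =
          (\<Sum>r = 1..k - 1. free_exp False a 1 r * n r)"
        unfolding f s N_as_sum[OF assms(1)] sum.distrib[symmetric] add_mult_distrib[symmetric]
        by (rule sum.cong[OF refl], rule arg_cong2[where f = "(*)"], rule 1) auto
      show "(\<Sum>i = a + 1..k - 1. N k n i) + (\<Sum>i | i \<in> {2..a - 1} \<and> even i. n i) =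
          (\<Sum>r = 1..k - 1. free_exp True (Suc a) 1 r * n r)"
        unfolding f s sum.distrib[symmetric] add_mult_distrib[symmetric]
        by (rule sum.cong[OF refl], rule arg_cong2[where f = "(*)"], rule 2) auto
    qed
  }
  {
    assume a: "even a"
    have 1: "(Suc r - a) + (of_bool (a \<le> r) + of_bool (1 \<le> r \<and> r \<le> a - 1 \<and> odd r)) = free_exp False a 1 r"
      if "1 \<le> r" for r
      by (rule exponent_even(1)) (use a that assms(1) in auto)
    have 2: "(Suc r - a) + of_bool (2 \<le> r \<and> r \<le> a - 2 \<and> even r) = free_exp True (Suc a) 1 r"
      if "1 \<le> r" for r
      by (rule exponent_even(2)) (use a that assms(1) in auto)
    show "((\<lambda>n.
           q ^ (N k n 1 * (N k n 1 + 1) div 2 + (\<Sum>i = 2..k - 1. (N k n i)\<^sup>2)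
                + (\<Sum>i = a..k - 1. N k n i))
           * (q ^ (N k n a + (\<Sum>i | i \<in> {1..a - 1} \<and> odd i. n i))
              + q ^ (\<Sum>i | i \<in> {2..a - 2} \<and> even i. n i))
           * qpoch (- q) q (int (N k n 1) - 1)
           / (\<Prod>i = 1..k - 1. qpoch (q\<^sup>2) (q\<^sup>2) (int (n i))))
        has_sum Obar_gf k a) ({1..k - 1} \<rightarrow>\<^sub>E UNIV)"
      unfolding assms(3) summand_fls
    proof (intro has_sum_summand assms(1,2) N1 exponent_eq)
      fix n :: "nat \<Rightarrow> nat"
      have f: "(\<Sum>i | i \<in> {1..a - 1} \<and> odd i. n i) = (\<Sum>r = 1..k - 1. of_bool (1 \<le> r \<and> r \<le> a - 1 \<and> odd r) * n r)"
        "(\<Sum>i | i \<in> {2..a - 2} \<and> even i. n i) = (\<Sum>r = 1..k - 1. of_bool (2 \<le> r \<and> r \<le> a - 2 \<and> even r) * n r)"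
        using assms(2) by (intro sum_filter_as_sum; simp)+
      show "(\<Sum>i = a..k - 1. N k n i) + (N k n a + (\<Sum>i | i \<in> {1..a - 1} \<and> odd i. n i)) =
          (\<Sum>r = 1..k - 1. free_exp False a 1 r * n r)"
        unfolding f sum_N_from[OF assms(1)] N_as_sum[OF assms(1)] sum.distrib[symmetric] add_mult_distrib[symmetric]
        by (rule sum.cong[OF refl], rule arg_cong2[where f = "(*)"], rule 1) auto
      show "(\<Sum>i = a..k - 1. N k n i) + (\<Sum>i | i \<in> {2..a - 2} \<and> even i. n i) =
          (\<Sum>r = 1..k - 1. free_exp True (Suc a) 1 r * n r)"
        unfolding f sum_N_from[OF assms(1)] sum.distrib[symmetric] add_mult_distrib[symmetric]
        by (rule sum.cong[OF refl], rule arg_cong2[where f = "(*)"], rule 2) auto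
    qed
  }
qed

end
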